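(* The problem $\mathsf{CycleType}(1)$ belongs to the complexity class $\mathsf{L}$ (deterministic logarithmic space).
   Context: For $n\ge 1$, $\mathrm{Sym}(n)$ is the group of all permutations of $[n]=\{1,\dots,n\}$, and $\langle \pi_1,\dots,\pi_m\rangle\le \mathrm{Sym}(n)$ is the subgroup generated by $\pi_1,\dots,\pi_m$. If $\pi\in\mathrm{Sym}(n)$ is written as a product of pairwise disjoint cycles (fixpoints counted as cycles of length $1$) of lengths $\ell_1,\dots,\ell_k$, then the cycle type $\mathrm{ct}(\pi)$ is the multiset consisting of $\ell_1,\dots,\ell_k$. The problem $\mathsf{CycleType}$ is: given $\pi_1,\dots,\pi_m,\rho\in\mathrm{Sym}(n)$, is there an element $\pi\in\langle\pi_1,\dots,\pi_m\rangle$ with $\mathrm{ct}(\pi)=\mathrm{ct}(\rho)$? For a number $k$, $\mathsf{CycleType}(k)$ is the restriction of $\mathsf{CycleType}$ to inputs with $m\le k$ (so in $\mathsf{CycleType}(1)$ the permutation group is cyclic, given by a single generator). Input encoding: the unary encoding of $n$ is implicitly part of the input; permutations are given either in pointwise representation $[\pi(1),\dots,\pi(n)]$ or in cycle representation (a list of pairwise disjoint cycles); the two are interconvertible in logspace, so the choice does not matter. $\mathsf{L}$ is the class of all problems solvable on a deterministic Turing machine in logarithmic space. *)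

theory Defs
  imports
    "HOL-Algebra.Sym_Groups"
    "HOL-Combinatorics.Orbits"
    "HOL-Library.Landau_Symbols"
    Complex_Main
begin

section \<open>Deterministic Turing machines and logarithmic space\<close>

text \<open>
  Offline multi-tape machines: one two-way read-only input tape with end markers and a fixed
  number of read-write work tapes that are infinite to the right. States and work symbols are
  initial segments of the natural numbers, so that one can quantify over all machines; the work
  symbol 0 is the blank.
\<close>

datatype 'a input_symbol = LeftEnd | Letter 'a | RightEnd

datatype move = MoveLeft | Stay | MoveRight

record 'a tm =
  num_states :: nat
  num_symbols :: nat
  num_tapes :: nat
  start :: nat
  accept :: nat
  reject :: nat
  delta :: "nat \<Rightarrow> 'a input_symbol \<Rightarrow> nat list \<Rightarrow> nat \<times> move \<times> (nat \<times> move) list"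

definition wf_tm :: "'a tm \<Rightarrow> bool" where
  "wf_tm M \<longleftrightarrow>
     num_symbols M \<ge> 1 \<and>
     start M < num_states M \<and> accept M < num_states M \<and> reject M < num_states M \<and>
     accept M \<noteq> reject M \<and>
     (\<forall>q < num_states M. \<forall>a gs. length gs = num_tapes M \<longrightarrow> set gs \<subseteq> {..<num_symbols M} \<longrightarrow>
        (case delta M q a gs of (q', d, acts) \<Rightarrow>
           q' < num_states M \<and> length acts = num_tapes M \<and> fst ` set acts \<subseteq> {..<num_symbols M}))"

text \<open>
  A work tape is its contents together with its head position. In a configuration
  \<open>(q, i, ts)\<close>, the input head position \<open>i\<close> is 0 on the left marker, \<open>1, \<dots>, |w|\<close> on the
  letters of the input \<open>w\<close>, and \<open>|w| + 1\<close> on the right marker.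
\<close>

type_synonym work_tape = "(nat \<Rightarrow> nat) \<times> nat"

type_synonym config = "nat \<times> nat \<times> work_tape list"

definition read_input :: "'a list \<Rightarrow> nat \<Rightarrow> 'a input_symbol" where
  "read_input w i =
     (if i = 0 then LeftEnd else if i \<le> length w then Letter (w ! (i - 1)) else RightEnd)"

text \<open>A head that is told to move off the left end of its tape stays where it is.\<close>

fun move_head :: "move \<Rightarrow> nat \<Rightarrow> nat" where
  "move_head MoveLeft i = i - 1"
| "move_head Stay i = i"
| "move_head MoveRight i = i + 1"

fun update_tape :: "nat \<times> move \<Rightarrow> work_tape \<Rightarrow> work_tape" where
  "update_tape (b, d) (t, h) = (t(h := b), move_head d h)"

fun tm_step :: "'a tm \<Rightarrow> 'a list \<Rightarrow> config \<Rightarrow> config" where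
  "tm_step M w (q, i, ts) =
     (if q = accept M \<or> q = reject M then (q, i, ts)
      else case delta M q (read_input w i) (map (\<lambda>(t, h). t h) ts) of
        (q', d, acts) \<Rightarrow> (q', min (move_head d i) (length w + 1), map2 update_tape acts ts))"

definition init_config :: "'a tm \<Rightarrow> config" where
  "init_config M = (start M, 0, replicate (num_tapes M) (\<lambda>_. 0, 0))"

definition config_at :: "'a tm \<Rightarrow> 'a list \<Rightarrow> nat \<Rightarrow> config" where
  "config_at M w t = (tm_step M w ^^ t) (init_config M)"

definition accepts :: "'a tm \<Rightarrow> 'a list \<Rightarrow> bool" where
  "accepts M w \<longleftrightarrow> (\<exists>t. fst (config_at M w t) = accept M)"

definition rejects :: "'a tm \<Rightarrow> 'a list \<Rightarrow> bool" where
  "rejects M w \<longleftrightarrow> (\<exists>t. fst (config_at M w t) = reject M)"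

definition decides :: "'a tm \<Rightarrow> 'a list set \<Rightarrow> bool" where
  "decides M A \<longleftrightarrow> (\<forall>w. (w \<in> A \<longrightarrow> accepts M w) \<and> (w \<notin> A \<longrightarrow> rejects M w))"

text \<open>
  Only work tapes count. As the number of tapes is a constant of the machine, bounding each tape
  separately is the same, up to a constant factor, as bounding the total number of visited cells.
\<close>

definition runs_in_space :: "'a tm \<Rightarrow> 'a list \<Rightarrow> nat \<Rightarrow> bool" where
  "runs_in_space M w s \<longleftrightarrow> (\<forall>t. \<forall>(_, h) \<in> set (snd (snd (config_at M w t))). h < s)"

definition DSPACE :: "(nat \<Rightarrow> real) \<Rightarrow> 'a::finite list set set" where
  "DSPACE f = {A. \<exists>M s. wf_tm M \<and> decides M A \<and>
     (\<forall>w. runs_in_space M w (s (length w))) \<and> (\<lambda>n. real (s n)) \<in> O(f)}"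

definition LOGSPACE :: "'a::finite list set set" where
  "LOGSPACE = DSPACE (\<lambda>n. log 2 (real n))"


section \<open>Cycle types\<close>

primrec prod_of_cycles :: "'a list list \<Rightarrow> 'a \<Rightarrow> 'a" where
  "prod_of_cycles [] = id"
| "prod_of_cycles (cs # css) = cycle_of_list cs \<circ> prod_of_cycles css"

definition cycle_decomposition_of :: "nat \<Rightarrow> (nat \<Rightarrow> nat) \<Rightarrow> nat list list \<Rightarrow> bool" where
  "cycle_decomposition_of n p css \<longleftrightarrow>
     [] \<notin> set css \<and> distinct (concat css) \<and> set (concat css) = {1..n} \<and>
     p = prod_of_cycles css"

definition cycle_type :: "nat \<Rightarrow> (nat \<Rightarrow> nat) \<Rightarrow> nat multiset" where
  "cycle_type n p = (THE M. \<exists>css. cycle_decomposition_of n p css \<and> M = mset (map length css))"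

text \<open>Every permutation has a cycle decomposition, and its cycle lengths are the orbit sizes.\<close>

lemma ex_cycle_decomposition_of:
  assumes "p permutes {1..n}"
  shows "\<exists>css. cycle_decomposition_of n p css"
proof -
  have "\<exists>css. [] \<notin> set css \<and> distinct (concat css) \<and> set (concat css) = I \<and>
          p = prod_of_cycles css"
    if "cycle_decomp I p" for I :: "nat set" and p
    using that
  proof induction
    case empty
    show ?case by (rule exI[of _ "[]"]) simp
  next
    case (comp I p cs)
    then obtain css where css: "[] \<notin> set css" "distinct (concat css)" "set (concat css) = I"
      "p = prod_of_cycles css" by blast
    show ?case
    proof (cases "cs = []")
      case True
      then have "cycle_of_list cs \<circ> p = p" by simp
      then show ?thesis using css True by (intro exI[of _ css]) (metis list.set(1) Un_empty_left)
    next
      case False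
      then show ?thesis using css comp.hyps by (intro exI[of _ "cs # css"]) auto
    qed
  qed
  then show ?thesis
    using cycle_decomposition[OF assms] unfolding cycle_decomposition_of_def by blast
qed

lemma prod_of_cycles_outside:
  "x \<notin> set (concat css) \<Longrightarrow> prod_of_cycles css x = x"
  by (induction css) (auto simp: id_outside_supp)

lemma prod_of_cycles_inside:
  assumes "distinct (concat css)" "cs \<in> set css" "x \<in> set cs"
  shows "prod_of_cycles css x = cycle_of_list cs x"
  using assms
proof (induction css)
  case (Cons ds css)
  show ?case
  proof (cases "x \<in> set ds")
    case True
    then have "x \<notin> set (concat css)" using Cons.prems by auto
    moreover have "cs = ds" using Cons.prems True by auto
    ultimately show ?thesis by (metis prod_of_cycles.simps(2) o_apply prod_of_cycles_outside)
  next
    case False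
    then have cs: "cs \<in> set css" using Cons.prems by auto
    then have "cycle_of_list cs x \<in> set cs"
      using Cons.prems permutes_in_image[OF cycle_permutes] by metis
    then have "cycle_of_list cs x \<notin> set ds" using Cons.prems cs by auto
    then have "cycle_of_list ds (cycle_of_list cs x) = cycle_of_list cs x"
      by (rule id_outside_supp)
    moreover have "prod_of_cycles css x = cycle_of_list cs x"
      using Cons cs by simp
    ultimately show ?thesis by (metis prod_of_cycles.simps(2) o_apply)
  qed
qed simp

lemma orbit_cycle_decomposition:
  assumes "cycle_decomposition_of n p css" "cs \<in> set css" "x \<in> set cs"
  shows "orbit p x = set cs"
proof -
  note d = assms(1)[unfolded cycle_decomposition_of_def]
  have dc: "distinct cs" using d assms(2) by (auto simp: distinct_concat_iff)
  have eq: "p y = cycle_of_list cs y" if "y \<in> set cs" for y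
  proof -
    have "prod_of_cycles css y = cycle_of_list cs y"
      using d assms(2) that by (intro prod_of_cycles_inside) simp_all
    then show ?thesis using d by metis
  qed
  have pow: "(p ^^ k) y = (cycle_of_list cs ^^ k) y \<and> (p ^^ k) y \<in> set cs" if "y \<in> set cs" for k y
  proof (induction k)
    case (Suc k)
    have "p ((p ^^ k) y) = cycle_of_list cs ((p ^^ k) y)" using Suc eq by blast
    moreover have "cycle_of_list cs ((p ^^ k) y) \<in> set cs"
      using Suc permutes_in_image[OF cycle_permutes] by metis
    ultimately show ?case using Suc by simp
  qed (use that in simp)
  have rot: "(p ^^ k) (cs ! i) = cs ! ((k + i) mod length cs)" if "i < length cs" for k i
  proof -
    have "(p ^^ k) (cs ! i) = map (cycle_of_list cs ^^ k) cs ! i"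
      using that pow[of "cs ! i" k] by simp
    also have "\<dots> = rotate k cs ! i" using cyclic_rotation[OF dc] by simp
    finally show ?thesis using that by (simp add: nth_rotate)
  qed
  obtain i where i: "i < length cs" "x = cs ! i" using assms(3) by (metis in_set_conv_nth)
  show ?thesis
  proof (intro equalityI subsetI)
    fix y assume "y \<in> orbit p x"
    then obtain k where "y = (p ^^ k) x" unfolding orbit_altdef by blast
    then show "y \<in> set cs" using pow[OF assms(3)] by blast
  next
    fix y assume "y \<in> set cs"
    then obtain j where j: "j < length cs" "y = cs ! j" by (metis in_set_conv_nth)
    define k where "k = length cs - i + j"
    have "k + i = length cs + j" using i by (simp add: k_def)
    then have "(p ^^ k) x = y" using rot[OF i(1), of k] i j by simp
    moreover have "k > 0" using i by (simp add: k_def)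
    ultimately show "y \<in> orbit p x" unfolding orbit_altdef by blast
  qed
qed

lemma cycle_decomposition_orbits:
  assumes "cycle_decomposition_of n p css"
  shows "mset (map length css) = image_mset card (mset_set (orbit p ` {1..n}))"
proof -
  note d = assms[unfolded cycle_decomposition_of_def]
  have dist: "distinct (concat css)" and ne: "[] \<notin> set css" using d by auto
  have "distinct (removeAll [] css)" and *: "\<And>xs. xs \<in> set css \<Longrightarrow> distinct xs"
    and **: "\<And>xs ys. xs \<in> set css \<Longrightarrow> ys \<in> set css \<Longrightarrow> xs \<noteq> ys \<Longrightarrow> set xs \<inter> set ys = {}"
    using dist unfolding distinct_concat_iff by blast+
  then have dcss: "distinct css" using ne by simp
  have inj: "inj_on set (set css)"
  proof (rule inj_onI)
    fix xs ys :: "nat list" assume a: "xs \<in> set css" "ys \<in> set css" "set xs = set ys"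
    have "xs \<noteq> []" using a(1) ne by auto
    then show "xs = ys" using **[OF a(1,2)] a(3) by (metis Int_absorb set_empty)
  qed
  have "orbit p ` {1..n} = set ` set css"
  proof -
    have "{1..n} = \<Union> (set ` set css)" using d by auto
    also have "orbit p ` \<dots> = set ` set css"
    proof (intro equalityI subsetI)
      fix X assume "X \<in> orbit p ` \<Union> (set ` set css)"
      then show "X \<in> set ` set css" using orbit_cycle_decomposition[OF assms] by auto
    next
      fix X assume "X \<in> set ` set css"
      then obtain cs where cs: "cs \<in> set css" "X = set cs" by auto
      then have "cs \<noteq> []" using ne by auto
      then have "hd cs \<in> set cs" by simp
      then show "X \<in> orbit p ` \<Union> (set ` set css)"
        using orbit_cycle_decomposition[OF assms cs(1)] cs by blast
    qed
    finally show ?thesis .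
  qed
  then have "image_mset card (mset_set (orbit p ` {1..n})) = image_mset (card \<circ> set) (mset css)"
    using dcss by (simp only: image_mset_mset_set[OF inj, symmetric] mset_set_set multiset.map_comp)
  also have "\<dots> = image_mset length (mset css)"
    by (rule image_mset_cong) (use * in \<open>auto simp: distinct_card\<close>)
  finally show ?thesis by simp
qed

lemma cycle_type_eq:
  assumes "cycle_decomposition_of n p css"
  shows "cycle_type n p = mset (map length css)"
  unfolding cycle_type_def using assms cycle_decomposition_orbits
  by (intro the_equality) (blast, metis)

lemma cycle_type_orbits:
  assumes "p permutes {1..n}"
  shows "cycle_type n p = image_mset card (mset_set (orbit p ` {1..n}))"
  using ex_cycle_decomposition_of[OF assms] cycle_type_eq cycle_decomposition_orbits by metis


section \<open>The cycle type problem\<close>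

definition CycleType_instances :: "(nat \<times> (nat \<Rightarrow> nat) list \<times> (nat \<Rightarrow> nat)) set" where
  "CycleType_instances = {(n, \<pi>s, \<rho>). n \<ge> 1 \<and> set \<pi>s \<subseteq> carrier (sym_group n) \<and>
     \<rho> \<in> carrier (sym_group n)}"

definition CycleType :: "(nat \<times> (nat \<Rightarrow> nat) list \<times> (nat \<Rightarrow> nat)) set" where
  "CycleType = {(n, \<pi>s, \<rho>) \<in> CycleType_instances.
     \<exists>\<pi> \<in> generate (sym_group n) (set \<pi>s). cycle_type n \<pi> = cycle_type n \<rho>}"

definition CycleType_upto :: "nat \<Rightarrow> (nat \<times> (nat \<Rightarrow> nat) list \<times> (nat \<Rightarrow> nat)) set" where
  "CycleType_upto k = {(n, \<pi>s, \<rho>) \<in> CycleType. length \<pi>s \<le> k}"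

text \<open>
  An instance is written as \<open>n\<close> in unary followed by the permutations in pointwise representation,
  with entries in binary, most significant bit first and without leading zeros:
  \<open>1\<dots>1 ; , \<pi>\<^sub>1(1) , \<dots> , \<pi>\<^sub>1(n) ; \<dots> ; , \<rho>(1) , \<dots> , \<rho>(n)\<close>. The last permutation is the target.
\<close>

datatype letter = Tick | Semicolon | Comma | Bit bool

instance letter :: finite
proof
  have "UNIV = {Tick, Semicolon, Comma} \<union> range Bit"
    by (auto intro: letter.exhaust)
  moreover have "finite ({Tick, Semicolon, Comma} \<union> range Bit)" by simp
  ultimately show "finite (UNIV :: letter set)" by simp
qed

fun binary :: "nat \<Rightarrow> letter list" where
  "binary n = (if n = 0 then [] else binary (n div 2) @ [Bit (odd n)])"

declare binary.simps [simp del]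

definition encode_perm :: "nat \<Rightarrow> (nat \<Rightarrow> nat) \<Rightarrow> letter list" where
  "encode_perm n \<pi> = concat (map (\<lambda>i. Comma # binary (\<pi> i)) [1..<n+1])"

fun encode :: "nat \<times> (nat \<Rightarrow> nat) list \<times> (nat \<Rightarrow> nat) \<Rightarrow> letter list" where
  "encode (n, \<pi>s, \<rho>) =
     replicate n Tick @ concat (map (\<lambda>\<pi>. Semicolon # encode_perm n \<pi>) (\<pi>s @ [\<rho>]))"

text \<open>The encoding is injective on instances.\<close>

lemma set_binary: "set (binary n) \<subseteq> range Bit"
  by (induction n rule: binary.induct) (subst binary.simps, auto)

lemma binary_inj: "binary m = binary n \<Longrightarrow> m = n"
proof (induction m arbitrary: n rule: binary.induct)
  case (1 m)
  show ?case
  proof (cases "m = 0 \<or> n = 0")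
    case True
    then show ?thesis using 1(2) by (auto simp: binary.simps[of m] binary.simps[of n] split: if_splits)
  next
    case False
    then have "binary (m div 2) = binary (n div 2)" "odd m = odd n"
      using 1(2) by (simp_all add: binary.simps[of m] binary.simps[of n])
    then have "m div 2 = n div 2" "m mod 2 = n mod 2"
      using 1(1) False by (blast, metis mod2_eq_if)
    then show ?thesis by (metis div_mult_mod_eq)
  qed
qed

lemma separated_inj:
  assumes "concat (map ((#) c) xss) = concat (map ((#) c) yss)"
    and "\<forall>xs \<in> set xss. c \<notin> set xs" "\<forall>ys \<in> set yss. c \<notin> set ys"
  shows "xss = yss"
  using assms
proof (induction xss arbitrary: yss)
  case Nil
  then show ?case by (cases yss) auto
next
  case (Cons xs xss)
  then obtain ys yss' where yss: "yss = ys # yss'" by (cases yss) auto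
  have tw: "takeWhile (\<lambda>a. a \<noteq> c) (zs @ concat (map ((#) c) zss)) = zs" if "c \<notin> set zs" for zs zss
  proof -
    have "\<forall>x\<in>set zs. x \<noteq> c" using that by auto
    then show ?thesis by (cases zss) (auto simp: takeWhile_append2)
  qed
  have eq: "xs @ concat (map ((#) c) xss) = ys @ concat (map ((#) c) yss')"
    using Cons.prems yss by simp
  have "xs = ys" using tw[of xs xss] tw[of ys yss'] eq Cons.prems yss by simp
  then show ?case using eq Cons.IH[of yss'] Cons.prems yss by simp
qed

lemma encode_perm_inj:
  assumes "encode_perm n \<pi> = encode_perm n \<sigma>" "\<pi> permutes {1..n}" "\<sigma> permutes {1..n}"
  shows "\<pi> = \<sigma>"
proof
  fix x
  have *: "map (\<lambda>i. binary (\<pi> i)) [1..<n+1] = map (\<lambda>i. binary (\<sigma> i)) [1..<n+1]"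
    by (rule separated_inj[of Comma])
       (use assms(1) set_binary in \<open>auto simp: encode_perm_def comp_def\<close>)
  then have "\<pi> x = \<sigma> x" if "x \<in> {1..n}"
  proof -
    have "x \<in> set [1..<n+1]" using that by auto
    then have "binary (\<pi> x) = binary (\<sigma> x)" using * by (metis map_eq_conv)
    then show ?thesis by (rule binary_inj)
  qed
  moreover have "\<pi> x = \<sigma> x" if "x \<notin> {1..n}"
    using that assms(2,3) by (simp add: permutes_not_in)
  ultimately show "\<pi> x = \<sigma> x" by blast
qed

lemma encode_inj_on: "inj_on encode CycleType_instances"
proof (rule inj_onI)
  fix a b assume a: "a \<in> CycleType_instances" "b \<in> CycleType_instances" "encode a = encode b"
  obtain n \<pi>s \<rho> m \<sigma>s \<tau> where ab: "a = (n, \<pi>s, \<rho>)" "b = (m, \<sigma>s, \<tau>)" by (metis prod_cases3)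
  have tw: "takeWhile (\<lambda>x. x = Tick) (encode (k, \<kappa>s, \<kappa>)) = replicate k Tick" for k \<kappa>s \<kappa>
  proof -
    have "takeWhile (\<lambda>x. x = Tick) (replicate k Tick @ ys) =
        replicate k Tick @ takeWhile (\<lambda>x. x = Tick) ys" for ys
      by (induction k) auto
    then show ?thesis by (cases \<kappa>s) auto
  qed
  have "replicate n Tick = replicate m Tick" using tw a(3) ab by metis
  then have nm: "n = m" by (metis length_replicate)
  have ns: "Semicolon \<notin> set (encode_perm k \<kappa>)" for k \<kappa>
    using set_binary by (auto simp: encode_perm_def)
  have "map (encode_perm n) (\<pi>s @ [\<rho>]) = map (encode_perm n) (\<sigma>s @ [\<tau>])"
    by (rule separated_inj[of Semicolon]) (use a(3) ab nm ns in \<open>auto simp: comp_def\<close>)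
  moreover have "inj_on (encode_perm n) {p. p permutes {1..n}}"
    using encode_perm_inj by (auto intro!: inj_onI)
  moreover have "set (\<pi>s @ [\<rho>]) \<union> set (\<sigma>s @ [\<tau>]) \<subseteq> {p. p permutes {1..n}}"
    using a(1,2) ab nm by (auto simp: CycleType_instances_def sym_group_carrier)
  ultimately have "\<pi>s @ [\<rho>] = \<sigma>s @ [\<tau>]"
    using inj_on_map_eq_map inj_on_subset by blast
  then show "a = b" using ab nm by simp
qed

end

theory Submission
  imports Defs "HOL-Computational_Algebra.Primes" "HOL-Algebra.Multiplicative_Group"
begin

text \<open>
  Let \<open>\<pi>\<close> be the generator (the identity if there is none) and \<open>\<rho>\<close> the target. A cycle of
  length \<open>l\<close> of \<open>\<pi>\<close> splits in \<open>\<pi> ^^ k\<close> into cycles of length \<open>l div gcd l k\<close>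
  (\<open>card_orbit_funpow\<close>), so only the exponents of the primes in \<open>k\<close>, capped by those in the
  cycle lengths, matter. If \<open>\<pi> ^^ k\<close> has the cycle type of \<open>\<rho>\<close>, these capped exponents can be
  read off: for a prime \<open>p\<close> let \<open>a\<close> and \<open>b\<close> be the largest exponents of \<open>p\<close> in a cycle length of
  \<open>\<pi>\<close> and of \<open>\<rho>\<close>; then \<open>b\<close> is \<open>a\<close> minus the exponent of \<open>p\<close> in \<open>k\<close>, or 0. Hence one may
  replace \<open>k\<close> by the product \<open>E\<close> of \<open>p\<close> to the number of prime powers \<open>p ^ j\<close>, \<open>j > 0\<close>, that divide a
  cycle length of \<open>\<pi>\<close> but none of \<open>\<rho>\<close>, and a single comparison of cycle types decides the
  problem (\<open>cycle_type_of_power\<close>). The number \<open>E\<close> is too long to be stored, but \<open>\<pi> ^^ E\<close> at a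
  point on a cycle of length \<open>l\<close> depends only on \<open>E mod l\<close>, which is obtained by iterated
  multiplication modulo \<open>l\<close>. Cycle types are compared by counting, for each length, the points on
  cycles of that length. All numbers that occur are at most
  the length of the input plus 1.
  
  To turn this into a Turing machine, a small language of expressions over numbers up to
  \<open>length w + 1\<close> is introduced, in which the only loop is an iteration with a bounded number of
  rounds. Every expression can be evaluated in logarithmic space (\<open>LOGSPACE_exp\<close>): it is compiled
  to a program with finitely many registers, and the registers are held in binary, one on each
  work tape, with the same number of digits. All heads of the machine move together, and a command
  is executed by one sweep over all digits and back (\<open>turing_machine\<close>), so the space used is the
  number of digits plus a constant, whatever the program does.
  
  It remains to write the decision procedure, including the parsing of the input, as an
  expression. The predicates \<open>logf\<close> and \<open>logp\<close> collect the functions and relations that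
  expressions describe; by their closure properties it suffices to write the procedure as an
  ordinary definition (\<open>accepted\<close>, \<open>logp_accepted\<close>) and to prove that it is right
  (\<open>accepted_iff\<close>).
\<close>

section \<open>Machines with an arbitrary finite control\<close>

definition control_step ::
  "('s \<Rightarrow> 'a input_symbol \<Rightarrow> nat list \<Rightarrow> 's \<times> move \<times> (nat \<times> move) list) \<Rightarrow> 's set \<Rightarrow> 'a list
     \<Rightarrow> 's \<times> nat \<times> work_tape list \<Rightarrow> 's \<times> nat \<times> work_tape list" where
  "control_step \<delta> F w = (\<lambda>(q, i, ts).
     if q \<in> F then (q, i, ts)
     else case \<delta> q (read_input w i) (map (\<lambda>(t, h). t h) ts) of
       (q', d, acts) \<Rightarrow> (q', min (move_head d i) (length w + 1), map2 update_tape acts ts))"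

text \<open>
  States of a machine are numbers; a bijection between the finite control and an initial segment
  of the numbers allows structured states instead. Closedness of \<open>Q\<close> is required for all lists of
  symbols, which spares an invariant about the contents of the tapes.
\<close>

lemma tm_of_finite_control:
  fixes \<delta> :: "'s \<Rightarrow> 'a input_symbol \<Rightarrow> nat list \<Rightarrow> 's \<times> move \<times> (nat \<times> move) list"
  assumes Q: "finite Q" "s0 \<in> Q" "qa \<in> Q" "qr \<in> Q" "qa \<noteq> qr" and S: "S \<ge> 1"
    and closed: "\<And>q a gs. q \<in> Q \<Longrightarrow> fst (\<delta> q a gs) \<in> Q"
    and acts: "\<And>q a gs. q \<in> Q \<Longrightarrow> length gs = K \<Longrightarrow> set gs \<subseteq> {..<S} \<Longrightarrow>
       length (snd (snd (\<delta> q a gs))) = K \<and> fst ` set (snd (snd (\<delta> q a gs))) \<subseteq> {..<S}"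
  shows "\<exists>M enc. wf_tm M \<and> inj_on enc Q \<and> accept M = enc qa \<and> reject M = enc qr \<and>
    (\<forall>w t. fst ((control_step \<delta> {qa, qr} w ^^ t) (s0, 0, replicate K (\<lambda>_. 0, 0))) \<in> Q \<and>
       config_at M w t =
       apfst enc ((control_step \<delta> {qa, qr} w ^^ t) (s0, 0, replicate K (\<lambda>_. 0, 0))))"
proof -
  obtain enc where enc: "bij_betw enc Q {..<card Q}"
    using ex_bij_betw_finite_nat[OF Q(1)] by (auto simp: atLeast0LessThan)
  define dec where "dec = the_inv_into Q enc"
  have inj: "inj_on enc Q" using enc by (rule bij_betw_imp_inj_on)
  have dec: "dec (enc q) = q" if "q \<in> Q" for q
    unfolding dec_def using inj that by (rule the_inv_into_f_f)
  have encQ: "enc q < card Q" if "q \<in> Q" for q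
    using bij_betwE[OF enc] that by auto
  have decQ: "dec k \<in> Q" if "k < card Q" for k
    unfolding dec_def using enc that
    by (metis bij_betw_def lessThan_iff order_refl the_inv_into_into)
  define M where "M = \<lparr>num_states = card Q, num_symbols = S, num_tapes = K, start = enc s0,
     accept = enc qa, reject = enc qr, delta = (\<lambda>k a gs. apfst enc (\<delta> (dec k) a gs))\<rparr>"
  have wf: "wf_tm M"
    unfolding wf_tm_def
  proof (intro conjI allI impI)
    fix k a gs
    assume k: "k < num_states M" "length gs = num_tapes M" "set gs \<subseteq> {..<num_symbols M}"
    then have "dec k \<in> Q" using decQ by (simp add: M_def)
    then show "case delta M k a gs of (q', d, as) \<Rightarrow>
      q' < num_states M \<and> length as = num_tapes M \<and> fst ` set as \<subseteq> {..<num_symbols M}"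
      using closed[of "dec k" a gs] acts[of "dec k" gs a] k encQ
      by (auto simp: M_def split_beta)
  qed (use Q S encQ inj in \<open>auto simp: M_def inj_on_eq_iff\<close>)
  have "fst ((control_step \<delta> {qa, qr} w ^^ t) (s0, 0, replicate K (\<lambda>_. 0, 0))) \<in> Q \<and>
       config_at M w t =
       apfst enc ((control_step \<delta> {qa, qr} w ^^ t) (s0, 0, replicate K (\<lambda>_. 0, 0)))" for w t
  proof (induction t)
    case 0
    then show ?case using Q by (simp add: config_at_def init_config_def M_def)
  next
    case (Suc t)
    obtain q i ts where c: "(control_step \<delta> {qa, qr} w ^^ t) (s0, 0, replicate K (\<lambda>_. 0, 0)) = (q, i, ts)"
      by (metis prod_cases3)
    have q: "q \<in> Q" and e: "config_at M w t = (enc q, i, ts)" using Suc c by auto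
    have iff: "enc q = accept M \<longleftrightarrow> q = qa" "enc q = reject M \<longleftrightarrow> q = qr"
      using q Q inj by (auto simp: M_def inj_on_eq_iff)
    have "config_at M w (Suc t) = tm_step M w (enc q, i, ts)"
      using e by (simp add: config_at_def)
    also have "\<dots> = apfst enc (control_step \<delta> {qa, qr} w (q, i, ts))"
      using iff dec[OF q] by (auto simp: control_step_def M_def split_beta)
    also have "control_step \<delta> {qa, qr} w (q, i, ts) =
        (control_step \<delta> {qa, qr} w ^^ Suc t) (s0, 0, replicate K (\<lambda>_. 0, 0))"
      using c by simp
    finally have "config_at M w (Suc t) =
       apfst enc ((control_step \<delta> {qa, qr} w ^^ Suc t) (s0, 0, replicate K (\<lambda>_. 0, 0)))" .
    moreover have "fst (control_step \<delta> {qa, qr} w (q, i, ts)) \<in> Q"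
      using q closed[OF q] by (simp add: control_step_def split_beta)
    ultimately show ?case using c by simp
  qed
  then show ?thesis
    using wf inj by (intro exI[of _ M] exI[of _ enc]) (auto simp: M_def)
qed

section \<open>Machines that sweep over synchronised tapes\<close>

text \<open>
  All heads move together, so the cells with the same number on the \<open>K\<close> tapes form a column. Cell 0
  carries the marker 3 on every tape. The first tape is also a ruler: to the right of the marker its symbol
  is 1 or 2 on the columns in use and 0 behind them. One macro step consists of reading an input
  letter and moving the input head (\<open>home\<close>), a sweep to the right in which a finite transducer
  rewrites the columns (\<open>col\<close>), a last look at the first unused column, which may be put to use
  (\<open>fin\<close>), and the way back to the marker.
\<close>

datatype ('p, 'q) sweep_state = Boot | Home 'p | Sweep 'q | Return 'p

locale sweeper =
  fixes K :: nat
    and p0 :: 'p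
    and final :: "'p set"
    and home :: "'p \<Rightarrow> 'a input_symbol \<Rightarrow> move \<times> 'q"
    and col :: "'q \<Rightarrow> nat list \<Rightarrow> 'q \<times> nat list"
    and fin :: "'q \<Rightarrow> 'p \<times> nat list list"
  assumes K: "K \<ge> 1"
    and col_length: "\<And>q c. length c = K \<Longrightarrow> length (snd (col q c)) = K"
    and col_ruler: "\<And>q c. length c = K \<Longrightarrow> hd c \<in> {1, 2} \<Longrightarrow> hd (snd (col q c)) \<in> {1, 2}"
    and fin_good: "\<And>q. snd (fin q) = [] \<or> (\<exists>c. snd (fin q) = [c] \<and> length c = K \<and> hd c \<in> {1, 2})"
begin

fun sweep_delta :: "('p, 'q) sweep_state \<Rightarrow> 'a input_symbol \<Rightarrow> nat list \<Rightarrow>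
    ('p, 'q) sweep_state \<times> move \<times> (nat \<times> move) list" where
  "sweep_delta Boot a gs = (Home p0, Stay, map (\<lambda>_. (3, Stay)) gs)"
| "sweep_delta (Home p) a gs =
     (Sweep (snd (home p a)), fst (home p a), map (\<lambda>b. (b, MoveRight)) gs)"
| "sweep_delta (Sweep q) a gs =
     (if hd gs = 0
      then (Return (fst (fin q)), Stay,
            map (\<lambda>b. (b, MoveLeft)) (case snd (fin q) of [] \<Rightarrow> gs | c # _ \<Rightarrow> c))
      else (Sweep (fst (col q gs)), Stay, map (\<lambda>b. (b, MoveRight)) (snd (col q gs))))"
| "sweep_delta (Return p) a gs =
     (if hd gs = 3 then (Home p, Stay, map (\<lambda>b. (b, Stay)) gs)
      else (Return p, Stay, map (\<lambda>b. (b, MoveLeft)) gs))"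

fun scan :: "'q \<Rightarrow> nat list list \<Rightarrow> 'q \<times> nat list list" where
  "scan q [] = (q, [])"
| "scan q (c # cs) = (let (q', c') = col q c; (q'', cs') = scan q' cs in (q'', c' # cs'))"

definition macro_step :: "'a list \<Rightarrow> 'p \<times> nat \<times> nat list list \<Rightarrow> 'p \<times> nat \<times> nat list list" where
  "macro_step w = (\<lambda>(p, i, cs).
     if p \<in> final then (p, i, cs)
     else let (d, q) = home p (read_input w i); (q', cs') = scan q cs; (p', e) = fin q'
       in (p', min (move_head d i) (length w + 1), cs' @ e))"

definition tapes :: "nat list list \<Rightarrow> nat \<Rightarrow> work_tape list" where
  "tapes cs h = map (\<lambda>j. (\<lambda>i. if i = 0 then 3 else if i \<le> length cs then cs ! (i - 1) ! j else 0, h)) [0..<K]"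

definition columns :: "nat list list \<Rightarrow> bool" where
  "columns cs \<longleftrightarrow> (\<forall>c\<in>set cs. length c = K \<and> hd c \<in> {1, 2})"

abbreviation step where "step \<equiv> control_step sweep_delta (Home ` final)"

lemma read_tapes:
  assumes "columns cs"
  shows "map (\<lambda>(t, h). t h) (tapes cs h) =
     (if h = 0 then replicate K 3 else if h \<le> length cs then cs ! (h - 1) else replicate K 0)"
proof -
  have "length (cs ! (h - 1)) = K" if "h \<noteq> 0" "h \<le> length cs"
    using assms that by (auto simp: columns_def)
  then show ?thesis by (auto simp: tapes_def intro!: nth_equalityI)
qed

lemma keep_tapes:
  assumes "columns cs"
  shows "map2 update_tape (map (\<lambda>b. (b, d)) (map (\<lambda>(t, h). t h) (tapes cs h))) (tapes cs h) =
     tapes cs (move_head d h)"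
  by (auto simp: tapes_def fun_eq_iff intro!: nth_equalityI)

lemma write_tapes:
  assumes "length c = K"
  shows "map2 update_tape (map (\<lambda>b. (b, d)) c) (tapes (ls @ c' # rs) (Suc (length ls))) =
     tapes (ls @ c # rs) (move_head d (Suc (length ls)))"
proof (rule nth_equalityI)
  fix j assume "j < length (map2 update_tape (map (\<lambda>b. (b, d)) c) (tapes (ls @ c' # rs) (Suc (length ls))))"
  then have j: "j < K" by (simp add: tapes_def assms)
  have cell: "(ls @ c # rs) ! (i - Suc 0) = (if i = Suc (length ls) then c else (ls @ c' # rs) ! (i - Suc 0))"
    if "i \<noteq> 0" for i
    using that by (auto simp: nth_append nth_Cons')
  show "map2 update_tape (map (\<lambda>b. (b, d)) c) (tapes (ls @ c' # rs) (Suc (length ls))) ! j =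
     tapes (ls @ c # rs) (move_head d (Suc (length ls))) ! j"
    using j assms by (auto simp: tapes_def fun_eq_iff cell)
qed (use assms in \<open>simp add: tapes_def\<close>)

lemma append_tapes:
  assumes "length c = K"
  shows "map2 update_tape (map (\<lambda>b. (b, d)) c) (tapes cs (Suc (length cs))) =
     tapes (cs @ [c]) (move_head d (Suc (length cs)))"
  using assms by (auto simp: tapes_def nth_append fun_eq_iff intro!: nth_equalityI)

definition heads_below :: "nat \<Rightarrow> 's \<times> nat \<times> work_tape list \<Rightarrow> bool" where
  "heads_below s c \<longleftrightarrow> (\<forall>(_, h) \<in> set (snd (snd c)). h < s)"

lemma heads_below_tapes: "h < s \<Longrightarrow> heads_below s (q, i, tapes cs h)"
  by (auto simp: heads_below_def tapes_def)

definition run :: "'a list \<Rightarrow> nat \<Rightarrow> nat \<Rightarrow> ('p, 'q) sweep_state \<times> nat \<times> work_tape list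
    \<Rightarrow> ('p, 'q) sweep_state \<times> nat \<times> work_tape list \<Rightarrow> bool" where
  "run w s t c c' \<longleftrightarrow> (step w ^^ t) c = c' \<and> (\<forall>j\<le>t. heads_below s ((step w ^^ j) c))"

lemma run_refl: "heads_below s c \<Longrightarrow> run w s 0 c c"
  by (simp add: run_def)

lemma run_trans:
  assumes "run w s t c c'" "run w s t' c' c''"
  shows "run w s (t + t') c c''"
proof -
  have "heads_below s ((step w ^^ j) c)" if "j \<le> t + t'" for j
  proof (cases "j \<le> t")
    case False
    then have "(step w ^^ j) c = (step w ^^ (j - t)) ((step w ^^ t) c)"
      by (metis comp_apply funpow_add le_add_diff_inverse2 nat_le_linear)
    then show ?thesis using False assms that by (simp add: run_def)
  qed (use assms in \<open>simp add: run_def\<close>)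
  moreover have "(step w ^^ (t + t')) c = c''"
    using assms by (simp add: run_def add.commute[of t] funpow_add)
  ultimately show ?thesis by (simp add: run_def)
qed

lemma run_step:
  assumes "step w c = c'" "heads_below s c" "run w s t c' c''"
  shows "run w s (Suc t) c c''"
proof -
  have "run w s 1 c c'" using assms by (auto simp: run_def le_Suc_eq)
  then show ?thesis using run_trans assms(3) by fastforce
qed

lemma columns_append [simp]: "columns (xs @ ys) \<longleftrightarrow> columns xs \<and> columns ys"
  and columns_Cons [simp]: "columns (c # ys) \<longleftrightarrow> length c = K \<and> hd c \<in> {1, 2} \<and> columns ys"
  and columns_Nil [simp]: "columns []"
  by (auto simp: columns_def)

lemma scan_columns: "columns cs \<Longrightarrow> columns (snd (scan q cs)) \<and> length (snd (scan q cs)) = length cs"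
  using col_length col_ruler by (induction cs arbitrary: q) (auto simp: split_beta Let_def)

lemma fin_columns: "columns (snd (fin q))"
  using fin_good[of q] by (auto simp: columns_def)

lemma macro_columns: "columns (snd (snd c)) \<Longrightarrow> columns (snd (snd (macro_step w c)))"
  using scan_columns fin_columns by (simp add: macro_step_def split_beta Let_def)

text \<open>
  The columns \<open>ls\<close> have already been rewritten; the head stands on the first of the columns \<open>rs\<close>.
\<close>

lemma sweep_run:
  assumes "columns ls" "columns rs" "length (ls @ rs) + 1 < s" "i \<le> length w + 1"
  shows "run w s (length rs) (Sweep q, i, tapes (ls @ rs) (Suc (length ls)))
     (Sweep (fst (scan q rs)), i,
      tapes (ls @ snd (scan q rs)) (Suc (length (ls @ rs))))"
  using assms
proof (induction rs arbitrary: ls q)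
  case Nil
  then show ?case by (auto intro: run_refl heads_below_tapes)
next
  case (Cons c rs)
  let ?c = "snd (col q c)" and ?q = "fst (col q c)"
  have c: "length c = K" "hd c \<in> {1, 2}" using Cons.prems by auto
  have c': "length ?c = K" "hd ?c \<in> {1, 2}" using col_length[OF c(1)] col_ruler[OF c] by auto
  have r: "map (\<lambda>(t, h). t h) (tapes (ls @ c # rs) (Suc (length ls))) = c"
    using Cons.prems by (subst read_tapes) auto
  have "step w (Sweep q, i, tapes (ls @ c # rs) (Suc (length ls))) =
     (Sweep ?q, i, tapes ((ls @ [?c]) @ rs) (Suc (length (ls @ [?c]))))"
    using c r write_tapes[OF c'(1), of MoveRight ls c rs] Cons.prems(4)
    by (auto simp: control_step_def)
  moreover have "run w s (length rs) (Sweep ?q, i, tapes ((ls @ [?c]) @ rs) (Suc (length (ls @ [?c]))))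
     (Sweep (fst (scan ?q rs)), i,
      tapes ((ls @ [?c]) @ snd (scan ?q rs)) (Suc (length ((ls @ [?c]) @ rs))))"
    by (rule Cons.IH) (use Cons.prems c' in auto)
  ultimately show ?case
    using Cons.prems(3) by (auto simp: split_beta Let_def intro!: run_step heads_below_tapes)
qed

lemma return_run:
  assumes "columns cs" "h \<le> length cs" "h < s" "i \<le> length w + 1"
  shows "run w s (Suc h) (Return p, i, tapes cs h) (Home p, i, tapes cs 0)"
  using assms
proof (induction h)
  case 0
  have "step w (Return p, i, tapes cs 0) = (Home p, i, tapes cs 0)"
    using read_tapes[OF 0(1), of 0] keep_tapes[OF 0(1), of Stay 0] K 0
    by (auto simp: control_step_def)
  then show ?case using 0 by (auto intro!: run_step run_refl heads_below_tapes)
next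
  case (Suc h)
  have "cs ! h \<in> set cs" using Suc.prems by simp
  then have "hd (cs ! h) \<noteq> 3" using Suc.prems(1) by (auto simp: columns_def)
  then have st: "step w (Return p, i, tapes cs (Suc h)) = (Return p, i, tapes cs h)"
    using read_tapes[OF Suc.prems(1), of "Suc h"] keep_tapes[OF Suc.prems(1), of MoveLeft "Suc h"] Suc.prems
    by (auto simp: control_step_def)
  have "run w s (Suc h) (Return p, i, tapes cs h) (Home p, i, tapes cs 0)"
    using Suc by simp
  from run_step[OF st heads_below_tapes this] show ?case using Suc.prems by simp
qed

lemma macro_run:
  assumes "columns cs" "length cs + 1 < s" "i \<le> length w + 1"
    and m: "macro_step w (p, i, cs) = (p', i', cs')"
  shows "\<exists>t>0. run w s t (Home p, i, tapes cs 0) (Home p', i', tapes cs' 0)"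
proof (cases "p \<in> final")
  case True
  then have "step w (Home p, i, tapes cs 0) = (Home p', i', tapes cs' 0)"
    using m by (simp add: control_step_def macro_step_def)
  then have "run w s (Suc 0) (Home p, i, tapes cs 0) (Home p', i', tapes cs' 0)"
    using m True assms(2) by (auto intro!: run_step run_refl heads_below_tapes simp: macro_step_def)
  then show ?thesis by blast
next
  case False
  define d q where "d = fst (home p (read_input w i))" and "q = snd (home p (read_input w i))"
  define cs1 q1 where "cs1 = snd (scan q cs)" and "q1 = fst (scan q cs)"
  have m': "p' = fst (fin q1)" "i' = min (move_head d i) (length w + 1)" "cs' = cs1 @ snd (fin q1)"
    using m False by (auto simp: macro_step_def split_beta Let_def d_def q_def cs1_def q1_def)
  have cs1: "columns cs1" "length cs1 = length cs"
    using scan_columns[OF assms(1), of q] by (auto simp: cs1_def)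
  have i': "i' \<le> length w + 1" using m' by simp
  have s1: "step w (Home p, i, tapes cs 0) = (Sweep q, i', tapes ([] @ cs) (Suc (length [])))"
    using False keep_tapes[OF assms(1), of MoveRight 0]
    by (auto simp: control_step_def m' d_def q_def)
  have s2: "run w s (length cs) (Sweep q, i', tapes ([] @ cs) (Suc (length [])))
     (Sweep q1, i', tapes cs1 (Suc (length cs)))"
    using sweep_run[of "[]" cs s i' w q] assms i' by (simp add: cs1_def q1_def)
  have rd: "map (\<lambda>(t, h). t h) (tapes cs1 (Suc (length cs1))) = replicate K 0"
    using read_tapes[OF cs1(1)] by simp
  have st: "step w (Sweep q1, i', tapes cs1 (Suc (length cs))) = (Return p', i', tapes cs' (length cs))"
  proof (cases "snd (fin q1)")
    case Nil
    then show ?thesis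
      using rd K keep_tapes[OF cs1(1), of MoveLeft "Suc (length cs)"] cs1 m' i'
      by (auto simp: control_step_def)
  next
    case (Cons c l)
    then have "snd (fin q1) = [c]" "length c = K" using fin_good[of q1] by auto
    then show ?thesis
      using rd K append_tapes[of c MoveLeft cs1] cs1 m' i'
      by (auto simp: control_step_def)
  qed
  have "columns cs'" using m' cs1 fin_columns by simp
  then have rt: "run w s (Suc (length cs)) (Return p', i', tapes cs' (length cs)) (Home p', i', tapes cs' 0)"
    using return_run[of cs' "length cs" s i' w p'] assms i' m' cs1 by simp
  have "Suc (length cs) < s" using assms(2) by simp
  note s3 = run_step[OF st heads_below_tapes[OF this] rt]
  have "0 < s" using assms(2) by simp
  from run_step[OF s1 heads_below_tapes[OF this] run_trans[OF s2 s3]] show ?thesis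
    by (intro exI[of _ "Suc (length cs + Suc (Suc (length cs)))"]) simp
qed

definition macro_config :: "'a list \<Rightarrow> nat \<Rightarrow> 'p \<times> nat \<times> nat list list" where
  "macro_config w k = (macro_step w ^^ k) (p0, 0, [])"

lemma macro_config_Suc: "macro_config w (Suc k) = macro_step w (macro_config w k)"
  by (simp add: macro_config_def)

lemma macro_config_good:
  "macro_config w k = (p, i, cs) \<Longrightarrow> columns cs \<and> i \<le> length w + 1"
proof (induction k arbitrary: p i cs)
  case 0
  then show ?case by (simp add: macro_config_def)
next
  case (Suc k)
  obtain p1 i1 cs1 where c: "macro_config w k = (p1, i1, cs1)" by (metis prod_cases3)
  have "columns cs1" "i1 \<le> length w + 1" using Suc.IH[OF c] by auto
  moreover have st: "macro_step w (p1, i1, cs1) = (p, i, cs)" using Suc.prems c by (simp add: macro_config_Suc)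
  ultimately show ?case
    using macro_columns[of "(p1, i1, cs1)" w]
    by (auto simp: macro_step_def split_beta Let_def split: if_splits)
qed

text \<open>
  Each macro step takes at least one step, so \<open>k\<close> macro steps cover the first \<open>k\<close> steps of the
  machine. A bound on the width after each macro step is therefore a bound on the space at all times.
\<close>

lemma macro_config_run:
  assumes "\<And>k. length (snd (snd (macro_config w k))) + 1 < s"
  shows "\<exists>t\<ge>k. run w s t (Home p0, 0, tapes [] 0)
    (Home (fst (macro_config w k)), fst (snd (macro_config w k)), tapes (snd (snd (macro_config w k))) 0)"
proof (induction k)
  case 0
  have "run w s 0 (Home p0, 0, tapes [] 0) (Home p0, 0, tapes [] 0)"
    using assms[of 0] by (intro run_refl heads_below_tapes) (simp add: macro_config_def)
  then show ?case by (auto simp: macro_config_def)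
next
  case (Suc k)
  obtain p i cs where c: "macro_config w k = (p, i, cs)" by (metis prod_cases3)
  obtain p' i' cs' where c': "macro_config w (Suc k) = (p', i', cs')" by (metis prod_cases3)
  obtain t where t: "t \<ge> k" "run w s t (Home p0, 0, tapes [] 0) (Home p, i, tapes cs 0)"
    using Suc c by auto
  have "macro_step w (p, i, cs) = (p', i', cs')" using c c' macro_config_Suc by metis
  then obtain t' where "t' > 0" "run w s t' (Home p, i, tapes cs 0) (Home p', i', tapes cs' 0)"
    using macro_run macro_config_good[OF c] assms[of k] c by (metis snd_conv)
  with run_trans[OF t(2)] have "run w s (t + t') (Home p0, 0, tapes [] 0) (Home p', i', tapes cs' 0)"
    "Suc k \<le> t + t'" using t by auto
  then show ?case using c' by auto
qed

text \<open>
  Acceptance and space can be read off the macro steps alone: the machine accepts or rejects in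
  the home state of a final control, and between two macro steps its heads never pass the
  first unused column.
\<close>

theorem turing_machine:
  assumes fin: "finite P" "finite Q" "p0 \<in> P" "pa \<in> P" "pr \<in> P" and F: "final = {pa, pr}" "pa \<noteq> pr"
    and home: "\<And>p a. p \<in> P \<Longrightarrow> p \<notin> final \<Longrightarrow> snd (home p a) \<in> Q"
    and col: "\<And>q c. q \<in> Q \<Longrightarrow> fst (col q c) \<in> Q"
    and fin_P: "\<And>q. q \<in> Q \<Longrightarrow> fst (fin q) \<in> P"
    and col_sym: "\<And>q c. q \<in> Q \<Longrightarrow> length c = K \<Longrightarrow> set c \<subseteq> {..<4} \<Longrightarrow> set (snd (col q c)) \<subseteq> {..<4}"
    and fin_sym: "\<And>q c. c \<in> set (snd (fin q)) \<Longrightarrow> set c \<subseteq> {..<4}"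
    and width: "\<And>w k. length (snd (snd (macro_config w k))) + 1 < s (length w)"
    and dec: "\<And>w. \<exists>k. fst (macro_config w k) = (if w \<in> A then pa else pr)"
  shows "\<exists>M. wf_tm M \<and> decides M A \<and> (\<forall>w. runs_in_space M w (s (length w)))"
proof -
  let ?S = "{Boot} \<union> Home ` P \<union> Sweep ` Q \<union> Return ` P"
  define c0 :: "('p, 'q) sweep_state \<times> nat \<times> work_tape list" where
    "c0 = (Boot, 0, replicate K (\<lambda>_. 0, 0))"
  have ha: "Home ` final = {Home pa, Home pr}" using F by simp
  \<comment> \<open>in a final control \<open>home\<close> may lead out of \<open>Q\<close>, so the machine is told to stay there\<close>
  define \<delta> where "\<delta> q a gs = (if q \<in> Home ` final then (q, Stay, map (\<lambda>g. (g, Stay)) gs) else sweep_delta q a gs)" for q a gs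
  have \<delta>: "control_step \<delta> {Home pa, Home pr} w = step w" for w
    unfolding ha[symmetric] by (auto simp: control_step_def \<delta>_def)
  have \<delta>_closed: "fst (\<delta> q a gs) \<in> ?S" if "q \<in> ?S" for q a gs
  proof (cases "q \<in> Home ` final")
    case True
    then show ?thesis using that by (simp add: \<delta>_def)
  next
    case False
    then have "\<And>p. q = Home p \<Longrightarrow> p \<notin> final" by blast
    with False that show ?thesis
      using home col fin_P fin by (cases q) (simp_all add: \<delta>_def image_iff)
  qed
  have \<delta>_acts: "length (snd (snd (\<delta> q a gs))) = K \<and> fst ` set (snd (snd (\<delta> q a gs))) \<subseteq> {..<4}"
    if "q \<in> ?S" "length gs = K" "set gs \<subseteq> {..<4}" for q a gs
  proof (cases q)
    case (Sweep r)
    then have r: "r \<in> Q" using that by auto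
    show ?thesis
    proof (cases "hd gs = 0")
      case True
      then show ?thesis
        using Sweep that fin_good[of r] fin_sym[of _ r] by (force simp: \<delta>_def image_image)
    next
      case False
      then show ?thesis
        using Sweep that col_length[of gs r] col_sym[OF r, of gs]
        by (auto simp: \<delta>_def image_image)
    qed
  qed (use that in \<open>auto simp: \<delta>_def image_image\<close>)
  have "\<exists>M enc. wf_tm M \<and> inj_on enc ?S \<and> accept M = enc (Home pa) \<and> reject M = enc (Home pr) \<and>
    (\<forall>w t. fst ((control_step \<delta> {Home pa, Home pr} w ^^ t) (Boot, 0, replicate K (\<lambda>_. 0, 0))) \<in> ?S \<and>
       config_at M w t =
       apfst enc ((control_step \<delta> {Home pa, Home pr} w ^^ t) (Boot, 0, replicate K (\<lambda>_. 0, 0))))"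
    by (rule tm_of_finite_control[where S = 4]) (use fin F \<delta>_closed \<delta>_acts in auto)
  then obtain M enc where M: "wf_tm M" "inj_on enc ?S" "accept M = enc (Home pa)" "reject M = enc (Home pr)"
    and sim: "\<And>w t. fst ((step w ^^ t) c0) \<in> ?S" "\<And>w t. config_at M w t = apfst enc ((step w ^^ t) c0)"
    unfolding \<delta> c0_def by blast
  have boot: "step w c0 = (Home p0, 0, tapes [] 0)" for w
    by (auto simp: c0_def control_step_def tapes_def map_replicate_const zip_replicate fun_eq_iff
        intro!: nth_equalityI)
  have reach: "\<exists>t\<ge>k. run w (s (length w)) t c0
    (Home (fst (macro_config w k)), fst (snd (macro_config w k)), tapes (snd (snd (macro_config w k))) 0)" for w k
  proof -
    obtain t where "t \<ge> k" "run w (s (length w)) t (Home p0, 0, tapes [] 0)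
      (Home (fst (macro_config w k)), fst (snd (macro_config w k)), tapes (snd (snd (macro_config w k))) 0)"
      using macro_config_run[OF width] by blast
    moreover have "heads_below (s (length w)) c0"
      using width[of w 0] by (auto simp: heads_below_def c0_def)
    ultimately show ?thesis
      using run_step[OF boot] by (intro exI[of _ "Suc t"]) auto
  qed
  have "decides M A"
    unfolding decides_def
  proof (intro allI)
    fix w
    obtain k where k: "fst (macro_config w k) = (if w \<in> A then pa else pr)" using dec by blast
    obtain t where "run w (s (length w)) t c0
      (Home (fst (macro_config w k)), fst (snd (macro_config w k)), tapes (snd (snd (macro_config w k))) 0)"
      using reach by blast
    then have "fst (config_at M w t) = enc (Home (if w \<in> A then pa else pr))"
      using k by (simp add: sim run_def)
    then show "(w \<in> A \<longrightarrow> accepts M w) \<and> (w \<notin> A \<longrightarrow> rejects M w)"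
      using M by (auto simp: accepts_def rejects_def)
  qed
  moreover have "runs_in_space M w (s (length w))" for w
    unfolding runs_in_space_def
  proof
    fix t
    obtain t' c where "t' \<ge> t" "run w (s (length w)) t' c0 c" using reach by blast
    then have "heads_below (s (length w)) ((step w ^^ t) c0)" by (auto simp: run_def)
    then show "\<forall>(_, h)\<in>set (snd (snd (config_at M w t))). h < s (length w)"
      by (auto simp: sim heads_below_def)
  qed
  ultimately show ?thesis using M(1) by blast
qed

end

section \<open>Register programs on sweeping machines\<close>

text \<open>
  Register \<open>x\<close> is held on tape \<open>x\<close> in binary, the least significant digit in cell 1; the symbol 1
  stands for the digit 0 and the symbol 2 for the digit 1. Each command takes one macro step or
  consists of commands that do. The control is the stack of the commands that are still to be executed. It
  is preceded by a phase \<open>Init\<close>, in which the input is read once to count its length in register 0 and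
  to measure out the number of digits, and followed by a comparison of the registers 1 and 2.
\<close>

datatype 'a condition = EQ nat nat | SYM "'a input_symbol \<Rightarrow> bool"

datatype 'a command =
    INC nat | ZERO nat | COPY nat nat | LEFT | RIGHT
  | SEQ "'a command" "'a command"
  | IF "'a condition" "'a command" "'a command"
  | UNTIL "'a condition" "'a command"

datatype 'a control = Init | Run "'a command list" | Done bool

text \<open>
  The states of the sweeping transducer carry the control that follows. In \<open>IncP x b g p\<close>, \<open>b\<close> is
  the carry, and \<open>g\<close> says that a carry that runs past the last digit creates a new one; in
  \<open>EqP x y b p p'\<close>, \<open>b\<close> says that the registers have agreed so far.
\<close>

datatype 'a pass =
    NopP "'a control"
  | IncP nat bool bool "'a control"
  | ZeroP nat "'a control"
  | CopyP nat nat "'a control"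
  | EqP nat nat bool "'a control" "'a control"

fun test :: "'a condition \<Rightarrow> 'a control \<Rightarrow> 'a control \<Rightarrow> 'a input_symbol \<Rightarrow> 'a pass" where
  "test (EQ x y) p p' a = EqP x y True p p'"
| "test (SYM P) p p' a = NopP (if P a then p else p')"

fun com_home :: "'a command \<Rightarrow> 'a control \<Rightarrow> 'a input_symbol \<Rightarrow> move \<times> 'a pass" where
  "com_home prog Init a =
     (if a = RightEnd then (Stay, NopP (Run [prog])) else (MoveRight, IncP 0 True True Init))"
| "com_home prog (Done b) a = (Stay, NopP (Done b))"
| "com_home prog (Run []) a = (Stay, EqP 1 2 True (Done False) (Done True))"
| "com_home prog (Run (INC x # k)) a = (Stay, IncP x True False (Run k))"
| "com_home prog (Run (ZERO x # k)) a = (Stay, ZeroP x (Run k))"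
| "com_home prog (Run (COPY x y # k)) a = (Stay, CopyP x y (Run k))"
| "com_home prog (Run (LEFT # k)) a = (MoveLeft, NopP (Run k))"
| "com_home prog (Run (RIGHT # k)) a = (MoveRight, NopP (Run k))"
| "com_home prog (Run (SEQ c d # k)) a = (Stay, NopP (Run (c # d # k)))"
| "com_home prog (Run (IF b c d # k)) a = (Stay, test b (Run (c # k)) (Run (d # k)) a)"
| "com_home prog (Run (UNTIL b c # k)) a =
     (Stay, test b (Run k) (Run (c # UNTIL b c # k)) a)"

fun com_col :: "'a pass \<Rightarrow> nat list \<Rightarrow> 'a pass \<times> nat list" where
  "com_col (NopP p) c = (NopP p, c)"
| "com_col (IncP x b g p) c =
     (IncP x (b \<and> c ! x = 2) g p, if b then c[x := if c ! x = 2 then 1 else 2] else c)"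
| "com_col (ZeroP x p) c = (ZeroP x p, c[x := 1])"
| "com_col (CopyP x y p) c = (CopyP x y p, c[x := if c ! y = 2 then 2 else 1])"
| "com_col (EqP x y b p p') c = (EqP x y (b \<and> c ! x = c ! y) p p', c)"

fun com_fin :: "nat \<Rightarrow> 'a pass \<Rightarrow> 'a control \<times> nat list list" where
  "com_fin K (NopP p) = (p, [])"
| "com_fin K (IncP x b g p) = (p, if b \<and> g then [2 # replicate (K - 1) 1] else [])"
| "com_fin K (ZeroP x p) = (p, [])"
| "com_fin K (CopyP x y p) = (p, [])"
| "com_fin K (EqP x y b p p') = (if b then p else p', [])"

text \<open>
  The stacks that occur while a command is executed on top of a stack \<open>k\<close>, before \<open>k\<close> is reached.
  A loop pushes itself below its body, so a program has only finitely many of them.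
\<close>

fun continuations :: "'a command \<Rightarrow> 'a command list \<Rightarrow> 'a command list set" where
  "continuations (SEQ c d) k =
     insert (SEQ c d # k) (continuations c (d # k) \<union> continuations d k)"
| "continuations (IF b c d) k = insert (IF b c d # k) (continuations c k \<union> continuations d k)"
| "continuations (UNTIL b c) k =
     insert (UNTIL b c # k) (continuations c (UNTIL b c # k))"
| "continuations c k = {c # k}"

fun successors :: "'a command list \<Rightarrow> 'a command list set" where
  "successors [] = {}"
| "successors (SEQ c d # k) = {c # d # k}"
| "successors (IF b c d # k) = {c # k, d # k}"
| "successors (UNTIL b c # k) = {k, c # UNTIL b c # k}"
| "successors (c # k) = {k}"

lemma finite_continuations: "finite (continuations c k)"
  by (induction c k rule: continuations.induct) auto

lemma start_in_continuations: "c # k \<in> continuations c k"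
  by (cases c) auto

lemma continuations_closed:
  "ks \<in> continuations c k \<Longrightarrow> successors ks \<subseteq> insert k (continuations c k)"
proof (induction c k rule: continuations.induct)
  case (1 c d k)
  then show ?case
    using start_in_continuations[of c "d # k"] start_in_continuations[of d k] by auto
next
  case (2 b c d k)
  then show ?case
    using start_in_continuations[of c k] start_in_continuations[of d k] by auto
next
  case (3 b c k)
  then show ?case
    using start_in_continuations[of c "UNTIL b c # k"] by auto
qed auto

fun cond_regs :: "'a condition \<Rightarrow> nat set" where
  "cond_regs (EQ x y) = {x, y}"
| "cond_regs (SYM P) = {}"

fun com_regs :: "'a command \<Rightarrow> nat set" where
  "com_regs (INC x) = {x}"
| "com_regs (ZERO x) = {x}"
| "com_regs (COPY x y) = {x, y}"
| "com_regs LEFT = {}"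
| "com_regs RIGHT = {}"
| "com_regs (SEQ c d) = com_regs c \<union> com_regs d"
| "com_regs (IF b c d) = cond_regs b \<union> com_regs c \<union> com_regs d"
| "com_regs (UNTIL b c) = cond_regs b \<union> com_regs c"

lemma finite_com_regs: "finite (com_regs c)"
proof -
  have "finite (cond_regs b)" for b :: "'a condition" by (cases b) auto
  then show ?thesis by (induction c) auto
qed

lemma continuations_regs:
  "ks \<in> continuations c k \<Longrightarrow> c' \<in> set ks \<Longrightarrow> com_regs c' \<subseteq> com_regs c \<union> \<Union> (com_regs ` set k)"
  by (induction c k arbitrary: c' rule: continuations.induct) fastforce+

definition controls :: "'a command \<Rightarrow> 'a control set" where
  "controls prog = {Init, Run [], Done True, Done False} \<union> Run ` continuations prog []"

definition used_regs :: "'a command \<Rightarrow> nat set" where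
  "used_regs prog = {0, 1, 2} \<union> com_regs prog"

definition passes :: "'a command \<Rightarrow> 'a pass set" where
  "passes prog = (let P = controls prog; X = used_regs prog in
     NopP ` P \<union> (\<lambda>(x, b, g, p). IncP x b g p) ` (X \<times> UNIV \<times> UNIV \<times> P) \<union>
     (\<lambda>(x, p). ZeroP x p) ` (X \<times> P) \<union> (\<lambda>(x, y, p). CopyP x y p) ` (X \<times> X \<times> P) \<union>
     (\<lambda>(x, y, b, p, p'). EqP x y b p p') ` (X \<times> X \<times> UNIV \<times> P \<times> P))"

lemma finite_controls: "finite (controls prog)"
  by (simp add: controls_def finite_continuations)

lemma finite_passes: "finite (passes prog)"
  by (simp add: passes_def Let_def finite_controls finite_com_regs used_regs_def)

lemma in_passes [simp]:
  "NopP p \<in> passes prog \<longleftrightarrow> p \<in> controls prog"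
  "IncP x b g p \<in> passes prog \<longleftrightarrow> x \<in> used_regs prog \<and> p \<in> controls prog"
  "ZeroP x p \<in> passes prog \<longleftrightarrow> x \<in> used_regs prog \<and> p \<in> controls prog"
  "CopyP x y p \<in> passes prog \<longleftrightarrow> x \<in> used_regs prog \<and> y \<in> used_regs prog \<and> p \<in> controls prog"
  "EqP x y b p p' \<in> passes prog \<longleftrightarrow>
     x \<in> used_regs prog \<and> y \<in> used_regs prog \<and> p \<in> controls prog \<and> p' \<in> controls prog"
  by (auto simp: passes_def Let_def image_iff)

lemma com_home_passes:
  assumes p: "p \<in> controls prog"
  shows "snd (com_home prog p a) \<in> passes prog"
proof -
  have suc: "\<forall>l \<in> successors ks. Run l \<in> controls prog" if "Run ks \<in> controls prog" for ks
    using that continuations_closed[of ks prog "[]"] by (auto simp: controls_def)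
  have regs: "com_regs c \<subseteq> com_regs prog" if "Run (c # k) \<in> controls prog" for c k
    using that continuations_regs[of "c # k" prog "[]" c] by (auto simp: controls_def)
  have ctl: "Init \<in> controls prog" "Done b \<in> controls prog" "Run [prog] \<in> controls prog" for b
    using start_in_continuations[of prog "[]"] by (cases b; simp add: controls_def)+
  have test: "test b q q' a \<in> passes prog"
    if "cond_regs b \<subseteq> com_regs prog" "q \<in> controls prog" "q' \<in> controls prog" for b q q'
    using that by (cases b) (auto simp: used_regs_def)
  show ?thesis
  proof (cases p)
    case (Run ks)
    show ?thesis
    proof (cases ks)
      case Nil
      then show ?thesis using Run p ctl by (simp add: used_regs_def)
    next
      case (Cons c k)
      have "Run (c # k) \<in> controls prog" using p Run Cons by simp
      note r = regs[OF this] and s = suc[OF this]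
      show ?thesis
      proof (cases c)
        case (IF b c1 c2)
        then show ?thesis using r s test by (simp add: Run Cons)
      next
        case (UNTIL b c1)
        then show ?thesis using r s test by (simp add: Run Cons)
      qed (use r s in \<open>simp_all add: Run Cons used_regs_def\<close>)
    qed
  qed (use ctl in \<open>simp_all add: used_regs_def\<close>)
qed

lemma com_col_passes: "q \<in> passes prog \<Longrightarrow> fst (com_col q c) \<in> passes prog"
  by (cases q) auto

lemma com_fin_controls: "q \<in> passes prog \<Longrightarrow> fst (com_fin K q) \<in> controls prog"
  by (cases q) auto

locale register_machine =
  fixes K :: nat and prog :: "'a command"
  assumes K2: "2 < K"
begin

sublocale sweeper K Init "{Done True, Done False}" "com_home prog" com_col "com_fin K"
proof
  fix q :: "'a pass" and c :: "nat list"
  assume c: "length c = K"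
  show "length (snd (com_col q c)) = K"
    by (cases q) (use c in auto)
  assume "hd c \<in> {1, 2}"
  moreover have "hd (c[x := v]) = (if x = 0 then v else hd c)" for x v
    using c K2 by (cases c; cases x) auto
  ultimately show "hd (snd (com_col q c)) \<in> {1, 2}"
    by (cases q) auto
next
  fix q :: "'a pass"
  show "snd (com_fin K q) = [] \<or>
    (\<exists>c. snd (com_fin K q) = [c] \<and> length c = K \<and> hd c \<in> {1, 2})"
    by (cases q) (use K2 in auto)
qed (use K2 in auto)

text \<open>
  The digits of the registers. Digits above the \<open>m\<close>-th are cut off, so registers may be treated as
  unbounded numbers as long as comparisons are made modulo \<open>2 ^ m\<close>.
\<close>

fun cols :: "nat \<Rightarrow> (nat \<Rightarrow> nat) \<Rightarrow> nat list list" where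
  "cols 0 s = []"
| "cols (Suc m) s = map (\<lambda>x. if odd (s x) then 2 else 1) [0..<K] # cols m (\<lambda>x. s x div 2)"

lemma length_cols [simp]: "length (cols m s) = m"
  by (induction m arbitrary: s) auto

lemma cols_snoc:
  "cols (Suc m) s = cols m s @ [map (\<lambda>x. if odd (s x div 2 ^ m) then 2 else 1) [0..<K]]"
proof (induction m arbitrary: s)
  case (Suc m)
  show ?case
    by (subst cols.simps(2), subst Suc) (simp add: div_mult2_eq)
qed simp

lemma scan_NopP: "scan (NopP p) cs = (NopP p, cs)"
  by (induction cs) auto

lemma scan_ZeroP: "scan (ZeroP x p) (cols m s) = (ZeroP x p, cols m (s(x := 0)))"
proof (induction m arbitrary: s)
  case (Suc m)
  have "(map (\<lambda>y. if odd (s y) then 2 else 1) [0..<K])[x := 1] =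
    map (\<lambda>y. if odd ((s(x := 0)) y) then 2 else (1::nat)) [0..<K]"
    by (auto simp: nth_list_update intro!: nth_equalityI)
  moreover have "(\<lambda>y. s y div 2)(x := 0) = (\<lambda>y. (s(x := 0)) y div 2)" by auto
  ultimately show ?case using Suc[of "\<lambda>y. s y div 2"] by simp
qed simp

lemma scan_CopyP:
  assumes "y < K"
  shows "scan (CopyP x y p) (cols m s) = (CopyP x y p, cols m (s(x := s y)))"
proof (induction m arbitrary: s)
  case (Suc m)
  have "(map (\<lambda>z. if odd (s z) then 2 else 1) [0..<K])[x := if odd (s y) then 2 else 1] =
    map (\<lambda>z. if odd ((s(x := s y)) z) then 2 else (1::nat)) [0..<K]"
    by (auto simp: nth_list_update intro!: nth_equalityI)
  moreover have "(\<lambda>z. s z div 2)(x := s y div 2) = (\<lambda>z. (s(x := s y)) z div 2)" by auto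
  ultimately show ?case using Suc[of "\<lambda>y. s y div 2"] assms by (cases "odd (s y)") auto
qed simp

lemma scan_EqP:
  assumes "x < K" "y < K"
  shows "scan (EqP x y b p p') (cols m s) =
    (EqP x y (b \<and> s x mod 2 ^ m = s y mod 2 ^ m) p p', cols m s)"
proof (induction m arbitrary: s b)
  case (Suc m)
  have "u mod 2 ^ Suc m = v mod 2 ^ Suc m \<longleftrightarrow>
      odd u = odd v \<and> u div 2 mod 2 ^ m = v div 2 mod 2 ^ m" for u v :: nat
    unfolding take_bit_eq_mod[symmetric] take_bit_Suc
    by (auto simp: mod2_eq_if) presburger+
  then show ?case using Suc[where s = "\<lambda>y. s y div 2"] assms by auto
qed simp

text \<open>
  Adding 1 carries over all \<open>m\<close> digits exactly if they are all 1.
\<close>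

lemma scan_IncP:
  assumes "x < K"
  shows "scan (IncP x b g p) (cols m s) =
    (IncP x (b \<and> 2 ^ m dvd s x + 1) g p, cols m (s(x := s x + of_bool b)))"
proof (induction m arbitrary: s b)
  case (Suc m)
  have "(2 ^ Suc m dvd s x + 1) = (odd (s x) \<and> 2 ^ m dvd s x div 2 + 1)"
  proof (cases "odd (s x)")
    case True
    then have "s x + 1 = 2 * (s x div 2 + 1)" by presburger
    then show ?thesis using True by (metis dvd_times_left_cancel_iff power_Suc zero_neq_numeral)
  next
    case False
    then have "odd (s x + 1)" by simp
    then have "\<not> 2 ^ Suc m dvd s x + 1" by (metis dvd_mult_left power_Suc)
    then show ?thesis using False by simp
  qed
  moreover have "(map (\<lambda>z. if odd (s z) then 2 else 1) [0..<K])[x := if odd (s x) then 1 else 2] =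
    map (\<lambda>z. if odd ((s(x := s x + 1)) z) then 2 else (1::nat)) [0..<K]"
    by (auto simp: nth_list_update intro!: nth_equalityI)
  moreover have "(\<lambda>z. s z div 2)(x := s x div 2 + of_bool (b \<and> odd (s x))) =
    (\<lambda>z. (s(x := s x + of_bool b)) z div 2)"
    by (auto simp: fun_eq_iff)
  ultimately show ?case using Suc[where b = "b \<and> odd (s x)" and s = "\<lambda>y. s y div 2"] assms
    by (cases b) (auto simp: fun_upd_def)
qed simp

text \<open>
  Execution of a command with \<open>m\<close> digits, as a relation between registers and input head before
  and after. That the rest \<open>k\<close> of the stack is arbitrary makes it compositional.
\<close>

definition exec :: "'a list \<Rightarrow> nat \<Rightarrow> 'a command \<Rightarrow> (nat \<Rightarrow> nat) \<times> nat \<Rightarrow> (nat \<Rightarrow> nat) \<times> nat \<Rightarrow> bool" where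
  "exec w m c = (\<lambda>(s, i) (s', i'). i \<le> length w + 1 \<longrightarrow> i' \<le> length w + 1 \<and>
     (\<forall>k. \<exists>n. (macro_step w ^^ n) (Run (c # k), i, cols m s) = (Run k, i', cols m s')))"

lemma macro_step_control:
  assumes "p \<notin> {Done True, Done False}"
  shows "macro_step w (p, i, cs) = (let (d, q) = com_home prog p (read_input w i);
    (q', cs') = scan q cs; (p', e) = com_fin K q' in (p', min (move_head d i) (length w + 1), cs' @ e))"
  using assms by (simp add: macro_step_def)

lemma exec_single:
  assumes "\<And>k. i \<le> length w + 1 \<Longrightarrow>
    i' \<le> length w + 1 \<and> macro_step w (Run (c # k), i, cols m s) = (Run k, i', cols m s')"
  shows "exec w m c (s, i) (s', i')"
proof -
  have "\<exists>n. (macro_step w ^^ n) (Run (c # k), i, cols m s) = (Run k, i', cols m s')"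
    if "i \<le> length w + 1" for k
    using assms[OF that, of k] by (intro exI[of _ 1]) simp
  then show ?thesis using assms by (auto simp: exec_def)
qed

lemma exec_INC: "x < K \<Longrightarrow> exec w m (INC x) (s, i) (s(x := s x + 1), i)"
  by (rule exec_single) (simp add: macro_step_control scan_IncP Let_def)

lemma exec_ZERO: "exec w m (ZERO x) (s, i) (s(x := 0), i)"
  by (rule exec_single) (simp add: macro_step_control scan_ZeroP Let_def)

lemma exec_COPY: "y < K \<Longrightarrow> exec w m (COPY x y) (s, i) (s(x := s y), i)"
  by (rule exec_single) (simp add: macro_step_control scan_CopyP Let_def)

lemma exec_LEFT: "exec w m LEFT (s, i) (s, i - 1)"
  by (rule exec_single) (auto simp: macro_step_control scan_NopP Let_def)

lemma exec_RIGHT: "exec w m RIGHT (s, i) (s, min (i + 1) (length w + 1))"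
  by (rule exec_single) (auto simp: macro_step_control scan_NopP Let_def)

fun holds :: "'a list \<Rightarrow> nat \<Rightarrow> 'a condition \<Rightarrow> (nat \<Rightarrow> nat) \<times> nat \<Rightarrow> bool" where
  "holds w m (EQ x y) (s, i) \<longleftrightarrow> s x mod 2 ^ m = s y mod 2 ^ m"
| "holds w m (SYM P) (s, i) \<longleftrightarrow> P (read_input w i)"

lemma test_run:
  assumes "cond_regs b \<subseteq> {..<K}"
  shows "com_fin K (fst (scan (test b p p' (read_input w i)) (cols m s))) =
      (if holds w m b (s, i) then p else p', [])"
    and "snd (scan (test b p p' (read_input w i)) (cols m s)) = cols m s"
  using assms by (cases b; simp add: scan_EqP scan_NopP)+

text \<open>
  The common pattern of the compound commands: one macro step uncovers the part \<open>c'\<close>, which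
  is executed first and leaves the stack \<open>f k\<close>.
\<close>

lemma exec_chain:
  assumes step: "\<And>k. i \<le> length w + 1 \<Longrightarrow>
      macro_step w (Run (c # k), i, cols m s) = (Run (c' # f k), i, cols m s)"
    and c': "exec w m c' (s, i) (sa, ia)"
    and rest: "\<And>k. ia \<le> length w + 1 \<Longrightarrow>
      ib \<le> length w + 1 \<and> (\<exists>n. (macro_step w ^^ n) (Run (f k), ia, cols m sa) = (Run k, ib, cols m sb))"
  shows "exec w m c (s, i) (sb, ib)"
  unfolding exec_def prod.case
proof (intro impI conjI allI)
  assume i: "i \<le> length w + 1"
  then have ia: "ia \<le> length w + 1" using c' by (simp add: exec_def)
  show "ib \<le> length w + 1" using rest[OF ia] by blast
  fix k
  obtain n1 where n1: "(macro_step w ^^ n1) (Run (c' # f k), i, cols m s) = (Run (f k), ia, cols m sa)"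
    using c' i unfolding exec_def by fastforce
  obtain n2 where n2: "(macro_step w ^^ n2) (Run (f k), ia, cols m sa) = (Run k, ib, cols m sb)"
    using rest[OF ia] by blast
  have "(macro_step w ^^ (n2 + (n1 + 1))) (Run (c # k), i, cols m s) = (Run k, ib, cols m sb)"
    unfolding funpow_add using step[OF i] n1 n2 by simp
  then show "\<exists>n. (macro_step w ^^ n) (Run (c # k), i, cols m s) = (Run k, ib, cols m sb)" by blast
qed

lemma exec_rest:
  "exec w m c (s, i) (s', i') \<Longrightarrow> i \<le> length w + 1 \<Longrightarrow>
    i' \<le> length w + 1 \<and> (\<exists>n. (macro_step w ^^ n) (Run (c # k), i, cols m s) = (Run k, i', cols m s'))"
  by (simp add: exec_def)

lemma exec_SEQ:
  assumes "exec w m c \<sigma> \<sigma>'" "exec w m d \<sigma>' \<sigma>''"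
  shows "exec w m (SEQ c d) \<sigma> \<sigma>''"
proof -
  obtain s i s' i' s'' i'' where [simp]: "\<sigma> = (s, i)" "\<sigma>' = (s', i')" "\<sigma>'' = (s'', i'')"
    by (metis surj_pair)
  show ?thesis
    unfolding \<open>\<sigma> = _\<close> \<open>\<sigma>'' = _\<close>
    by (rule exec_chain[where c' = c and f = "\<lambda>k. d # k" and ia = i' and sa = s'])
      (use assms exec_rest[of w m d s' i' s'' i''] in \<open>auto simp: macro_step_control scan_NopP Let_def\<close>)
qed

lemma exec_IF:
  assumes "cond_regs b \<subseteq> {..<K}" "exec w m (if holds w m b \<sigma> then c else d) \<sigma> \<sigma>'"
  shows "exec w m (IF b c d) \<sigma> \<sigma>'"
proof -
  obtain s i s' i' where [simp]: "\<sigma> = (s, i)" "\<sigma>' = (s', i')" by (metis surj_pair)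
  show ?thesis
    unfolding \<open>\<sigma> = _\<close> \<open>\<sigma>' = _\<close>
    by (rule exec_chain[where c' = "if holds w m b \<sigma> then c else d" and f = "\<lambda>k. k" and ia = i' and sa = s'])
      (use assms test_run[OF assms(1)] in
        \<open>auto simp: macro_step_control Let_def split_beta intro!: exI[of _ 0]\<close>)
qed

lemma exec_UNTIL_stop:
  assumes "cond_regs b \<subseteq> {..<K}" "holds w m b \<sigma>"
  shows "exec w m (UNTIL b c) \<sigma> \<sigma>"
proof -
  obtain s i where [simp]: "\<sigma> = (s, i)" by (metis surj_pair)
  show ?thesis
    unfolding \<open>\<sigma> = _\<close>
    by (rule exec_single)
      (use assms test_run[OF assms(1)] in \<open>auto simp: macro_step_control Let_def split_beta\<close>)
qed

lemma exec_UNTIL_step: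
  assumes "cond_regs b \<subseteq> {..<K}" "\<not> holds w m b \<sigma>" "exec w m c \<sigma> \<sigma>'" "exec w m (UNTIL b c) \<sigma>' \<sigma>''"
  shows "exec w m (UNTIL b c) \<sigma> \<sigma>''"
proof -
  obtain s i s' i' s'' i'' where [simp]: "\<sigma> = (s, i)" "\<sigma>' = (s', i')" "\<sigma>'' = (s'', i'')"
    by (metis surj_pair)
  show ?thesis
    unfolding \<open>\<sigma> = _\<close> \<open>\<sigma>'' = _\<close>
    by (rule exec_chain[where c' = c and f = "\<lambda>k. UNTIL b c # k" and ia = i' and sa = s'])
      (use assms test_run[OF assms(1)] exec_rest[of w m "UNTIL b c" s' i' s'' i''] in
        \<open>auto simp: macro_step_control Let_def split_beta\<close>)
qed

text \<open>
  A loop rule for loops whose number \<open>n\<close> of rounds is known; \<open>I t\<close> holds after \<open>t\<close> rounds.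
\<close>

lemma exec_UNTIL_count:
  assumes b: "cond_regs b \<subseteq> {..<K}"
    and I0: "I 0 \<sigma>"
    and step: "\<And>t \<tau>. t < n \<Longrightarrow> I t \<tau> \<Longrightarrow> \<not> holds w m b \<tau> \<and> (\<exists>\<tau>'. exec w m c \<tau> \<tau>' \<and> I (Suc t) \<tau>')"
    and stop: "\<And>\<tau>. I n \<tau> \<Longrightarrow> holds w m b \<tau>"
  shows "\<exists>\<tau>. exec w m (UNTIL b c) \<sigma> \<tau> \<and> I n \<tau>"
proof -
  have "\<exists>\<tau>'. exec w m (UNTIL b c) \<tau> \<tau>' \<and> I n \<tau>'" if "t \<le> n" "I t \<tau>" for t \<tau>
    using that
  proof (induction t arbitrary: \<tau> rule: inc_induct)
    case base
    then show ?case using exec_UNTIL_stop[OF b] stop by blast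
  next
    case (step t)
    then show ?case using assms(3)[of t \<tau>] exec_UNTIL_step[OF b] by blast
  qed
  then show ?thesis using I0 by blast
qed

end

section \<open>An expression language for logarithmic space\<close>

fun iter :: "nat \<Rightarrow> (nat \<Rightarrow> 'b \<Rightarrow> 'b) \<Rightarrow> 'b \<Rightarrow> 'b" where
  "iter 0 f a = a"
| "iter (Suc n) f a = f n (iter n f a)"

text \<open>
  Expressions over an input \<open>w\<close>, with values up to \<open>length w + 1\<close>: the successor saturates there.
  Variables are de Bruijn indices. In \<open>EIter b s t\<close> the value of \<open>s\<close> is transformed \<open>t\<close> times by
  \<open>b\<close>, in which variable 0 is the value reached so far and variable 1 the number of the round.
\<close>

datatype 'a exp =
    EVar nat
  | EZero
  | EBound
  | ESuc "'a exp"
  | EIf "'a exp" "'a exp" "'a exp" "'a exp"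
  | ELetter "'a input_symbol \<Rightarrow> bool" "'a exp"
  | EIter "'a exp" "'a exp" "'a exp"

primrec eval :: "'a list \<Rightarrow> 'a exp \<Rightarrow> (nat \<Rightarrow> nat) \<Rightarrow> nat" where
  "eval w (EVar v) \<rho> = \<rho> v"
| "eval w EZero \<rho> = 0"
| "eval w EBound \<rho> = length w + 1"
| "eval w (ESuc e) \<rho> = min (eval w e \<rho> + 1) (length w + 1)"
| "eval w (EIf a b c d) \<rho> = (if eval w a \<rho> = eval w b \<rho> then eval w c \<rho> else eval w d \<rho>)"
| "eval w (ELetter P e) \<rho> = of_bool (P (read_input w (eval w e \<rho>)))"
| "eval w (EIter b s t) \<rho> =
     iter (eval w t \<rho>) (\<lambda>i acc. eval w b (case_nat acc (case_nat i \<rho>))) (eval w s \<rho>)"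

lemma eval_le:
  "\<forall>v. \<rho> v \<le> length w + 1 \<Longrightarrow> eval w e \<rho> \<le> length w + 1"
proof (induction e arbitrary: \<rho>)
  case (EIter b s t)
  let ?f = "\<lambda>i acc. eval w b (case_nat acc (case_nat i \<rho>))"
  have "n \<le> length w + 2 \<Longrightarrow> iter n ?f (eval w s \<rho>) \<le> length w + 1" for n
  proof (induction n)
    case 0
    then show ?case using EIter by simp
  next
    case (Suc n)
    have "\<forall>v. case_nat (iter n ?f (eval w s \<rho>)) (case_nat n \<rho>) v \<le> length w + 1"
      using Suc EIter.prems by (simp split: nat.split)
    then show ?case using EIter.IH(1) by simp
  qed
  moreover have "eval w t \<rho> \<le> length w + 1" using EIter by simp
  ultimately show ?case by simp
qed auto

text \<open>
  Evaluation into register \<open>d\<close>. Variable \<open>v\<close> is held in register \<open>env v < d\<close>, register 0 holds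
  \<open>length w + 1\<close>, and the registers below \<open>d\<close> are preserved. A letter is fetched by moving the
  input head to the left end and then as many steps to the right as register \<open>d\<close> says, counted in
  register \<open>d + 1\<close>.
\<close>

primrec compile :: "'a exp \<Rightarrow> (nat \<Rightarrow> nat) \<Rightarrow> nat \<Rightarrow> 'a command" where
  "compile (EVar v) env d = COPY d (env v)"
| "compile EZero env d = ZERO d"
| "compile EBound env d = COPY d 0"
| "compile (ESuc e) env d = SEQ (compile e env d) (IF (EQ d 0) (COPY d d) (INC d))"
| "compile (EIf a b c e) env d =
     SEQ (compile a env d) (SEQ (compile b env (d + 1))
       (IF (EQ d (d + 1)) (compile c env d) (compile e env d)))"
| "compile (ELetter P e) env d =
     SEQ (compile e env d) (SEQ (UNTIL (SYM (\<lambda>a. a = LeftEnd)) LEFT) (SEQ (ZERO (d + 1))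
       (SEQ (UNTIL (EQ (d + 1) d) (SEQ RIGHT (INC (d + 1))))
         (SEQ (ZERO d) (IF (SYM P) (INC d) (COPY d d))))))"
| "compile (EIter b s t) env d =
     SEQ (compile s env d) (SEQ (compile t env (d + 2)) (SEQ (ZERO (d + 1))
       (UNTIL (EQ (d + 1) (d + 2))
         (SEQ (compile b (case_nat d (case_nat (d + 1) env)) (d + 3))
           (SEQ (COPY d (d + 3)) (INC (d + 1)))))))"

primrec registers :: "'a exp \<Rightarrow> nat" where
  "registers (EVar v) = 1"
| "registers EZero = 1"
| "registers EBound = 1"
| "registers (ESuc e) = registers e"
| "registers (EIf a b c d) = registers a + registers b + registers c + registers d + 1"
| "registers (ELetter P e) = registers e + 2"
| "registers (EIter b s t) = registers b + registers s + registers t + 4"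

lemma registers_pos: "registers e > 0"
  by (induction e) auto

context register_machine
begin

lemma exec_compile:
  assumes "d + registers e \<le> K" "0 < d" "s 0 = length w + 1" "length w + 1 < 2 ^ m"
    and "\<forall>v. env v < d" "\<forall>v. s (env v) \<le> length w + 1" "i \<le> length w + 1"
  shows "\<exists>s' i'. exec w m (compile e env d) (s, i) (s', i') \<and> i' \<le> length w + 1 \<and>
    (\<forall>r<d. s' r = s r) \<and> s' d = eval w e (\<lambda>v. s (env v))"
  using assms
proof (induction e arbitrary: d env s i)
  case (EVar v)
  then have "env v < K" by (metis add_lessD1 le_trans less_le_trans nat_le_linear not_le registers_pos le_add1)
  then show ?case using EVar exec_COPY[of "env v" w m d s i]
    by (intro exI[of _ "s(d := s (env v))"] exI[of _ i]) (auto simp: fun_upd_def)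
next
  case EZero
  then show ?case using exec_ZERO[of w m d s i]
    by (intro exI[of _ "s(d := 0)"] exI[of _ i]) (auto simp: fun_upd_def)
next
  case EBound
  then show ?case using exec_COPY[of 0 w m d s i] K2
    by (intro exI[of _ "s(d := s 0)"] exI[of _ i]) (auto simp: fun_upd_def)
next
  case (ESuc e)
  obtain s1 i1 where 1: "exec w m (compile e env d) (s, i) (s1, i1)" "i1 \<le> length w + 1"
    "\<forall>r<d. s1 r = s r" "s1 d = eval w e (\<lambda>v. s (env v))"
    using ESuc.IH[of d s env i] ESuc.prems by auto
  let ?v = "eval w e (\<lambda>v. s (env v))"
  have le: "?v \<le> length w + 1" by (rule eval_le) (use ESuc.prems in simp)
  have d: "d < K" using ESuc.prems registers_pos[of e] by simp
  have h: "holds w m (EQ d 0) (s1, i1) \<longleftrightarrow> ?v = length w + 1"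
    using 1 ESuc.prems le by simp
  have "exec w m (if holds w m (EQ d 0) (s1, i1) then COPY d d else INC d) (s1, i1)
    (s1(d := min (?v + 1) (length w + 1)), i1)"
    unfolding h
    using exec_COPY[OF d, of w m d s1 i1] exec_INC[OF d, of w m s1 i1] 1(4) le
    by (auto simp: min_def)
  then have "exec w m (IF (EQ d 0) (COPY d d) (INC d)) (s1, i1)
    (s1(d := min (?v + 1) (length w + 1)), i1)"
    by (intro exec_IF) (use d K2 in auto)
  from exec_SEQ[OF 1(1) this] show ?case
    using 1 by (intro exI[of _ "s1(d := min (?v + 1) (length w + 1))"] exI[of _ i1])
      (auto simp: fun_upd_def)
next
  case (EIf a b c e)
  let ?\<rho> = "\<lambda>v. s (env v)"
  obtain s1 i1 where 1: "exec w m (compile a env d) (s, i) (s1, i1)" "i1 \<le> length w + 1"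
    "\<forall>r<d. s1 r = s r" "s1 d = eval w a ?\<rho>"
    using EIf.IH(1)[of d s env i] EIf.prems by auto
  have \<rho>1: "(\<lambda>v. s1 (env v)) = ?\<rho>" using 1 EIf.prems by auto
  have "\<exists>s' i'. exec w m (compile b env (d + 1)) (s1, i1) (s', i') \<and> i' \<le> length w + 1 \<and>
    (\<forall>r<d+1. s' r = s1 r) \<and> s' (d + 1) = eval w b (\<lambda>v. s1 (env v))"
    by (rule EIf.IH(2)) (use EIf.prems 1 in \<open>auto simp: less_SucI\<close>)
  then obtain s2 i2 where 2: "exec w m (compile b env (d + 1)) (s1, i1) (s2, i2)" "i2 \<le> length w + 1"
    "\<forall>r<d+1. s2 r = s1 r" "s2 (d + 1) = eval w b ?\<rho>"
    unfolding \<rho>1 by blast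
  have \<rho>2: "(\<lambda>v. s2 (env v)) = ?\<rho>" using 1 2 EIf.prems \<rho>1 by (auto simp: fun_eq_iff less_SucI)
  have s2d: "s2 d = eval w a ?\<rho>" using 1 2 by simp
  have le: "eval w a ?\<rho> \<le> length w + 1" "eval w b ?\<rho> \<le> length w + 1"
    by (rule eval_le, use EIf.prems in simp)+
  have h: "holds w m (EQ d (d + 1)) (s2, i2) \<longleftrightarrow> eval w a ?\<rho> = eval w b ?\<rho>"
    using 2 s2d le EIf.prems by simp
  have d: "d + 1 < K" using EIf.prems registers_pos[of a] registers_pos[of b] by simp
  have "\<exists>s' i'. exec w m (if holds w m (EQ d (d + 1)) (s2, i2) then compile c env d else compile e env d)
      (s2, i2) (s', i') \<and> i' \<le> length w + 1 \<and>
    (\<forall>r<d. s' r = s2 r) \<and> s' d = eval w (if eval w a ?\<rho> = eval w b ?\<rho> then c else e) (\<lambda>v. s2 (env v))"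
    unfolding h using EIf.IH(3)[of d s2 env i2] EIf.IH(4)[of d s2 env i2] EIf.prems 1 2 \<rho>2
    by (auto simp: fun_eq_iff)
  then obtain s3 i3 where 3: "exec w m (if holds w m (EQ d (d + 1)) (s2, i2) then compile c env d else compile e env d)
      (s2, i2) (s3, i3)" "i3 \<le> length w + 1"
    "\<forall>r<d. s3 r = s2 r" "s3 d = eval w (if eval w a ?\<rho> = eval w b ?\<rho> then c else e) ?\<rho>"
    unfolding \<rho>2 by blast
  have "exec w m (IF (EQ d (d + 1)) (compile c env d) (compile e env d)) (s2, i2) (s3, i3)"
    by (rule exec_IF[OF _ 3(1)]) (use d in auto)
  from exec_SEQ[OF 1(1) exec_SEQ[OF 2(1) this]] show ?case
    using 1 2 3 by (intro exI[of _ s3] exI[of _ i3]) auto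
next
  case (ELetter P e)
  let ?v = "eval w e (\<lambda>v. s (env v))"
  obtain s1 i1 where 1: "exec w m (compile e env d) (s, i) (s1, i1)" "i1 \<le> length w + 1"
    "\<forall>r<d. s1 r = s r" "s1 d = ?v"
    using ELetter.IH[of d s env i] ELetter.prems by auto
  have le: "?v \<le> length w + 1" by (rule eval_le) (use ELetter.prems in simp)
  have d: "d < K" "d + 1 < K" using ELetter.prems registers_pos[of e] by auto
  have "\<exists>\<tau>. exec w m (UNTIL (SYM (\<lambda>a. a = LeftEnd)) LEFT) (s1, i1) \<tau> \<and> \<tau> = (s1, i1 - i1)"
  proof (rule exec_UNTIL_count[where I = "\<lambda>t \<tau>. \<tau> = (s1, i1 - t)"])
    fix t \<tau> assume t: "t < i1" and \<tau>: "\<tau> = (s1, i1 - t)"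
    have "exec w m LEFT (s1, i1 - t) (s1, i1 - t - 1)" by (rule exec_LEFT)
    then show "\<not> holds w m (SYM (\<lambda>a. a = LeftEnd)) \<tau> \<and>
       (\<exists>\<tau>'. exec w m LEFT \<tau> \<tau>' \<and> \<tau>' = (s1, i1 - Suc t))"
      using t \<tau> by (auto simp: read_input_def)
  qed (auto simp: read_input_def)
  then have 2: "exec w m (UNTIL (SYM (\<lambda>a. a = LeftEnd)) LEFT) (s1, i1) (s1, 0)" by simp
  define s3 where "s3 = s1(d + 1 := 0)"
  have 3: "exec w m (ZERO (d + 1)) (s1, 0) (s3, 0)" unfolding s3_def by (rule exec_ZERO)
  have "\<exists>\<tau>. exec w m (UNTIL (EQ (d + 1) d) (SEQ RIGHT (INC (d + 1)))) (s3, 0) \<tau> \<and> \<tau> = (s1(d + 1 := ?v), ?v)"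
  proof (rule exec_UNTIL_count[where I = "\<lambda>t \<tau>. \<tau> = (s1(d + 1 := t), t)"])
    show "(s3, 0) = (s1(d + 1 := 0), 0)" by (simp add: s3_def)
    fix t \<tau> assume t: "t < ?v" and \<tau>: "\<tau> = (s1(d + 1 := t), t)"
    have "exec w m RIGHT (s1(d + 1 := t), t) (s1(d + 1 := t), min (t + 1) (length w + 1))"
      by (rule exec_RIGHT)
    moreover have "min (t + 1) (length w + 1) = Suc t" using t le by simp
    ultimately have "exec w m (SEQ RIGHT (INC (d + 1))) \<tau> (s1(d + 1 := Suc t), Suc t)"
      unfolding \<tau> using exec_INC[OF d(2), of w m "s1(d + 1 := t)" "Suc t"] by (auto intro: exec_SEQ)
    then show "\<not> holds w m (EQ (d + 1) d) \<tau> \<and>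
       (\<exists>\<tau>'. exec w m (SEQ RIGHT (INC (d + 1))) \<tau> \<tau>' \<and> \<tau>' = (s1(d + 1 := Suc t), Suc t))"
      using t \<tau> le 1 ELetter.prems by auto
  qed (use d 1 in auto)
  then have 4: "exec w m (UNTIL (EQ (d + 1) d) (SEQ RIGHT (INC (d + 1)))) (s3, 0) (s1(d + 1 := ?v), ?v)" by simp
  define s5 where "s5 = s1(d + 1 := ?v, d := 0)"
  have 5: "exec w m (ZERO d) (s1(d + 1 := ?v), ?v) (s5, ?v)" unfolding s5_def by (rule exec_ZERO)
  define s6 where "s6 = s5(d := of_bool (P (read_input w ?v)))"
  have "exec w m (if holds w m (SYM P) (s5, ?v) then INC d else COPY d d) (s5, ?v) (s6, ?v)"
    using exec_COPY[OF d(1), of w m d s5 ?v] exec_INC[OF d(1), of w m s5 ?v]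
    by (auto simp: s6_def s5_def)
  then have 6: "exec w m (IF (SYM P) (INC d) (COPY d d)) (s5, ?v) (s6, ?v)"
    by (intro exec_IF) auto
  from exec_SEQ[OF 1(1) exec_SEQ[OF 2 exec_SEQ[OF 3 exec_SEQ[OF 4 exec_SEQ[OF 5 6]]]]]
  show ?case using 1 le by (intro exI[of _ s6] exI[of _ ?v]) (auto simp: s6_def s5_def fun_upd_def)
next
  case (EIter b e t)
  let ?\<rho> = "\<lambda>v. s (env v)"
  obtain s1 i1 where 1: "exec w m (compile e env d) (s, i) (s1, i1)" "i1 \<le> length w + 1"
    "\<forall>r<d. s1 r = s r" "s1 d = eval w e ?\<rho>"
    using EIter.IH(2)[of d s env i] EIter.prems by auto
  have \<rho>1: "(\<lambda>v. s1 (env v)) = ?\<rho>" using 1 EIter.prems by auto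
  have "\<exists>s' i'. exec w m (compile t env (d + 2)) (s1, i1) (s', i') \<and> i' \<le> length w + 1 \<and>
    (\<forall>r<d+2. s' r = s1 r) \<and> s' (d + 2) = eval w t (\<lambda>v. s1 (env v))"
    by (rule EIter.IH(3)) (use EIter.prems 1 in \<open>auto simp: less_SucI\<close>)
  then obtain s2 i2 where 2: "exec w m (compile t env (d + 2)) (s1, i1) (s2, i2)" "i2 \<le> length w + 1"
    "\<forall>r<d+2. s2 r = s1 r" "s2 (d + 2) = eval w t ?\<rho>"
    unfolding \<rho>1 by blast
  define s3 where "s3 = s2(d + 1 := 0)"
  have 3: "exec w m (ZERO (d + 1)) (s2, i2) (s3, i2)" unfolding s3_def by (rule exec_ZERO)
  let ?n = "eval w t ?\<rho>" and ?env = "case_nat d (case_nat (d + 1) env)"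
  let ?body = "SEQ (compile b ?env (d + 3)) (SEQ (COPY d (d + 3)) (INC (d + 1)))"
  define f where "f = (\<lambda>i acc. eval w b (case_nat acc (case_nat i ?\<rho>)))"
  define I where "I k = (\<lambda>(s', i'). i' \<le> length w + 1 \<and> (\<forall>r<d. s' r = s r) \<and>
    s' d = iter k f (eval w e ?\<rho>) \<and> s' (d + 1) = k \<and> s' (d + 2) = ?n)" for k :: nat
  have n: "?n \<le> length w + 1" by (rule eval_le) (use EIter.prems in simp)
  have acc: "iter k f (eval w e ?\<rho>) \<le> length w + 1" if "k \<le> ?n" for k
  proof -
    show ?thesis
      using that
    proof (induction k)
      case 0
      then show ?case using eval_le[of ?\<rho> w e] EIter.prems by simp
    next
      case (Suc k)
      then have "\<forall>v. case_nat (iter k f (eval w e ?\<rho>)) (case_nat k ?\<rho>) v \<le> length w + 1"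
        using n EIter.prems by (simp split: nat.split)
      then show ?case unfolding iter.simps f_def by (rule eval_le)
    qed
  qed
  have d: "d + 3 < K" using EIter.prems registers_pos[of b] by simp
  have "\<exists>\<tau>. exec w m (UNTIL (EQ (d + 1) (d + 2)) ?body) (s3, i2) \<tau> \<and> I ?n \<tau>"
  proof (rule exec_UNTIL_count[where I = I])
    show "I 0 (s3, i2)" using 1 2 by (simp add: I_def s3_def)
  next
    fix k \<tau> assume k: "k < ?n" and I: "I k \<tau>"
    obtain s' i' where \<tau>: "\<tau> = (s', i')" by (metis surj_pair)
    have s': "i' \<le> length w + 1" "\<forall>r<d. s' r = s r" "s' d = iter k f (eval w e ?\<rho>)"
      "s' (d + 1) = k" "s' (d + 2) = ?n" using I \<tau> by (auto simp: I_def)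
    have env: "(\<lambda>v. s' (?env v)) = case_nat (s' d) (case_nat k ?\<rho>)"
      using s' EIter.prems(5) by (auto simp: fun_eq_iff split: nat.split)
    have "\<exists>s'' i''. exec w m (compile b ?env (d + 3)) (s', i') (s'', i'') \<and> i'' \<le> length w + 1 \<and>
      (\<forall>r<d+3. s'' r = s' r) \<and> s'' (d + 3) = eval w b (\<lambda>v. s' (?env v))"
    proof (rule EIter.IH(1))
      show "\<forall>v. ?env v < d + 3"
        using EIter.prems(5) by (auto split: nat.split intro: less_le_trans)
      show "\<forall>v. s' (?env v) \<le> length w + 1"
        using env s'(3) acc[of k] k n EIter.prems(6) by (simp add: fun_eq_iff split: nat.split)
    qed (use EIter.prems s' in auto)
    then obtain s4 i4 where 4: "exec w m (compile b ?env (d + 3)) (s', i') (s4, i4)"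
      "i4 \<le> length w + 1" "\<forall>r<d+3. s4 r = s' r" "s4 (d + 3) = f k (s' d)"
      unfolding env f_def by blast
    let ?s5 = "s4(d := s4 (d + 3))"
    let ?s6 = "?s5(d + 1 := ?s5 (d + 1) + 1)"
    have "exec w m ?body (s', i') (?s6, i4)"
      by (rule exec_SEQ[OF 4(1) exec_SEQ[OF exec_COPY exec_INC]]) (use d in auto)
    moreover have "I (Suc k) (?s6, i4)"
      using 4 s' by (auto simp: I_def)
    moreover have "\<not> holds w m (EQ (d + 1) (d + 2)) \<tau>"
      using \<tau> s' k n EIter.prems(4) by simp
    ultimately show "\<not> holds w m (EQ (d + 1) (d + 2)) \<tau> \<and> (\<exists>\<tau>'. exec w m ?body \<tau> \<tau>' \<and> I (Suc k) \<tau>')"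
      using \<tau> by blast
  qed (use d in \<open>auto simp: I_def\<close>)
  then obtain s5 i5 where 5: "exec w m (UNTIL (EQ (d + 1) (d + 2)) ?body) (s3, i2) (s5, i5)" "I ?n (s5, i5)"
    by auto
  from exec_SEQ[OF 1(1) exec_SEQ[OF 2(1) exec_SEQ[OF 3 5(1)]]] show ?case
    using 5(2) by (intro exI[of _ s5] exI[of _ i5]) (simp add: I_def f_def)
qed

definition counter_regs :: "nat \<Rightarrow> nat \<Rightarrow> nat" where
  "counter_regs k = (\<lambda>_. 0)(0 := k)"

text \<open>
  The initial phase. A digit is only added when the carry has run over all digits, that is, when
  the counter has become a power of two; hence the number \<open>m\<close> of digits stays minimal.
\<close>

lemma init_config:
  "k \<le> length w + 1 \<Longrightarrow> \<exists>m. macro_config w k = (Init, k, cols m (counter_regs k)) \<and>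
     k < 2 ^ m \<and> 2 ^ m \<le> 2 * k + 1"
proof (induction k)
  case 0
  then show ?case by (intro exI[of _ 0]) (simp add: macro_config_def)
next
  case (Suc k)
  then obtain m where m: "macro_config w k = (Init, k, cols m (counter_regs k))"
    "k < 2 ^ m" "2 ^ m \<le> 2 * k + 1" by auto
  have sym: "read_input w k \<noteq> RightEnd" using Suc.prems by (simp add: read_input_def)
  let ?s = "counter_regs (Suc k)"
  have inc: "(counter_regs k)(0 := Suc k) = ?s" "counter_regs k 0 = k"
    by (auto simp: counter_regs_def)
  have step: "macro_config w (Suc k) =
     (Init, Suc k, cols m ?s @ (if 2 ^ m dvd k + 1 then [2 # replicate (K - 1) 1] else []))"
    using sym Suc.prems K2 by (simp add: macro_config_Suc m macro_step_control scan_IncP Let_def inc)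
  show ?case
  proof (cases "2 ^ m dvd k + 1")
    case True
    then have k: "k + 1 = 2 ^ m" using m by (simp add: dvd_imp_le le_antisym Suc_leI)
    have "map (\<lambda>x. if odd (?s x div 2 ^ m) then 2 else 1) [0..<K] = 2 # replicate (K - 1) (1::nat)"
      using k K2 by (auto simp: nth_Cons' counter_regs_def intro!: nth_equalityI)
    then have "cols m ?s @ [2 # replicate (K - 1) 1] = cols (Suc m) ?s"
      by (simp add: cols_snoc del: cols.simps)
    then show ?thesis using step True k by (intro exI[of _ "Suc m"]) (auto simp del: cols.simps)
  next
    case False
    then have "k + 1 \<noteq> 2 ^ m" by auto
    then show ?thesis using step False m by (intro exI[of _ m]) auto
  qed
qed

text \<open>
  Passes that may append a column or lead back into the initial phase.
\<close>

fun grows :: "'a pass \<Rightarrow> bool" where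
  "grows (NopP p) \<longleftrightarrow> p = Init"
| "grows (IncP x b g p) \<longleftrightarrow> g \<or> p = Init"
| "grows (ZeroP x p) \<longleftrightarrow> p = Init"
| "grows (CopyP x y p) \<longleftrightarrow> p = Init"
| "grows (EqP x y b p p') \<longleftrightarrow> p = Init \<or> p' = Init"

lemma grows_scan: "grows (fst (scan q cs)) \<longleftrightarrow> grows q"
proof (induction cs arbitrary: q)
  case (Cons c cs)
  have "grows (fst (com_col q c)) = grows q" by (cases q) auto
  then show ?case using Cons by (simp add: split_beta Let_def)
qed simp

lemma fixed_width:
  assumes "fst c \<noteq> Init" "columns (snd (snd c))"
  shows "fst (macro_step w c) \<noteq> Init \<and> length (snd (snd (macro_step w c))) = length (snd (snd c))"
proof -
  obtain p i cs where c: "c = (p, i, cs)" by (metis prod_cases3)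
  have fin: "fst (com_fin K q) \<noteq> Init \<and> snd (com_fin K q) = []" if "\<not> grows q" for q :: "'a pass"
    using that by (cases q) auto
  have test: "\<not> grows (test b q q' a)" if "q \<noteq> Init" "q' \<noteq> Init" for b q q' and a :: "'a input_symbol"
    using that by (cases b) auto
  have "\<not> grows (snd (com_home prog p a))" for a
  proof (cases p)
    case (Run ks)
    show ?thesis
    proof (cases ks)
      case (Cons d k)
      then show ?thesis using Run test by (cases d) auto
    qed (use Run in simp)
  qed (use assms c in auto)
  then show ?thesis
    using assms c fin grows_scan scan_columns by (simp add: macro_step_def split_beta Let_def)
qed

lemma width_bound: "2 ^ length (snd (snd (macro_config w k))) \<le> 2 * length w + 3"
proof (cases "k \<le> length w + 1")
  case True
  then show ?thesis using init_config[OF True] by auto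
next
  case False
  have "fst (macro_config w k) \<noteq> Init \<and> 2 ^ length (snd (snd (macro_config w k))) \<le> 2 * length w + 3"
    if "length w + 2 \<le> k" for k
    using that
  proof (induction k rule: dec_induct)
    case base
    obtain m where m: "macro_config w (length w + 1) = (Init, length w + 1, cols m (counter_regs (length w + 1)))"
      "2 ^ m \<le> 2 * (length w + 1) + 1" using init_config[of "length w + 1" w] by auto
    have "macro_config w (length w + 2) = macro_step w (macro_config w (length w + 1))"
      using macro_config_Suc[of w "length w + 1"] by simp
    then show ?case
      using m by (simp add: macro_step_control read_input_def scan_NopP Let_def)
  next
    case (step k)
    have "columns (snd (snd (macro_config w k)))"
      using macro_config_good by (metis prod.collapse)
    then show ?case using fixed_width step.IH by (simp add: macro_config_Suc)
  qed
  then show ?thesis using False by simp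
qed

text \<open>
  Register 2 is set to 0, so the final comparison accepts exactly if the value is not 0.
\<close>

lemma final_config:
  assumes prog: "prog = SEQ (compile e (\<lambda>_. 0) 1) (ZERO 2)" and "K = registers e + 3"
  shows "\<exists>k. fst (macro_config w k) = (if eval w e (\<lambda>_. length w + 1) \<noteq> 0 then Done True else Done False)"
proof -
  let ?n = "length w + 1" and ?v = "eval w e (\<lambda>_. length w + 1)"
  define s where "s = counter_regs ?n"
  obtain m where m: "macro_config w ?n = (Init, ?n, cols m s)" "?n < 2 ^ m"
    using init_config[of ?n w] by (auto simp: s_def)
  have start: "macro_config w (Suc ?n) = (Run [prog], ?n, cols m s)"
    unfolding macro_config_Suc m(1) by (simp add: macro_step_control read_input_def scan_NopP Let_def)
  have "\<exists>s' i'. exec w m (compile e (\<lambda>_. 0) 1) (s, ?n) (s', i') \<and> i' \<le> ?n \<and>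
    (\<forall>r<1. s' r = s r) \<and> s' 1 = eval w e (\<lambda>v. s 0)"
    by (rule exec_compile) (use assms m in \<open>auto simp: s_def counter_regs_def\<close>)
  then obtain s' i' where s': "exec w m (compile e (\<lambda>_. 0) 1) (s, ?n) (s', i')" "s' 1 = ?v"
    by (auto simp: s_def counter_regs_def)
  have "exec w m prog (s, ?n) (s'(2 := 0), i')"
    using exec_SEQ[OF s'(1) exec_ZERO[of w m 2]] by (simp only: prog[symmetric])
  then obtain n where n: "(macro_step w ^^ n) (Run [prog], ?n, cols m s) = (Run [], i', cols m (s'(2 := 0)))"
    unfolding exec_def by fastforce
  have "?v < 2 ^ m" using eval_le[of "\<lambda>_. ?n" w e] m(2) by simp
  then have "fst (macro_step w (Run [], i', cols m (s'(2 := 0)))) = Done (?v \<noteq> 0)"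
    using s'(2) K2 by (simp add: macro_step_control scan_EqP Let_def)
  moreover have "macro_config w (Suc (n + Suc ?n)) = macro_step w (Run [], i', cols m (s'(2 := 0)))"
  proof -
    have "macro_config w (n + Suc ?n) = (macro_step w ^^ n) (macro_config w (Suc ?n))"
      unfolding macro_config_def funpow_add by simp
    then show ?thesis unfolding start n macro_config_Suc[of w "n + Suc ?n"] by (rule arg_cong)
  qed
  ultimately show ?thesis by (intro exI[of _ "Suc (n + Suc ?n)"]) simp
qed

end

text \<open>
  The number of digits is fixed by the initial phase to at most \<open>log 2 (2 * length w + 3)\<close>, and no
  command changes it; so the space bound does not depend on what the program computes.
\<close>

theorem LOGSPACE_exp:
  fixes e :: "'a::finite exp"
  assumes "\<And>w. eval w e (\<lambda>_. length w + 1) \<noteq> 0 \<longleftrightarrow> w \<in> A"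
  shows "A \<in> LOGSPACE"
proof -
  define K where "K = registers e + 3"
  define prog where "prog = SEQ (compile e (\<lambda>_. 0) 1) (ZERO 2)"
  define s where "s n = nat \<lfloor>log 2 (real (2 * n + 3))\<rfloor> + 2" for n
  interpret register_machine K prog by unfold_locales (simp add: K_def)
  have "\<exists>M. wf_tm M \<and> decides M A \<and> (\<forall>w. runs_in_space M w (s (length w)))"
  proof (rule turing_machine[where P = "controls prog" and Q = "passes prog" and pa = "Done True" and pr = "Done False"])
    fix q :: "'a pass" and c
    show "set (snd (com_col q c)) \<subseteq> {..<4}" if "set c \<subseteq> {..<4}"
      using that by (cases q) (auto dest!: subsetD[OF set_update_subset_insert])
    show "set c \<subseteq> {..<4}" if "c \<in> set (snd (com_fin K q))"
      using that by (cases q) (auto split: if_splits)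
  next
    fix w :: "'a list" and k
    let ?m = "length (snd (snd (macro_config w k)))"
    have "real (2 ^ ?m) \<le> real (2 * length w + 3)"
      using width_bound of_nat_mono by blast
    then have "?m \<le> log 2 (real (2 * length w + 3))"
      by (intro le_log_of_power) auto
    then have "?m \<le> nat \<lfloor>log 2 (real (2 * length w + 3))\<rfloor>" by (rule le_nat_floor)
    then show "?m + 1 < s (length w)" by (simp add: s_def)
  next
    fix w :: "'a list"
    show "\<exists>k. fst (macro_config w k) = (if w \<in> A then Done True else Done False)"
      using final_config[OF prog_def K_def, of w] assms[of w] by simp
  qed (simp_all add: finite_controls finite_passes com_home_passes com_col_passes com_fin_controls,
      simp_all add: controls_def)
  moreover have "(\<lambda>n. real (s n)) \<in> O(\<lambda>n. log 2 (real n))"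
  proof (rule bigoI[where c = 4])
    have "norm (real (s n)) \<le> 4 * norm (log 2 (real n))" if "n \<ge> 3" for n
    proof -
      \<comment> \<open>for \<open>n \<ge> 3\<close>, \<open>log 2 (2 * n + 3)\<close> is at most twice \<open>log 2 n\<close>, and so is the additive 2\<close>
      have "2 * n + 3 \<le> 3 * n" "3 * n \<le> n * n" using that by simp_all
      then have "2 * n + 3 \<le> n ^ 2" unfolding power2_eq_square by (rule le_trans)
      then have "real (2 * n + 3) \<le> real n ^ 2" by (metis of_nat_mono of_nat_power)
      then have "log 2 (real (2 * n + 3)) \<le> log 2 (real n ^ 2)" by (intro log_mono) auto
      also have "\<dots> = 2 * log 2 (real n)" using that by (simp add: log_nat_power)
      finally have "log 2 (real (2 * n + 3)) \<le> 2 * log 2 (real n)" .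
      moreover have "real (nat \<lfloor>log 2 (real (2 * n + 3))\<rfloor>) \<le> log 2 (real (2 * n + 3))"
        by (intro of_nat_floor) simp
      moreover have "real (s n) = real (nat \<lfloor>log 2 (real (2 * n + 3))\<rfloor>) + 2"
        unfolding s_def by simp
      ultimately have "real (s n) \<le> 2 * log 2 (real n) + 2" by linarith
      moreover have "log 2 2 \<le> log 2 (real n)" using that by (subst log_le_cancel_iff) auto
      ultimately show ?thesis by simp
    qed
    then show "eventually (\<lambda>n. norm (real (s n)) \<le> 4 * norm (log 2 (real n))) at_top"
      using eventually_sequentially by blast
  qed
  ultimately show ?thesis unfolding LOGSPACE_def DSPACE_def by blast
qed

section \<open>Closure properties of expressible functions\<close>

text \<open>
  Functions and relations that are described by an expression. Only environments with values up to
  \<open>length w + 1\<close> matter, so that saturated operations may be replaced by exact ones wherever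
  their results stay in this range (\<open>logf_cong\<close>).
\<close>

definition logf :: "('a list \<Rightarrow> (nat \<Rightarrow> nat) \<Rightarrow> nat) \<Rightarrow> bool" where
  "logf F \<longleftrightarrow> (\<exists>e. \<forall>w \<rho>. (\<forall>v. \<rho> v \<le> length w + 1) \<longrightarrow> eval w e \<rho> = F w \<rho>)"

definition logp :: "('a list \<Rightarrow> (nat \<Rightarrow> nat) \<Rightarrow> bool) \<Rightarrow> bool" where
  "logp P \<longleftrightarrow> logf (\<lambda>w \<rho>. of_bool (P w \<rho>))"

lemma logfI: "(\<And>w \<rho>. \<forall>v. \<rho> v \<le> length w + 1 \<Longrightarrow> eval w e \<rho> = F w \<rho>) \<Longrightarrow> logf F"
  unfolding logf_def by blast

lemma logf_le: "logf F \<Longrightarrow> \<forall>v. \<rho> v \<le> length w + 1 \<Longrightarrow> F w \<rho> \<le> length w + 1"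
  unfolding logf_def using eval_le by metis

lemma logf_cong:
  assumes "logf G" "\<And>w \<rho>. \<forall>v. \<rho> v \<le> length w + 1 \<Longrightarrow> F w \<rho> = G w \<rho>"
  shows "logf F"
  using assms unfolding logf_def by metis

lemma logp_cong:
  assumes "logp Q" "\<And>w \<rho>. \<forall>v. \<rho> v \<le> length w + 1 \<Longrightarrow> P w \<rho> = Q w \<rho>"
  shows "logp P"
  using assms(1) unfolding logp_def by (rule logf_cong) (simp add: assms(2))

primrec rename :: "'a exp \<Rightarrow> (nat \<Rightarrow> nat) \<Rightarrow> 'a exp" where
  "rename (EVar v) f = EVar (f v)"
| "rename EZero f = EZero"
| "rename EBound f = EBound"
| "rename (ESuc e) f = ESuc (rename e f)"
| "rename (EIf a b c d) f = EIf (rename a f) (rename b f) (rename c f) (rename d f)"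
| "rename (ELetter P e) f = ELetter P (rename e f)"
| "rename (EIter b s t) f =
     EIter (rename b (case_nat 0 (case_nat 1 (\<lambda>v. f v + 2)))) (rename s f) (rename t f)"

lemma eval_rename: "eval w (rename e f) \<rho> = eval w e (\<lambda>v. \<rho> (f v))"
proof (induction e arbitrary: f \<rho>)
  case (EIter b s t)
  have "(\<lambda>v. case_nat acc (case_nat i \<rho>) (case_nat 0 (case_nat 1 (\<lambda>v. f v + 2)) v)) =
      case_nat acc (case_nat i (\<lambda>v. \<rho> (f v)))" for acc i
    by (auto simp: fun_eq_iff split: nat.split)
  then show ?case by (simp only: rename.simps eval.simps EIter)
qed auto

lemma logf_rename:
  assumes "logf F"
  shows "logf (\<lambda>w \<rho>. F w (\<lambda>v. \<rho> (f v)))"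
proof -
  obtain e where "\<forall>w \<rho>. (\<forall>v. \<rho> v \<le> length w + 1) \<longrightarrow> eval w e \<rho> = F w \<rho>"
    using assms by (auto simp: logf_def)
  then show ?thesis by (intro logfI[of "rename e f"]) (simp add: eval_rename)
qed

text \<open>
  An iteration with a single round binds a value to variable 0; variable 1, the number of the round,
  is then 0.
\<close>

lemma logf_let:
  assumes "logf G" "logf a"
  shows "logf (\<lambda>w \<rho>. G w (case_nat (a w \<rho>) (case_nat 0 \<rho>)))"
proof -
  obtain e where e: "\<And>w \<rho>. \<forall>v. \<rho> v \<le> length w + 1 \<Longrightarrow> eval w e \<rho> = G w \<rho>"
    using assms(1) by (auto simp: logf_def)
  obtain e' where e': "\<And>w \<rho>. \<forall>v. \<rho> v \<le> length w + 1 \<Longrightarrow> eval w e' \<rho> = a w \<rho>"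
    using assms(2) by (auto simp: logf_def)
  show ?thesis
  proof (rule logfI[of "EIter e e' (ESuc EZero)"])
    fix w :: "'a list" and \<rho> :: "nat \<Rightarrow> nat"
    assume \<rho>: "\<forall>v. \<rho> v \<le> length w + 1"
    then have "\<forall>v. case_nat (a w \<rho>) (case_nat 0 \<rho>) v \<le> length w + 1"
      using logf_le[OF assms(2)] by (simp split: nat.split)
    then show "eval w (EIter e e' (ESuc EZero)) \<rho> = G w (case_nat (a w \<rho>) (case_nat 0 \<rho>))"
      using e e' \<rho> by simp
  qed
qed

text \<open>
  Together with the next lemmas: substitution into a function of one, two or three arguments. It is
  enough to show such a function expressible on variables; its use on arbitrary arguments then follows.
\<close>

lemma logf_app1:
  assumes "logf (\<lambda>w \<rho>. f w (\<rho> 0))" "logf a"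
  shows "logf (\<lambda>w \<rho>. f w (a w \<rho>))"
  using logf_let[OF assms] by simp

lemma logf_app2:
  assumes "logf (\<lambda>w \<rho>. f w (\<rho> 0) (\<rho> 1))" "logf a" "logf b"
  shows "logf (\<lambda>w \<rho>. f w (a w \<rho>) (b w \<rho>))"
proof -
  \<comment> \<open>each binding shifts the other variables by two\<close>
  note f = logf_rename[OF assms(1), of "\<lambda>v. 2 * v"]
  note a = logf_rename[OF assms(2), of "\<lambda>v. Suc (Suc v)"]
  show ?thesis using logf_let[OF logf_let[OF f a] assms(3)] by (simp add: numeral_2_eq_2)
qed

lemma logf_app3:
  assumes "logf (\<lambda>w \<rho>. f w (\<rho> 0) (\<rho> 1) (\<rho> 2))" "logf a" "logf b" "logf c"
  shows "logf (\<lambda>w \<rho>. f w (a w \<rho>) (b w \<rho>) (c w \<rho>))"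
proof -
  note f = logf_rename[OF assms(1), of "\<lambda>v. v + v"]
  note a = logf_rename[OF assms(2), of "\<lambda>v. Suc (Suc (Suc (Suc v)))"]
  note b = logf_rename[OF assms(3), of "\<lambda>v. Suc (Suc v)"]
  show ?thesis
    using logf_let[OF logf_let[OF logf_let[OF f a] b] assms(4)] by (simp add: numeral_2_eq_2)
qed

lemma logp_app1:
  assumes "logp (\<lambda>w \<rho>. P w (\<rho> 0))" "logf a"
  shows "logp (\<lambda>w \<rho>. P w (a w \<rho>))"
  using logf_app1[of "\<lambda>w x. of_bool (P w x)"] assms by (simp add: logp_def)

lemma logp_app2:
  assumes "logp (\<lambda>w \<rho>. P w (\<rho> 0) (\<rho> 1))" "logf a" "logf b"
  shows "logp (\<lambda>w \<rho>. P w (a w \<rho>) (b w \<rho>))"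
  using logf_app2[of "\<lambda>w x y. of_bool (P w x y)"] assms by (simp add: logp_def)

definition csuc :: "'a list \<Rightarrow> nat \<Rightarrow> nat" where
  "csuc w x = min (x + 1) (length w + 1)"

lemma logf_var: "logf (\<lambda>w \<rho>. \<rho> v)"
  by (rule logfI[of "EVar v"]) simp

lemma logf_zero: "logf (\<lambda>w \<rho>. 0)"
  by (rule logfI[of EZero]) simp

lemma logf_one: "logf (\<lambda>w \<rho>. 1)"
  by (rule logfI[of "ESuc EZero"]) simp

lemma logf_bound: "logf (\<lambda>w \<rho>. length w + 1)"
  by (rule logfI[of EBound]) simp

lemma logf_csuc: "logf a \<Longrightarrow> logf (\<lambda>w \<rho>. csuc w (a w \<rho>))"
  by (rule logf_app1[of csuc]) (auto intro: logfI[of "ESuc (EVar 0)"] simp: csuc_def)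

lemma logf_iter:
  assumes "logf (\<lambda>w \<rho>. G w (\<lambda>v. \<rho> (v + 2)) (\<rho> 1) (\<rho> 0))" "logf t" "logf s"
  shows "logf (\<lambda>w \<rho>. iter (t w \<rho>) (\<lambda>i acc. G w \<rho> i acc) (s w \<rho>))"
proof -
  obtain b where b: "\<And>w \<rho>. \<forall>v. \<rho> v \<le> length w + 1 \<Longrightarrow>
      eval w b \<rho> = G w (\<lambda>v. \<rho> (v + 2)) (\<rho> 1) (\<rho> 0)"
    using assms(1) by (auto simp: logf_def)
  obtain e where e: "\<And>w \<rho>. \<forall>v. \<rho> v \<le> length w + 1 \<Longrightarrow> eval w e \<rho> = t w \<rho>"
    using assms(2) by (auto simp: logf_def)
  obtain e' where e': "\<And>w \<rho>. \<forall>v. \<rho> v \<le> length w + 1 \<Longrightarrow> eval w e' \<rho> = s w \<rho>"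
    using assms(3) by (auto simp: logf_def)
  show ?thesis
  proof (rule logfI[of "EIter b e' e"])
    fix w :: "'a list" and \<rho> :: "nat \<Rightarrow> nat"
    assume \<rho>: "\<forall>v. \<rho> v \<le> length w + 1"
    let ?f = "\<lambda>i acc. eval w b (case_nat acc (case_nat i \<rho>))"
    have "iter k ?f (s w \<rho>) = iter k (G w \<rho>) (s w \<rho>) \<and> iter k ?f (s w \<rho>) \<le> length w + 1"
      if "k \<le> t w \<rho>" for k
      using that
    proof (induction k)
      case 0
      then show ?case using logf_le[OF assms(3) \<rho>] by simp
    next
      case (Suc k)
      have "k \<le> length w + 1" using Suc logf_le[OF assms(2) \<rho>] by simp
      then have bd: "\<forall>v. case_nat (iter k ?f (s w \<rho>)) (case_nat k \<rho>) v \<le> length w + 1"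
        using Suc \<rho> by (simp split: nat.split)
      have "?f k (iter k ?f (s w \<rho>)) = G w \<rho> k (iter k ?f (s w \<rho>))"
        using b[OF bd] by (simp add: numeral_2_eq_2)
      moreover have "?f k (iter k ?f (s w \<rho>)) \<le> length w + 1" by (rule eval_le[OF bd])
      moreover have "iter k ?f (s w \<rho>) = iter k (G w \<rho>) (s w \<rho>)" using Suc by simp
      ultimately show ?case unfolding iter.simps by metis
    qed
    then show "eval w (EIter b e' e) \<rho> = iter (t w \<rho>) (\<lambda>i acc. G w \<rho> i acc) (s w \<rho>)"
      using e[OF \<rho>] e'[OF \<rho>] by simp
  qed
qed

lemma logf_length: "logf (\<lambda>w \<rho>. length w)"
proof -
  have "logf (\<lambda>w \<rho>. iter (length w + 1) (\<lambda>i acc. i) 0)"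
    by (intro logf_iter logf_var logf_bound logf_zero)
  then show ?thesis by simp
qed

lemma logf_if:
  assumes "logp P" "logf a" "logf b"
  shows "logf (\<lambda>w \<rho>. if P w \<rho> then a w \<rho> else b w \<rho>)"
proof -
  obtain e e1 e2 where e: "\<And>w \<rho>. \<forall>v. \<rho> v \<le> length w + 1 \<Longrightarrow> eval w e \<rho> = of_bool (P w \<rho>)"
     "\<And>w \<rho>. \<forall>v. \<rho> v \<le> length w + 1 \<Longrightarrow> eval w e1 \<rho> = a w \<rho>"
     "\<And>w \<rho>. \<forall>v. \<rho> v \<le> length w + 1 \<Longrightarrow> eval w e2 \<rho> = b w \<rho>"
    using assms unfolding logp_def logf_def by blast
  show ?thesis by (rule logfI[of "EIf e EZero e2 e1"]) (simp add: e)
qed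

lemma logp_eq:
  assumes "logf a" "logf b"
  shows "logp (\<lambda>w \<rho>. a w \<rho> = b w \<rho>)"
proof -
  obtain e1 e2 where e:
     "\<And>w \<rho>. \<forall>v. \<rho> v \<le> length w + 1 \<Longrightarrow> eval w e1 \<rho> = a w \<rho>"
     "\<And>w \<rho>. \<forall>v. \<rho> v \<le> length w + 1 \<Longrightarrow> eval w e2 \<rho> = b w \<rho>"
    using assms unfolding logf_def by blast
  show ?thesis unfolding logp_def
    by (rule logfI[of "EIf e1 e2 (ESuc EZero) EZero"]) (simp add: e)
qed

lemma logp_input:
  assumes "logf a"
  shows "logp (\<lambda>w \<rho>. Q (read_input w (a w \<rho>)))"
  by (rule logp_app1[OF _ assms]) (auto simp: logp_def intro: logfI[of "ELetter Q (EVar 0)"])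

lemma logp_not: "logp P \<Longrightarrow> logp (\<lambda>w \<rho>. \<not> P w \<rho>)"
  unfolding logp_def[of "\<lambda>w \<rho>. \<not> P w \<rho>"]
  by (rule logf_cong[OF logf_if[OF _ logf_zero logf_one]]) auto

lemma logp_conj: "logp P \<Longrightarrow> logp Q \<Longrightarrow> logp (\<lambda>w \<rho>. P w \<rho> \<and> Q w \<rho>)"
  unfolding logp_def[of "\<lambda>w \<rho>. P w \<rho> \<and> Q w \<rho>"]
  by (rule logf_cong[OF logf_if[of P "\<lambda>w \<rho>. of_bool (Q w \<rho>)", OF _ _ logf_zero]])
    (auto simp: logp_def)

lemma logp_disj: "logp P \<Longrightarrow> logp Q \<Longrightarrow> logp (\<lambda>w \<rho>. P w \<rho> \<or> Q w \<rho>)"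
  using logp_not[OF logp_conj[OF logp_not logp_not]] by simp

lemma logp_imp: "logp P \<Longrightarrow> logp Q \<Longrightarrow> logp (\<lambda>w \<rho>. P w \<rho> \<longrightarrow> Q w \<rho>)"
  using logp_disj[OF logp_not] by simp

text \<open>
  Counting is the basic form of search: the bounded quantifiers and the order are derived from it.
\<close>

lemma logf_count:
  assumes "logp (\<lambda>w \<rho>. P w (\<lambda>v. \<rho> (v + 2)) (\<rho> 1))" "logf t"
  shows "logf (\<lambda>w \<rho>. card {i. i < t w \<rho> \<and> P w \<rho> i})"
proof (rule logf_cong)
  show "logf (\<lambda>w \<rho>. iter (t w \<rho>) (\<lambda>i acc. if P w \<rho> i then csuc w acc else acc) 0)"
    by (intro logf_iter logf_if logf_csuc logf_var logf_zero assms)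
next
  fix w :: "'a list" and \<rho> :: "nat \<Rightarrow> nat"
  assume \<rho>: "\<forall>v. \<rho> v \<le> length w + 1"
  have "card {i. i < k \<and> P w \<rho> i} = iter k (\<lambda>i acc. if P w \<rho> i then csuc w acc else acc) 0"
    if "k \<le> length w + 1" for k
    using that
  proof (induction k)
    case (Suc k)
    have "{i. i < Suc k \<and> P w \<rho> i} = (if P w \<rho> k then insert k else id) {i. i < k \<and> P w \<rho> i}"
      by (auto simp: less_Suc_eq)
    moreover have "card {i. i < k \<and> P w \<rho> i} \<le> card {..<k}" by (rule card_mono) auto
    ultimately show ?case using Suc by (auto simp: csuc_def)
  qed simp
  then show "card {i. i < t w \<rho> \<and> P w \<rho> i} =
      iter (t w \<rho>) (\<lambda>i acc. if P w \<rho> i then csuc w acc else acc) 0"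
    using logf_le[OF assms(2) \<rho>] by blast
qed

lemma logp_ex:
  assumes "logp (\<lambda>w \<rho>. P w (\<lambda>v. \<rho> (v + 2)) (\<rho> 1))" "logf t"
  shows "logp (\<lambda>w \<rho>. \<exists>i<t w \<rho>. P w \<rho> i)"
  by (rule logp_cong[OF logp_not[OF logp_eq[OF logf_count[OF assms] logf_zero]]]) auto

lemma logp_all:
  assumes "logp (\<lambda>w \<rho>. P w (\<lambda>v. \<rho> (v + 2)) (\<rho> 1))" "logf t"
  shows "logp (\<lambda>w \<rho>. \<forall>i<t w \<rho>. P w \<rho> i)"
  using logp_not[OF logp_ex[OF logp_not[OF assms(1)] assms(2)]] by simp

lemma logp_less:
  assumes "logf a" "logf b"
  shows "logp (\<lambda>w \<rho>. a w \<rho> < b w \<rho>)"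
proof (rule logp_app2[OF _ assms])
  have "logp (\<lambda>w \<rho>. \<exists>i<\<rho> 1. i = \<rho> 0)"
    by (intro logp_ex logp_eq logf_var)
  then show "logp (\<lambda>w \<rho>. \<rho> 0 < \<rho> 1)" by simp
qed

lemma logp_le: "logf a \<Longrightarrow> logf b \<Longrightarrow> logp (\<lambda>w \<rho>. a w \<rho> \<le> b w \<rho>)"
  using logp_not[OF logp_less] by (simp add: not_less)

lemma logf_funpow:
  assumes "logf (\<lambda>w \<rho>. f w (\<rho> 0))" "logf k" "logf x"
  shows "logf (\<lambda>w \<rho>. (f w ^^ k w \<rho>) (x w \<rho>))"
proof -
  have "(f w ^^ n) y = iter n (\<lambda>_. f w) y" for w n y
    by (induction n) auto
  then show ?thesis
    by (simp only:) (intro logf_iter assms)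
qed

lemmas log_rules = logf_var logf_zero logf_one logf_bound logf_csuc logf_iter logf_length logf_if
  logp_eq logp_not logp_conj logp_disj logp_imp logf_count logp_ex logp_all logp_less logp_le

text \<open>
  Arithmetic modulo \<open>l\<close> by counting, with a successor that returns to 0 at \<open>l\<close>.
\<close>

definition modinc :: "'a list \<Rightarrow> nat \<Rightarrow> nat \<Rightarrow> nat" where
  "modinc w l s = (if csuc w s = l then 0 else csuc w s)"

definition modadd :: "'a list \<Rightarrow> nat \<Rightarrow> nat \<Rightarrow> nat \<Rightarrow> nat" where
  "modadd w l s k = iter k (\<lambda>_. modinc w l) s"

definition modmul :: "'a list \<Rightarrow> nat \<Rightarrow> nat \<Rightarrow> nat \<Rightarrow> nat" where
  "modmul w l a k = iter k (\<lambda>_ s. modadd w l s a) 0"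

lemma logf_modinc: "logf a \<Longrightarrow> logf b \<Longrightarrow> logf (\<lambda>w \<rho>. modinc w (a w \<rho>) (b w \<rho>))"
  by (rule logf_app2[of modinc]) (unfold modinc_def, intro log_rules)

lemma logf_modadd:
  "logf a \<Longrightarrow> logf b \<Longrightarrow> logf c \<Longrightarrow> logf (\<lambda>w \<rho>. modadd w (a w \<rho>) (b w \<rho>) (c w \<rho>))"
  by (rule logf_app3[of modadd]) (unfold modadd_def, intro log_rules logf_modinc)

lemma logf_modmul:
  "logf a \<Longrightarrow> logf b \<Longrightarrow> logf c \<Longrightarrow> logf (\<lambda>w \<rho>. modmul w (a w \<rho>) (b w \<rho>) (c w \<rho>))"
  by (rule logf_app3[of modmul]) (unfold modmul_def, intro log_rules logf_modadd)

lemma modadd: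
  assumes "l \<le> length w + 1" "s < l"
  shows "modadd w l s k = (s + k) mod l"
proof (induction k)
  case (Suc k)
  have "(s + k) mod l \<le> length w"
    using mod_less_divisor[of l "s + k"] assms by linarith
  then show ?case
    using Suc assms \<open>(s + k) mod l \<le> length w\<close> by (auto simp: modadd_def modinc_def csuc_def mod_Suc min_def)
qed (use assms in \<open>simp add: modadd_def\<close>)

lemma modmul:
  assumes "0 < l" "l \<le> length w + 1"
  shows "modmul w l a k = a * k mod l"
proof (induction k)
  case (Suc k)
  then have "modmul w l a (Suc k) = modadd w l (a * k mod l) a" by (simp add: modmul_def)
  also have "\<dots> = (a * k mod l + a) mod l" using assms by (intro modadd) auto
  finally show ?case by (simp add: mod_simps add.commute)
qed (simp add: modmul_def)

text \<open>
  The divisor 0 fits in: then the successor never returns to 0, so that the result of counting is 0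
  only for the dividend 0.
\<close>

lemma logp_dvd:
  fixes a b :: "'a list \<Rightarrow> (nat \<Rightarrow> nat) \<Rightarrow> nat"
  assumes "logf a" "logf b"
  shows "logp (\<lambda>w \<rho>. a w \<rho> dvd b w \<rho>)"
proof (rule logp_app2[OF _ assms])
  show "logp (\<lambda>(w :: 'a list) \<rho>. \<rho> 0 dvd \<rho> 1)"
  proof (rule logp_cong)
    show "logp (\<lambda>(w :: 'a list) \<rho>. modadd w (\<rho> 0) 0 (\<rho> 1) = 0)"
      by (intro log_rules logf_modadd)
  next
    fix w :: "'a list" and \<rho> :: "nat \<Rightarrow> nat"
    assume \<rho>: "\<forall>v. \<rho> v \<le> length w + 1"
    have "0 < modadd w 0 0 (Suc k)" for k
      by (simp add: modadd_def modinc_def csuc_def)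
    then have "modadd w 0 0 (\<rho> 1) = 0 \<longleftrightarrow> \<rho> 1 = 0"
      by (cases "\<rho> 1") (auto simp: modadd_def)
    then show "\<rho> 0 dvd \<rho> 1 \<longleftrightarrow> modadd w (\<rho> 0) 0 (\<rho> 1) = 0"
      using modadd[of "\<rho> 0" w 0 "\<rho> 1"] \<rho> by (cases "\<rho> 0 = 0") auto
  qed
qed

lemma LOGSPACE_logp:
  fixes A :: "'a::finite list set"
  assumes "logp (\<lambda>w \<rho>. w \<in> A)"
  shows "A \<in> LOGSPACE"
proof -
  obtain e where "\<And>w \<rho>. \<forall>v. \<rho> v \<le> length w + 1 \<Longrightarrow> eval w e \<rho> = of_bool (w \<in> A)"
    using assms by (auto simp: logp_def logf_def)
  then show ?thesis by (intro LOGSPACE_exp[of e]) simp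
qed

section \<open>Cycle types of powers\<close>

lemma funpow_fix_iff_card_orbit_dvd:
  assumes "permutation p"
  shows "(p ^^ j) x = x \<longleftrightarrow> card (orbit p x) dvd j"
proof -
  have "set (support p x) = orbit p x"
    unfolding support_set[OF assms] orbit_altdef_permutation[OF assms] by auto
  then have "card (orbit p x) = length (support p x)"
    using distinct_card[OF cycle_of_permutation[OF assms]] by metis
  then show ?thesis using least_power_dvd[OF assms] by simp
qed

lemma card_orbit_pos:
  assumes "permutation p"
  shows "0 < card (orbit p x)"
  using finite_orbit[OF permutation_self_in_orbit[OF assms]] permutation_self_in_orbit[OF assms]
  by (auto simp: card_gt_0_iff)

text \<open>
  Both sides divide the same numbers \<open>j\<close>: those for which \<open>k * j\<close> is a multiple of the length of the
  cycle of \<open>p\<close> through \<open>x\<close>.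
\<close>

lemma card_orbit_funpow:
  assumes "permutation p"
  shows "card (orbit (p ^^ k) x) = card (orbit p x) div gcd (card (orbit p x)) k"
proof -
  let ?l = "card (orbit p x)"
  obtain S where S: "finite S" "p permutes S" using assms by (auto simp: permutation_permutes)
  then have pk: "permutation (p ^^ k)" using permutes_funpow permutation_permutes by blast
  have l: "0 < ?l" by (rule card_orbit_pos[OF assms])
  have "card (orbit (p ^^ k) x) dvd j \<longleftrightarrow> ?l div gcd ?l k dvd j" for j
  proof -
    have "card (orbit (p ^^ k) x) dvd j \<longleftrightarrow> ((p ^^ k) ^^ j) x = x"
      using funpow_fix_iff_card_orbit_dvd[OF pk] by simp
    also have "\<dots> \<longleftrightarrow> ?l dvd k * j"
      using funpow_fix_iff_card_orbit_dvd[OF assms] by (simp add: funpow_mult)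
    also have "\<dots> \<longleftrightarrow> gcd ?l k * (?l div gcd ?l k) dvd gcd ?l k * (k div gcd ?l k * j)"
      by (simp add: mult.assoc[symmetric])
    also have "\<dots> \<longleftrightarrow> ?l div gcd ?l k dvd k div gcd ?l k * j"
      using l by (subst nat_mult_dvd_cancel1) auto
    also have "\<dots> \<longleftrightarrow> ?l div gcd ?l k dvd j"
      using l by (intro coprime_dvd_mult_right_iff div_gcd_coprime) auto
    finally show ?thesis .
  qed
  then show ?thesis by (metis dvd_antisym dvd_refl)
qed

lemma card_points_by_orbit:
  assumes "p permutes S" "finite S"
  shows "card {x\<in>S. card (orbit p x) = L} = L * card {X \<in> orbit p ` S. card X = L}"
proof -
  have perm: "permutation p" using assms by (auto simp: permutation_permutes)
  have sub: "orbit p x \<subseteq> S" if "x \<in> S" for x using permutes_orbit_subset[OF assms(1) that] .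
  have eq: "orbit p y = orbit p x" if "y \<in> orbit p x" for x y
    by (rule orbit_cyclic_eq3[OF cyclic_on_orbit'[OF perm] that])
  have U: "{x\<in>S. card (orbit p x) = L} = \<Union> {X \<in> orbit p ` S. card X = L}"
  proof (intro equalityI subsetI)
    fix x assume "x \<in> {x\<in>S. card (orbit p x) = L}"
    then show "x \<in> \<Union> {X \<in> orbit p ` S. card X = L}"
      using permutation_self_in_orbit[OF perm, of x] by blast
  next
    fix y assume "y \<in> \<Union> {X \<in> orbit p ` S. card X = L}"
    then obtain x where x: "x \<in> S" "card (orbit p x) = L" "y \<in> orbit p x" by blast
    then show "y \<in> {x\<in>S. card (orbit p x) = L}" using sub[OF x(1)] eq[OF x(3)] by auto
  qed
  have "L * card {X \<in> orbit p ` S. card X = L} = card (\<Union> {X \<in> orbit p ` S. card X = L})"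
  proof (rule card_partition)
    show "finite (\<Union> {X \<in> orbit p ` S. card X = L})" unfolding U[symmetric] using assms(2) by simp
    fix c1 c2 assume "c1 \<in> {X \<in> orbit p ` S. card X = L}" "c2 \<in> {X \<in> orbit p ` S. card X = L}" "c1 \<noteq> c2"
    then obtain x y where "c1 = orbit p x" "c2 = orbit p y" "orbit p x \<noteq> orbit p y" by blast
    then show "c1 \<inter> c2 = {}" using eq[of _ x] eq[of _ y] by (metis disjoint_iff)
  qed (use assms in auto)
  then show ?thesis using U by simp
qed

text \<open>
  Counting points on cycles of length \<open>L\<close> instead of these cycles multiplies the count by \<open>L\<close>,
  which loses nothing because there are no cycles of length 0; and points need no representatives.
\<close>

lemma cycle_type_eq_iff:
  assumes p: "p permutes {1..n}" and q: "q permutes {1..n}"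
  shows "cycle_type n p = cycle_type n q \<longleftrightarrow>
    (\<forall>L. card {x\<in>{1..n}. card (orbit p x) = L} = card {x\<in>{1..n}. card (orbit q x) = L})"
proof -
  have count: "L * count (cycle_type n r) L = card {x\<in>{1..n}. card (orbit r x) = L}"
    if "r permutes {1..n}" for r L
    unfolding cycle_type_orbits[OF that] card_points_by_orbit[OF that finite_atLeastAtMost]
    by (subst count_image_mset_eq_card_vimage) auto
  have zero: "count (cycle_type n r) 0 = 0" if "r permutes {1..n}" for r
  proof -
    have "permutation r" using that by (auto simp: permutation_permutes)
    then have "card X \<noteq> 0" if "X \<in> orbit r ` {1..n}" for X
      using that card_orbit_pos by (metis imageE less_irrefl)
    then have "{X \<in> orbit r ` {1..n}. card X = 0} = {}" by blast
    then show ?thesis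
      unfolding cycle_type_orbits[OF that] by (subst count_image_mset_eq_card_vimage) auto
  qed
  show ?thesis
  proof
    assume R: "\<forall>L. card {x\<in>{1..n}. card (orbit p x) = L} = card {x\<in>{1..n}. card (orbit q x) = L}"
    show "cycle_type n p = cycle_type n q"
    proof (rule multiset_eqI)
      fix L
      have "L * count (cycle_type n p) L = L * count (cycle_type n q) L"
        unfolding count[OF p] count[OF q] by (rule R[THEN spec])
      then have "L = 0 \<or> count (cycle_type n p) L = count (cycle_type n q) L" by auto
      then show "count (cycle_type n p) L = count (cycle_type n q) L"
        using zero[OF p] zero[OF q] by metis
    qed
  next
    assume E: "cycle_type n p = cycle_type n q"
    show "\<forall>L. card {x\<in>{1..n}. card (orbit p x) = L} = card {x\<in>{1..n}. card (orbit q x) = L}"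
    proof
      fix L
      show "card {x\<in>{1..n}. card (orbit p x) = L} = card {x\<in>{1..n}. card (orbit q x) = L}"
        using count[OF p, of L] count[OF q, of L] unfolding E by (rule subst)
    qed
  qed
qed

lemma generate_sym_group:
  assumes "p permutes {1..n}"
  shows "generate (sym_group n) {p} = {p ^^ k |k. 0 < k}"
proof -
  interpret group "sym_group n" by (rule sym_group_is_group)
  have pow: "p [^]\<^bsub>sym_group n\<^esub> k = p ^^ k" for k :: nat
    by (induction k) (simp_all add: sym_group_mult sym_group_one funpow_Suc_right del: funpow.simps(2))
  have fin: "finite (carrier (sym_group n))"
    by (simp add: sym_group_def finite_permutations)
  have gen: "generate (sym_group n) {p} = {p ^^ k |k. k \<in> UNIV}"
    using generate_pow_on_finite_carrier[OF fin, of p] assms by (simp add: sym_group_carrier pow)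
  have pos: "\<exists>j>0. p ^^ k = p ^^ j" for k
  proof (cases "k = 0")
    case True
    \<comment> \<open>the exponent 0 is replaced by a positive multiple of the order\<close>
    obtain N where "p ^^ N = id" "N > 0"
      using permutation_is_nilpotent assms by (metis permutation_permutes finite_atLeastAtMost)
    then have "p ^^ N = p ^^ k" using True by (simp add: id_def[symmetric])
    then show ?thesis using \<open>N > 0\<close> by metis
  qed auto
  have "{p ^^ k |k. k \<in> UNIV} \<subseteq> {p ^^ k |k. 0 < k}"
  proof clarify
    fix k :: nat
    show "\<exists>j. p ^^ k = p ^^ j \<and> 0 < j" using pos[of k] by blast
  qed
  then show ?thesis unfolding gen by blast
qed

section \<open>The exponent\<close>

text \<open>
  For a prime \<open>p\<close>: the powers \<open>p ^ j\<close> with \<open>j > 0\<close>, described by their divisors. In this form the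
  property can be checked by a bounded quantifier.
\<close>

definition prime_power_of :: "nat \<Rightarrow> nat \<Rightarrow> bool" where
  "prime_power_of p q \<longleftrightarrow> 1 < q \<and> (\<forall>d. d dvd q \<longrightarrow> d = 1 \<or> p dvd d)"

lemma prime_power_of_iff:
  assumes "prime p"
  shows "prime_power_of p q \<longleftrightarrow> (\<exists>j>0. q = p ^ j)"
proof
  assume q: "prime_power_of p q"
  then have "q \<noteq> 0" by (auto simp: prime_power_of_def)
  then obtain r where r: "q = p ^ multiplicity p q * r" "\<not> p dvd r"
    using multiplicity_decompose'[of q p] prime_gt_1_nat[OF assms] by auto
  then have "r = 1" using q by (metis dvd_triv_right prime_power_of_def)
  moreover define j where "j = multiplicity p q"
  ultimately have "q = p ^ j" using r(1) by simp
  moreover from this have "j \<noteq> 0" using q by (intro notI) (simp add: prime_power_of_def)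
  ultimately show "\<exists>j>0. q = p ^ j" by blast
next
  assume "\<exists>j>0. q = p ^ j"
  then obtain j where j: "j > 0" "q = p ^ j" by blast
  have "d = 1 \<or> p dvd d" if "d dvd q" for d
  proof -
    have "d dvd p ^ j" using that j(2) by (simp only:)
    then obtain i where "d = p ^ i" unfolding divides_primepow_nat[OF assms] by blast
    then show ?thesis by (cases i) auto
  qed
  then show "prime_power_of p q"
    unfolding prime_power_of_def using one_less_power[OF prime_gt_1_nat[OF assms] j(1)] j(2) by blast
qed

text \<open>
  With the cycle lengths \<open>A\<close> of a permutation and \<open>B\<close> of a power of it, these are the powers of
  \<open>p\<close> that get lost from the cycle lengths; \<open>M\<close> only has to exceed all lengths.
\<close>

definition lost_powers :: "nat \<Rightarrow> nat set \<Rightarrow> nat set \<Rightarrow> nat \<Rightarrow> nat set" where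
  "lost_powers M A B p = {q. q < M \<and> prime_power_of p q \<and> (\<exists>l\<in>A. q dvd l) \<and> \<not> (\<exists>l\<in>B. q dvd l)}"

definition exponent :: "nat \<Rightarrow> nat set \<Rightarrow> nat set \<Rightarrow> nat" where
  "exponent M A B = (\<Prod>p | p < M \<and> prime p. p ^ card (lost_powers M A B p))"

lemma exponent_pos: "0 < exponent M A B"
  unfolding exponent_def by (rule prod_pos) (auto dest: prime_gt_0_nat)

text \<open>
  With \<open>a\<close> the largest exponent of \<open>p\<close> in \<open>A\<close> and \<open>v\<close> its exponent in \<open>k\<close>, the power \<open>p ^ j\<close>
  divides an element of \<open>A\<close> if \<open>j \<le> a\<close>, and an element of \<open>B\<close> if \<open>j \<le> a - v\<close> (truncated). The
  lost exponents are those in between.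
\<close>

lemma card_lost_powers:
  assumes A: "A \<noteq> {}" "A \<subseteq> {1..<M}" and p: "prime p" and k: "0 < k"
    and B: "B = (\<lambda>l. l div gcd l k) ` A"
  shows "card (lost_powers M A B p) = min (Max (multiplicity p ` A)) (multiplicity p k)"
proof -
  let ?v = "multiplicity p"
  define a where "a = Max (?v ` A)"
  have fin: "finite A" using A(2) finite_subset by blast
  have pos: "l > 0" if "l \<in> A" for l using A that by auto
  have max: "(\<exists>l\<in>A. j \<le> ?v l) \<longleftrightarrow> j \<le> a" for j
    using Max_ge_iff[of "?v ` A" j] fin A(1) by (auto simp: a_def)
  have dvd: "p ^ j dvd l \<longleftrightarrow> j \<le> ?v l" if "l > 0" for l j
    using that p by (intro power_dvd_iff_le_multiplicity) auto
  have vB: "?v (l div gcd l k) = ?v l - ?v k" if "l \<in> A" for l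
  proof -
    have l: "l > 0" by (rule pos[OF that])
    have g: "?v (gcd l k) = min (?v l) (?v k)"
    proof -
      have "j \<le> ?v (gcd l k) \<longleftrightarrow> j \<le> min (?v l) (?v k)" for j
        using dvd[of "gcd l k" j] dvd[of l j] dvd[of k j] l k by (simp add: gcd_greatest_iff)
      then show ?thesis by (metis le_refl le_antisym)
    qed
    have "?v l = ?v (gcd l k) + ?v (l div gcd l k)"
      using l p prime_elem_multiplicity_mult_distrib[of p "gcd l k" "l div gcd l k"]
      by (auto simp: dvd_div_eq_0_iff)
    then show ?thesis using g by (simp add: min_def split: if_splits)
  qed
  have dvdB: "(\<exists>l\<in>B. p ^ j dvd l) \<longleftrightarrow> (\<exists>l\<in>A. j \<le> ?v l - ?v k)" for j
  proof -
    have "l div gcd l k > 0" if "l \<in> A" for l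
      using pos[OF that] by (simp add: div_greater_zero_iff gcd_le1_nat)
    then show ?thesis using vB dvd unfolding B by simp
  qed
  have "lost_powers M A B p = (\<lambda>j. p ^ j) ` {a - ?v k<..a}"
  proof (intro equalityI subsetI)
    fix q assume q: "q \<in> lost_powers M A B p"
    then obtain j where j: "j > 0" "q = p ^ j"
      using prime_power_of_iff[OF p] by (auto simp: lost_powers_def)
    have "j \<le> a" using q j dvd pos max by (auto simp: lost_powers_def)
    moreover have "\<not> j \<le> a - ?v k"
    proof
      assume "j \<le> a - ?v k"
      then have "j + ?v k \<le> a" using j by simp
      then obtain l where "l \<in> A" "j + ?v k \<le> ?v l" using max by blast
      then have "\<exists>l\<in>A. j \<le> ?v l - ?v k" by (intro bexI[of _ l]) auto
      then show False using q j dvdB by (auto simp: lost_powers_def)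
    qed
    ultimately show "q \<in> (\<lambda>j. p ^ j) ` {a - ?v k<..a}" using j by auto
  next
    fix q assume "q \<in> (\<lambda>j. p ^ j) ` {a - ?v k<..a}"
    then obtain j where j: "q = p ^ j" "a - ?v k < j" "j \<le> a" by auto
    obtain l where l: "l \<in> A" "q dvd l" using max j dvd pos by metis
    have "q < M" using dvd_imp_le[OF l(2) pos[OF l(1)]] l(1) A(2) by force
    have "\<not> (\<exists>l\<in>A. j \<le> ?v l - ?v k)"
    proof
      assume "\<exists>l\<in>A. j \<le> ?v l - ?v k"
      then obtain l where l: "l \<in> A" "j \<le> ?v l - ?v k" by blast
      then have "?v l \<le> a" using max by blast
      then show False using l j by simp
    qed
    then have "\<not> (\<exists>l\<in>B. q dvd l)" using dvdB[of j] j(1) by simp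
    moreover have "prime_power_of p q" unfolding prime_power_of_iff[OF p] using j by (intro exI[of _ j]) simp
    ultimately show "q \<in> lost_powers M A B p"
      unfolding lost_powers_def using l \<open>q < M\<close> by blast
  qed
  moreover have "inj_on (\<lambda>j. p ^ j) {a - ?v k<..a}"
    using prime_gt_1_nat[OF p] by (intro inj_onI) simp
  ultimately have "card (lost_powers M A B p) = a - (a - ?v k)" by (simp add: card_image)
  then show ?thesis by (simp add: a_def min_def)
qed

text \<open>
  The exponent of \<open>p\<close> in \<open>exponent M A B\<close> is that in \<open>k\<close>, cut off at the largest exponent in \<open>A\<close>. For the
  greatest common divisor with an element of \<open>A\<close> this makes no difference.
\<close>

lemma gcd_exponent:
  assumes A: "A \<subseteq> {1..<M}" and k: "0 < k" and B: "B = (\<lambda>l. l div gcd l k) ` A" and l: "l \<in> A"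
  shows "gcd l (exponent M A B) = gcd l k"
proof (rule multiplicity_eq_nat)
  show "0 < gcd l (exponent M A B)" "0 < gcd l k" using k exponent_pos[of M A B] by auto
  fix p :: nat assume p: "prime p"
  let ?v = "multiplicity p"
  have pos: "0 < l" using A l by auto
  have dvd: "p ^ j dvd x \<longleftrightarrow> j \<le> ?v x" if "x > 0" for x j
    using that p by (intro power_dvd_iff_le_multiplicity) auto
  have g: "?v (gcd l x) = min (?v l) (?v x)" if "x > 0" for x
  proof -
    have "j \<le> ?v (gcd l x) \<longleftrightarrow> j \<le> min (?v l) (?v x)" for j
      using dvd[of "gcd l x" j] dvd[of l j] dvd[of x j] pos that by (simp add: gcd_greatest_iff)
    then show ?thesis by (metis le_refl le_antisym)
  qed
  have "min (?v l) (?v (exponent M A B)) = min (?v l) (?v k)"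
  proof (cases "p < M")
    case True
    then have "?v (exponent M A B) = card (lost_powers M A B p)"
      unfolding exponent_def using p by (subst multiplicity_prod_prime_powers) auto
    also have "\<dots> = min (Max (?v ` A)) (?v k)"
      using card_lost_powers[OF _ A p k B] l by blast
    finally have "?v (exponent M A B) = min (Max (?v ` A)) (?v k)" .
    moreover have "?v l \<le> Max (?v ` A)"
      using l finite_subset[OF A] by (intro Max_ge) auto
    ultimately show ?thesis by (simp add: min_def)
  next
    case False
    then have "\<not> p dvd l" using A l by (auto dest!: dvd_imp_le)
    then have "?v l = 0" by (rule not_dvd_imp_multiplicity_0)
    then show ?thesis by simp
  qed
  then show "?v (gcd l (exponent M A B)) = ?v (gcd l k)" using g exponent_pos k by simp
qed

definition cycle_lengths :: "nat \<Rightarrow> (nat \<Rightarrow> nat) \<Rightarrow> nat set" where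
  "cycle_lengths n p = (\<lambda>x. card (orbit p x)) ` {1..n}"

text \<open>
  If some power of \<open>p\<close> has the cycle type of \<open>r\<close>, then the cycle lengths of \<open>p\<close> and \<open>r\<close> determine
  the exponent up to its effect on cycle lengths, so it suffices to test one exponent. Conversely, the tested
  element is itself a power of \<open>p\<close>.
\<close>

theorem cycle_type_of_power:
  assumes p: "p permutes {1..n}" and r: "r permutes {1..n}" and M: "n < M"
  shows "(\<exists>s \<in> generate (sym_group n) {p}. cycle_type n s = cycle_type n r) \<longleftrightarrow>
    cycle_type n (p ^^ exponent M (cycle_lengths n p) (cycle_lengths n r)) = cycle_type n r"
proof
  let ?E = "exponent M (cycle_lengths n p) (cycle_lengths n r)"
  assume "\<exists>s \<in> generate (sym_group n) {p}. cycle_type n s = cycle_type n r"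
  then obtain k where k: "0 < k" "cycle_type n (p ^^ k) = cycle_type n r"
    unfolding generate_sym_group[OF p] by blast
  have perm: "permutation p" using p by (auto simp: permutation_permutes)
  have lengths: "cycle_lengths n q = set_mset (cycle_type n q)" if "q permutes {1..n}" for q
    unfolding cycle_type_orbits[OF that] cycle_lengths_def by auto
  have "cycle_lengths n r = cycle_lengths n (p ^^ k)"
    using lengths[OF r] lengths[OF permutes_funpow[OF p]] k by simp
  also have "\<dots> = (\<lambda>l. l div gcd l k) ` cycle_lengths n p"
    by (simp add: cycle_lengths_def image_image card_orbit_funpow[OF perm])
  finally have B: "cycle_lengths n r = (\<lambda>l. l div gcd l k) ` cycle_lengths n p" .
  have A: "cycle_lengths n p \<subseteq> {1..<M}"
  proof
    fix l assume "l \<in> cycle_lengths n p"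
    then obtain x where x: "x \<in> {1..n}" "l = card (orbit p x)" by (auto simp: cycle_lengths_def)
    then have "l \<le> card {1..n}" using card_mono[OF _ permutes_orbit_subset[OF p x(1)]] by simp
    then show "l \<in> {1..<M}" using card_orbit_pos[OF perm, of x] x M by auto
  qed
  have same: "card (orbit (p ^^ ?E) x) = card (orbit (p ^^ k) x)" if "x \<in> {1..n}" for x
    using gcd_exponent[OF A k(1) B, of "card (orbit p x)"] that
    by (auto simp: card_orbit_funpow[OF perm] cycle_lengths_def)
  have "{x\<in>{1..n}. card (orbit (p ^^ ?E) x) = L} = {x\<in>{1..n}. card (orbit (p ^^ k) x) = L}" for L
    using same by auto
  then have "cycle_type n (p ^^ ?E) = cycle_type n (p ^^ k)"
    using cycle_type_eq_iff permutes_funpow[OF p] by simp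
  then show "cycle_type n (p ^^ ?E) = cycle_type n r" using k by simp
next
  assume "cycle_type n (p ^^ exponent M (cycle_lengths n p) (cycle_lengths n r)) = cycle_type n r"
  then show "\<exists>s \<in> generate (sym_group n) {p}. cycle_type n s = cycle_type n r"
    unfolding generate_sym_group[OF p] using exponent_pos by blast
qed

section \<open>The decision procedure\<close>

definition cadd :: "'a list \<Rightarrow> nat \<Rightarrow> nat \<Rightarrow> nat" where
  "cadd w a b = iter b (\<lambda>_. csuc w) a"

lemma cadd: "a \<le> length w + 1 \<Longrightarrow> cadd w a b = min (a + b) (length w + 1)"
  by (induction b) (auto simp: cadd_def csuc_def)

lemma logf_cadd: "logf a \<Longrightarrow> logf b \<Longrightarrow> logf (\<lambda>w \<rho>. cadd w (a w \<rho>) (b w \<rho>))"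
  by (rule logf_app2[of cadd]) (unfold cadd_def, intro log_rules)

definition letter_at :: "'a list \<Rightarrow> nat \<Rightarrow> 'a \<Rightarrow> bool" where
  "letter_at w i a \<longleftrightarrow> i < length w \<and> w ! i = a"

lemma logp_letter_at:
  assumes "logf i"
  shows "logp (\<lambda>w \<rho>. letter_at w (i w \<rho>) a)"
proof (rule logp_app1[OF _ assms])
  show "logp (\<lambda>w \<rho>. letter_at w (\<rho> 0) a)"
  proof (rule logp_cong)
    show "logp (\<lambda>w \<rho>. read_input w (csuc w (\<rho> 0)) = Letter a)"
      by (intro logp_input[where Q = "\<lambda>s. s = Letter a"] log_rules)
  qed (auto simp: letter_at_def read_input_def csuc_def min_def le_Suc_eq)
qed

definition letters :: "'a list \<Rightarrow> 'a \<Rightarrow> nat" where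
  "letters w a = card {i. i < length w \<and> letter_at w i a}"

definition commas_before :: "letter list \<Rightarrow> nat \<Rightarrow> nat" where
  "commas_before w i = card {j. j < i \<and> letter_at w j Comma}"

text \<open>
  The number behind the \<open>k\<close>-th comma, saturated at \<open>length w + 1\<close>. An iteration carries only one
  value; therefore the commas are counted anew at each position.
\<close>

definition field :: "letter list \<Rightarrow> nat \<Rightarrow> nat" where
  "field w k = iter (length w)
     (\<lambda>i v. if commas_before w i = k then
         if letter_at w i (Bit True) then csuc w (cadd w v v)
         else if letter_at w i (Bit False) then cadd w v v else v
       else v) 0"

lemma logf_letters: "logf (\<lambda>w \<rho>. letters w a)"
  unfolding letters_def by (intro log_rules logp_letter_at)

lemma logf_commas_before: "logf i \<Longrightarrow> logf (\<lambda>w \<rho>. commas_before w (i w \<rho>))"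
  by (rule logf_app1[of commas_before]) (unfold commas_before_def, intro log_rules logp_letter_at)

lemma logf_field: "logf k \<Longrightarrow> logf (\<lambda>w \<rho>. field w (k w \<rho>))"
  by (rule logf_app1[of field])
    (unfold field_def, intro log_rules logp_letter_at logf_commas_before logf_cadd)

text \<open>
  Without a generator the generated group is trivial and may as well be generated by the identity.
\<close>

definition first_perm :: "letter list \<Rightarrow> nat \<Rightarrow> nat" where
  "first_perm w x = (if letters w Semicolon = 1 then x else field w x)"

definition target_perm :: "letter list \<Rightarrow> nat \<Rightarrow> nat" where
  "target_perm w x =
     (if letters w Semicolon = 1 then field w x else field w (cadd w (letters w Tick) x))"

lemma logf_first_perm: "logf x \<Longrightarrow> logf (\<lambda>w \<rho>. first_perm w (x w \<rho>))"
  by (rule logf_app1[of first_perm]) (unfold first_perm_def, intro log_rules logf_letters logf_field)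

lemma logf_target_perm: "logf x \<Longrightarrow> logf (\<lambda>w \<rho>. target_perm w (x w \<rho>))"
  by (rule logf_app1[of target_perm])
    (unfold target_perm_def, intro log_rules logf_letters logf_field logf_cadd)

text \<open>
  Which letter may follow which; a numeral may be the last thing in the word, and must not begin
  with the digit 0.
\<close>

definition linked_at :: "letter list \<Rightarrow> nat \<Rightarrow> bool" where
  "linked_at w i \<longleftrightarrow>
     (letter_at w i Tick \<longrightarrow> letter_at w (csuc w i) Tick \<or> letter_at w (csuc w i) Semicolon) \<and>
     (letter_at w i Semicolon \<longrightarrow> letter_at w (csuc w i) Comma) \<and>
     (letter_at w i Comma \<longrightarrow> letter_at w (csuc w i) (Bit True)) \<and>
     (letter_at w i (Bit True) \<or> letter_at w i (Bit False) \<longrightarrow> \<not> letter_at w (csuc w i) Tick)"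

text \<open>
  Local conditions and counts suffice to recognise words of the right shape. In the case of two
  permutations, the existence of a semicolon behind exactly \<open>n\<close> commas (there \<open>n > 0\<close> is the number of
  ticks) makes the two blocks equally long. As the word is not empty, \<open>csuc w 1\<close> is 2.
\<close>

definition syntax_ok :: "letter list \<Rightarrow> bool" where
  "syntax_ok w \<longleftrightarrow> letter_at w 0 Tick \<and> (\<forall>i<length w. linked_at w i) \<and>
     (letters w Semicolon = 1 \<and> letters w Comma = letters w Tick \<or>
      letters w Semicolon = csuc w 1 \<and> letters w Comma = cadd w (letters w Tick) (letters w Tick) \<and>
        (\<exists>i<length w. letter_at w i Semicolon \<and> commas_before w i = letters w Tick))"

definition is_point :: "letter list \<Rightarrow> nat \<Rightarrow> bool" where
  "is_point w x \<longleftrightarrow> 1 \<le> x \<and> x \<le> letters w Tick"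

definition perm_ok :: "letter list \<Rightarrow> (nat \<Rightarrow> nat) \<Rightarrow> bool" where
  "perm_ok w f \<longleftrightarrow> (\<forall>x<length w + 1. is_point w x \<longrightarrow> is_point w (f x) \<and>
     (\<forall>y<length w + 1. is_point w y \<and> f x = f y \<longrightarrow> x = y))"

lemma logp_linked_at: "logf i \<Longrightarrow> logp (\<lambda>w \<rho>. linked_at w (i w \<rho>))"
  by (rule logp_app1[of linked_at]) (unfold linked_at_def, intro log_rules logp_letter_at)

lemma logp_syntax_ok: "logp (\<lambda>w \<rho>. syntax_ok w)"
  unfolding syntax_ok_def
  by (intro log_rules logp_letter_at logp_linked_at logf_letters logf_cadd logf_commas_before)

lemma logp_is_point: "logf x \<Longrightarrow> logp (\<lambda>w \<rho>. is_point w (x w \<rho>))"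
  by (rule logp_app1[of is_point]) (unfold is_point_def, intro log_rules logf_letters)

lemma logp_perm_ok:
  assumes "\<And>x. logf x \<Longrightarrow> logf (\<lambda>w \<rho>. f w (x w \<rho>))"
  shows "logp (\<lambda>w \<rho>. perm_ok w (f w))"
  unfolding perm_ok_def by (intro log_rules logp_is_point assms)

text \<open>
  Points and exponents may range up to \<open>length w\<close>, since the permuted points are at most as many as
  the letters of \<open>w\<close>.
\<close>

definition cycle_len :: "'a list \<Rightarrow> (nat \<Rightarrow> nat) \<Rightarrow> nat \<Rightarrow> nat" where
  "cycle_len w f x = card {y. y < length w + 1 \<and> (\<exists>k<length w + 1. (f ^^ k) x = y)}"

lemma logf_cycle_len:
  assumes "\<And>x. logf x \<Longrightarrow> logf (\<lambda>w \<rho>. f w (x w \<rho>))" "logf x"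
  shows "logf (\<lambda>w \<rho>. cycle_len w (f w) (x w \<rho>))"
  by (rule logf_app1[of "\<lambda>w. cycle_len w (f w)", OF _ assms(2)])
    (unfold cycle_len_def, intro log_rules logf_funpow assms(1))

definition divides_cycle :: "letter list \<Rightarrow> (nat \<Rightarrow> nat) \<Rightarrow> nat \<Rightarrow> bool" where
  "divides_cycle w f q \<longleftrightarrow> (\<exists>x<length w + 1. is_point w x \<and> q dvd cycle_len w f x)"

lemma logp_divides_cycle:
  assumes "\<And>x. logf x \<Longrightarrow> logf (\<lambda>w \<rho>. f w (x w \<rho>))" "logf q"
  shows "logp (\<lambda>w \<rho>. divides_cycle w (f w) (q w \<rho>))"
  by (rule logp_app1[of "\<lambda>w. divides_cycle w (f w)", OF _ assms(2)])
    (unfold divides_cycle_def, intro log_rules logp_is_point logp_dvd logf_cycle_len assms(1))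

definition prime_below :: "'a list \<Rightarrow> nat \<Rightarrow> bool" where
  "prime_below w p \<longleftrightarrow> 1 < p \<and> (\<forall>d<length w + 1. d dvd p \<longrightarrow> d = 1 \<or> d = p)"

definition lost_power :: "letter list \<Rightarrow> nat \<Rightarrow> nat \<Rightarrow> bool" where
  "lost_power w p q \<longleftrightarrow> (1 < q \<and> (\<forall>d<length w + 1. d dvd q \<longrightarrow> d = 1 \<or> p dvd d)) \<and>
     divides_cycle w (first_perm w) q \<and> \<not> divides_cycle w (target_perm w) q"

text \<open>
  The exponent of \<open>cycle_type_of_power\<close> modulo \<open>l\<close>: the outer loop runs through the primes, the
  inner one multiplies by the prime for each of its lost powers.
\<close>

definition exponent_mod :: "letter list \<Rightarrow> nat \<Rightarrow> nat" where
  "exponent_mod w l = iter (length w + 1)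
     (\<lambda>p v. if prime_below w p
       then iter (length w + 1) (\<lambda>q v. if lost_power w p q then modmul w l v p else v) v
       else v) (modadd w l 0 1)"

lemma logp_prime_below: "logf p \<Longrightarrow> logp (\<lambda>w \<rho>. prime_below w (p w \<rho>))"
  by (rule logp_app1[of prime_below]) (unfold prime_below_def, intro log_rules logp_dvd)

lemma logp_lost_power: "logf p \<Longrightarrow> logf q \<Longrightarrow> logp (\<lambda>w \<rho>. lost_power w (p w \<rho>) (q w \<rho>))"
  by (rule logp_app2[of lost_power])
    (unfold lost_power_def,
      intro log_rules logp_dvd logp_divides_cycle logf_first_perm logf_target_perm)

lemma logf_exponent_mod: "logf l \<Longrightarrow> logf (\<lambda>w \<rho>. exponent_mod w (l w \<rho>))"
  by (rule logf_app1[of exponent_mod])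
    (unfold exponent_mod_def,
      intro log_rules logp_prime_below logp_lost_power logf_modmul logf_modadd)

definition power_perm :: "letter list \<Rightarrow> nat \<Rightarrow> nat" where
  "power_perm w x = (first_perm w ^^ exponent_mod w (cycle_len w (first_perm w) x)) x"

lemma logf_power_perm: "logf x \<Longrightarrow> logf (\<lambda>w \<rho>. power_perm w (x w \<rho>))"
  by (rule logf_app1[of power_perm])
    (unfold power_perm_def,
      intro logf_var logf_funpow logf_exponent_mod logf_cycle_len logf_first_perm)

definition points_on_cycles :: "letter list \<Rightarrow> (nat \<Rightarrow> nat) \<Rightarrow> nat \<Rightarrow> nat" where
  "points_on_cycles w f L = card {x. x < length w + 1 \<and> is_point w x \<and> cycle_len w f x = L}"

definition accepted :: "letter list \<Rightarrow> bool" where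
  "accepted w \<longleftrightarrow> syntax_ok w \<and> perm_ok w (first_perm w) \<and> perm_ok w (target_perm w) \<and>
     (\<forall>L<length w + 1. points_on_cycles w (power_perm w) L = points_on_cycles w (target_perm w) L)"

lemma logf_points_on_cycles:
  assumes "\<And>x. logf x \<Longrightarrow> logf (\<lambda>w \<rho>. f w (x w \<rho>))" "logf L"
  shows "logf (\<lambda>w \<rho>. points_on_cycles w (f w) (L w \<rho>))"
  by (rule logf_app1[of "\<lambda>w. points_on_cycles w (f w)", OF _ assms(2)])
    (unfold points_on_cycles_def, intro log_rules logp_is_point logf_cycle_len assms(1))

lemma logp_accepted: "logp (\<lambda>w \<rho>. accepted w)"
  unfolding accepted_def
  by (intro log_rules logp_syntax_ok logp_perm_ok logf_points_on_cycles logf_power_perm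
      logf_first_perm logf_target_perm)

section \<open>The shape of instances\<close>

text \<open>
  The binary representations of the positive numbers.
\<close>

definition numeral_word :: "letter list \<Rightarrow> bool" where
  "numeral_word s \<longleftrightarrow> set s \<subseteq> range Bit \<and> s \<noteq> [] \<and> hd s = Bit True"

definition numeral_value :: "letter list \<Rightarrow> nat" where
  "numeral_value s = foldl (\<lambda>v a. 2 * v + of_bool (a = Bit True)) 0 s"

abbreviation comma_list :: "letter list list \<Rightarrow> letter list" where
  "comma_list ss \<equiv> concat (map ((#) Comma) ss)"

abbreviation block_list :: "letter list list list \<Rightarrow> letter list" where
  "block_list bs \<equiv> concat (map (\<lambda>b. Semicolon # comma_list b) bs)"

definition layout :: "nat \<Rightarrow> letter list list list \<Rightarrow> letter list" where
  "layout n bs = replicate n Tick @ block_list bs"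

definition block_ok :: "letter list list \<Rightarrow> bool" where
  "block_ok b \<longleftrightarrow> b \<noteq> [] \<and> (\<forall>s\<in>set b. numeral_word s)"

lemma numeral_value_snoc: "numeral_value (s @ [a]) = 2 * numeral_value s + of_bool (a = Bit True)"
  by (simp add: numeral_value_def)

lemma numeral_value_binary: "numeral_value (binary v) = v"
proof (induction v rule: binary.induct)
  case (1 v)
  show ?case
  proof (cases "v = 0")
    case False
    then show ?thesis
      using 1 by (subst binary.simps) (simp add: numeral_value_snoc)
  qed (simp add: binary.simps numeral_value_def)
qed

lemma numeral_word_binary: "v \<noteq> 0 \<Longrightarrow> numeral_word (binary v)"
proof (induction v rule: binary.induct)
  case (1 v)
  show ?case
  proof (cases "v div 2 = 0")
    case True
    then have "v = 1" using 1 by linarith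
    then show ?thesis by (simp add: numeral_word_def binary.simps)
  next
    case False
    then have "numeral_word (binary (v div 2))" using 1 by blast
    then show ?thesis using 1(2) by (subst binary.simps) (auto simp: numeral_word_def)
  qed
qed

lemma numeral_value_pos: "numeral_word s \<Longrightarrow> 0 < numeral_value s"
proof (induction s rule: rev_induct)
  case (snoc a s)
  show ?case
  proof (cases "s = []")
    case False
    then show ?thesis using snoc by (auto simp: numeral_word_def numeral_value_snoc)
  qed (use snoc in \<open>auto simp: numeral_word_def numeral_value_def\<close>)
qed (simp add: numeral_word_def)

lemma binary_numeral_value: "numeral_word s \<Longrightarrow> binary (numeral_value s) = s"
proof (induction s rule: rev_induct)
  case (snoc a s)
  obtain b where a: "a = Bit b" using snoc.prems by (auto simp: numeral_word_def)
  have IH: "binary (numeral_value s) = s"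
  proof (cases "s = []")
    case True
    then show ?thesis by (simp add: numeral_value_def binary.simps)
  next
    case False
    then show ?thesis using snoc by (auto simp: numeral_word_def)
  qed
  have "0 < numeral_value (s @ [a])" using numeral_value_pos snoc.prems by blast
  then show ?case
    using IH a by (subst binary.simps) (simp add: numeral_value_snoc)
qed (simp add: numeral_word_def)

lemma encode_layout:
  "encode (n, ps, r) = layout n (map (\<lambda>p. map (\<lambda>i. binary (p i)) [1..<n+1]) (ps @ [r]))"
  by (simp add: layout_def encode_perm_def comp_def)

fun follows :: "letter \<Rightarrow> letter list \<Rightarrow> bool" where
  "follows Tick u \<longleftrightarrow> u \<noteq> [] \<and> (hd u = Tick \<or> hd u = Semicolon)"
| "follows Semicolon u \<longleftrightarrow> u \<noteq> [] \<and> hd u = Comma"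
| "follows Comma u \<longleftrightarrow> u \<noteq> [] \<and> hd u = Bit True"
| "follows (Bit b) u \<longleftrightarrow> u = [] \<or> hd u \<noteq> Tick"

fun linked :: "letter list \<Rightarrow> bool" where
  "linked [] \<longleftrightarrow> True"
| "linked (a # u) \<longleftrightarrow> follows a u \<and> linked u"

lemma linked_iff_nth: "linked w \<longleftrightarrow> (\<forall>i<length w. follows (w ! i) (drop (Suc i) w))"
  by (induction w) (simp_all add: All_less_Suc2)

lemma linked_iff_linked_at: "linked w \<longleftrightarrow> (\<forall>i<length w. linked_at w i)"
proof -
  have "follows (w ! i) (drop (Suc i) w) \<longleftrightarrow> linked_at w i" if i: "i < length w" for i
  proof -
    have "letter_at w (csuc w i) a \<longleftrightarrow> drop (Suc i) w \<noteq> [] \<and> hd (drop (Suc i) w) = a" for a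
      using i by (auto simp: letter_at_def csuc_def hd_drop_conv_nth)
    then show ?thesis
      using i by (cases "w ! i") (auto simp: linked_at_def letter_at_def[of w i])
  qed
  then show ?thesis by (simp add: linked_iff_nth)
qed

text \<open>
  Parsing from the right: each letter extends, or closes, the piece that begins at the next letter.
  The parts \<open>s\<close> and \<open>ss\<close> are the digits and fields whose comma or semicolon is still to
  come on the left.
\<close>

lemma linked_parse:
  "linked u \<Longrightarrow> u = [] \<or> hd u \<noteq> Tick \<Longrightarrow>
   \<exists>s ss bs. u = s @ comma_list ss @ block_list bs \<and> set s \<subseteq> range Bit \<and>
     (\<forall>s\<in>set ss. numeral_word s) \<and> (\<forall>b\<in>set bs. block_ok b)"
proof (induction u)
  case Nil
  then show ?case by (intro exI[of _ "[]"]) simp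
next
  case (Cons a u)
  have "u = [] \<or> hd u \<noteq> Tick" using Cons.prems by (cases a) auto
  then obtain s ss bs where u: "u = s @ comma_list ss @ block_list bs" "set s \<subseteq> range Bit"
    "\<forall>s\<in>set ss. numeral_word s" "\<forall>b\<in>set bs. block_ok b"
    using Cons by auto
  show ?case
  proof (cases a)
    case Tick
    then show ?thesis using Cons.prems by simp
  next
    case Semicolon
    then have h: "u \<noteq> []" "hd u = Comma" using Cons.prems by auto
    then have s: "s = []" using u by (cases s) auto
    then have "ss \<noteq> []" using h u by (cases bs) auto
    then show ?thesis using u s Semicolon
      by (intro exI[of _ "[]"] exI[of _ "ss # bs"]) (auto simp: block_ok_def)
  next
    case Comma
    then have h: "u \<noteq> []" "hd u = Bit True" using Cons.prems by auto
    then have "s \<noteq> []" using u by (cases ss; cases bs) auto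
    then have "numeral_word s" using u h by (auto simp: numeral_word_def)
    then show ?thesis using u Comma
      by (intro exI[of _ "[]"] exI[of _ "s # ss"] exI[of _ bs]) auto
  next
    case (Bit b)
    then show ?thesis using u
      by (intro exI[of _ "a # s"] exI[of _ ss] exI[of _ bs]) auto
  qed
qed

lemma linked_layout_parse:
  "linked w \<Longrightarrow> w \<noteq> [] \<Longrightarrow> hd w = Tick \<Longrightarrow>
   \<exists>n bs. w = layout (Suc n) bs \<and> bs \<noteq> [] \<and> (\<forall>b\<in>set bs. block_ok b)"
proof (induction w)
  case (Cons a w)
  then have w: "w \<noteq> []" "hd w = Tick \<or> hd w = Semicolon" "linked w" "a = Tick" by auto
  show ?case
  proof (cases "hd w = Tick")
    case True
    then obtain n bs where "w = layout (Suc n) bs" "bs \<noteq> []" "\<forall>b\<in>set bs. block_ok b"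
      using Cons w by blast
    then show ?thesis using w by (intro exI[of _ "Suc n"] exI[of _ bs]) (simp add: layout_def)
  next
    case False
    then have h: "hd w = Semicolon" using w by blast
    obtain s ss bs where u: "w = s @ comma_list ss @ block_list bs" "set s \<subseteq> range Bit"
      "\<forall>b\<in>set bs. block_ok b"
      using linked_parse[OF w(3)] False by blast
    have "s = []" using u h by (cases s) auto
    then have "ss = []" using u h by (cases ss) auto
    then have "w = block_list bs" using u \<open>s = []\<close> by simp
    moreover from this have "bs \<noteq> []" using w by auto
    ultimately show ?thesis using u w by (intro exI[of _ 0] exI[of _ bs]) (simp add: layout_def)
  qed
qed simp

lemma linked_bits: "set s \<subseteq> range Bit \<Longrightarrow> linked u \<Longrightarrow> u = [] \<or> hd u \<noteq> Tick \<Longrightarrow> linked (s @ u)"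
proof (induction s)
  case (Cons a s)
  then obtain b where "a = Bit b" by auto
  then show ?case using Cons by (cases s) auto
qed simp

lemma linked_comma_list:
  assumes "\<forall>s\<in>set ss. numeral_word s" "linked u" "u = [] \<or> hd u = Semicolon"
  shows "linked (comma_list ss @ u)"
  using assms(1)
proof (induction ss)
  case (Cons s ss)
  have "comma_list ss @ u = [] \<or> hd (comma_list ss @ u) \<noteq> Tick"
    using assms(3) by (cases ss) auto
  moreover have "set s \<subseteq> range Bit" "linked (comma_list ss @ u)"
    using Cons by (auto simp: numeral_word_def)
  ultimately have "linked (s @ comma_list ss @ u)" by (intro linked_bits[of s])
  moreover have "s \<noteq> []" "hd s = Bit True" using Cons by (auto simp: numeral_word_def)
  ultimately show ?case by simp
qed (use assms in simp)

lemma linked_layout: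
  assumes "bs \<noteq> []" "\<forall>b\<in>set bs. block_ok b"
  shows "linked (layout n bs)"
proof -
  have "linked (block_list bs)"
    using assms(2)
  proof (induction bs)
    case (Cons b bs)
    have "block_list bs = [] \<or> hd (block_list bs) = Semicolon" by (cases bs) auto
    then have "linked (comma_list b @ block_list bs)"
      using Cons by (intro linked_comma_list) (auto simp: block_ok_def)
    moreover have "b \<noteq> []" using Cons by (auto simp: block_ok_def)
    ultimately show ?case by (cases b) auto
  qed simp
  moreover have "block_list bs \<noteq> [] \<and> hd (block_list bs) = Semicolon" using assms(1) by (cases bs) auto
  ultimately show ?thesis
    unfolding layout_def by (induction n) (auto simp: hd_append)
qed

lemma letters_eq_filter: "letters w a = length (filter (\<lambda>x. x = a) w)"
  unfolding letters_def letter_at_def length_filter_conv_card by (rule arg_cong[where f = card]) auto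

lemma letters_append: "letters (u @ v) a = letters u a + letters v a"
  by (simp add: letters_eq_filter)

lemma commas_before_eq: "i \<le> length w \<Longrightarrow> commas_before w i = letters (take i w) Comma"
  unfolding commas_before_def letters_def letter_at_def by (rule arg_cong[where f = card]) auto

lemma separators_not_bits [simp]: "Tick \<notin> range Bit" "Semicolon \<notin> range Bit" "Comma \<notin> range Bit"
  by auto

lemma letters_numeral: "numeral_word s \<Longrightarrow> a \<notin> range Bit \<Longrightarrow> letters s a = 0"
  by (auto simp: letters_eq_filter numeral_word_def filter_empty_conv)

lemma letters_Cons: "letters (b # u) a = of_bool (b = a) + letters u a"
  by (simp add: letters_eq_filter)

lemma letters_Nil: "letters [] a = 0"
  by (simp add: letters_eq_filter)

lemma letters_comma_list:
  "\<forall>s\<in>set ss. numeral_word s \<Longrightarrow> a \<notin> range Bit \<Longrightarrow>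
     letters (comma_list ss) a = (if a = Comma then length ss else 0)"
  by (induction ss) (auto simp: letters_Nil letters_Cons letters_append letters_numeral)

lemma letters_block_list:
  "\<forall>b\<in>set bs. block_ok b \<Longrightarrow> a \<notin> range Bit \<Longrightarrow>
     letters (block_list bs) a =
       (if a = Semicolon then length bs else if a = Comma then sum_list (map length bs) else 0)"
  by (induction bs) (auto simp: letters_Nil letters_Cons letters_append letters_comma_list block_ok_def)

lemma letters_replicate: "letters (replicate n b) a = (if a = b then n else 0)"
  by (induction n) (auto simp: letters_Nil letters_Cons)

lemma letters_layout:
  assumes "\<forall>b\<in>set bs. block_ok b"
  shows "letters (layout n bs) Tick = n" "letters (layout n bs) Semicolon = length bs"
    "letters (layout n bs) Comma = sum_list (map length bs)"
  using assms by (auto simp: layout_def letters_append letters_replicate letters_block_list)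

lemma separator_split:
  assumes "x \<notin> set r" "x \<notin> set c" "x \<notin> set d" "r @ x # c @ x # d = u @ x # v"
  shows "u = r \<or> u = r @ x # c"
  using assms by (auto simp: append_eq_append_conv2 append_eq_Cons_conv Cons_eq_append_conv)

text \<open>
  The letters determine a sequence of blocks, and the counts their number and lengths. If there are two
  blocks, a semicolon behind \<open>n > 0\<close> commas can only be the second one, so the first block has \<open>n\<close>
  fields.
\<close>

lemma syntax_ok_iff:
  "syntax_ok w \<longleftrightarrow> (\<exists>n bs. w = layout n bs \<and> 1 \<le> n \<and> length bs \<in> {1, 2} \<and>
     (\<forall>b\<in>set bs. block_ok b \<and> length b = n))"
proof
  assume ok: "syntax_ok w"
  then have "linked w" "w \<noteq> []" "hd w = Tick"
    by (auto simp: syntax_ok_def linked_iff_linked_at letter_at_def hd_conv_nth)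
  then obtain n bs where w: "w = layout (Suc n) bs" "bs \<noteq> []" and bs: "\<forall>b\<in>set bs. block_ok b"
    using linked_layout_parse by blast
  note cnt = letters_layout[OF bs, of "Suc n", folded w(1)]
  have len: "Suc n \<le> length w" using w by (simp add: layout_def)
  have cs: "csuc w 1 = 2" "cadd w (Suc n) (Suc n) = min (Suc n + Suc n) (length w + 1)"
    using len cadd[of "Suc n" w "Suc n"] by (auto simp: csuc_def)
  from ok consider
    (one) "length bs = 1" "sum_list (map length bs) = Suc n"
    | (two) i where "length bs = 2" "sum_list (map length bs) = min (Suc n + Suc n) (length w + 1)"
      "i < length w" "letter_at w i Semicolon" "commas_before w i = Suc n"
    unfolding syntax_ok_def cnt cs by blast
  then show "\<exists>n bs. w = layout n bs \<and> 1 \<le> n \<and> length bs \<in> {1, 2} \<and>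
     (\<forall>b\<in>set bs. block_ok b \<and> length b = n)"
  proof cases
    case one
    then obtain b where "bs = [b]" by (auto simp: length_Suc_conv)
    then show ?thesis using one w bs by (intro exI[of _ "Suc n"] exI[of _ bs]) auto
  next
    case two
    then obtain b1 b2 where b: "bs = [b1, b2]" by (auto simp: numeral_2_eq_2 length_Suc_conv)
    have no: "Semicolon \<notin> set (comma_list b)" if "b \<in> set bs" for b
      using letters_comma_list[of b Semicolon] bs that
      by (auto simp: block_ok_def letters_eq_filter filter_empty_conv)
    have "take i w = replicate (Suc n) Tick \<or> take i w = replicate (Suc n) Tick @ Semicolon # comma_list b1"
    proof (rule separator_split)
      show "replicate (Suc n) Tick @ Semicolon # comma_list b1 @ Semicolon # comma_list b2 =
          take i w @ Semicolon # drop (Suc i) w"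
        using id_take_nth_drop[OF two(3)] two(4) w b by (simp add: letter_at_def layout_def)
    qed (use no b in auto)
    moreover have "letters (take i w) Comma = Suc n" using two commas_before_eq[of i w] by simp
    ultimately have "length b1 = Suc n"
      using bs b by (auto simp: letters_append letters_replicate letters_Cons letters_Nil
          letters_comma_list block_ok_def)
    moreover have "letters w Comma \<le> length w" by (simp add: letters_eq_filter)
    then have "length b2 = Suc n" using two(2) cnt b calculation by (simp add: min_def split: if_splits)
    ultimately show ?thesis using b w bs by (intro exI[of _ "Suc n"] exI[of _ bs]) auto
  qed
next
  assume "\<exists>n bs. w = layout n bs \<and> 1 \<le> n \<and> length bs \<in> {1, 2} \<and>
     (\<forall>b\<in>set bs. block_ok b \<and> length b = n)"
  then obtain n bs where w: "w = layout n bs" "1 \<le> n" "length bs \<in> {1, 2}"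
    and bs: "\<forall>b\<in>set bs. block_ok b" and len: "\<forall>b\<in>set bs. length b = n" by blast
  note cnt = letters_layout[OF bs, of n, folded w(1)]
  have "linked w" unfolding w(1) by (rule linked_layout) (use w bs in auto)
  then have lk: "\<forall>i<length w. linked_at w i" by (simp add: linked_iff_linked_at)
  have n: "n \<le> length w" using w by (simp add: layout_def)
  have tick: "letter_at w 0 Tick" using w n by (auto simp: letter_at_def layout_def nth_append)
  have cs: "csuc w 1 = 2" "cadd w n n = min (n + n) (length w + 1)"
    using n w(2) cadd[of n w n] by (auto simp: csuc_def)
  have "letters w Comma \<le> length w" by (simp add: letters_eq_filter)
  show "syntax_ok w"
  proof (cases "length bs = 1")
    case True
    then obtain b where "bs = [b]" by (auto simp: length_Suc_conv)
    then show ?thesis using lk tick cnt len by (simp add: syntax_ok_def)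
  next
    case False
    then obtain b1 b2 where b: "bs = [b1, b2]" using w(3) by (auto simp: numeral_2_eq_2 length_Suc_conv)
    have "letters w Comma = n + n" using cnt b len by simp
    \<comment> \<open>the position of the second semicolon\<close>
    let ?i = "n + 1 + length (comma_list b1)"
    have i: "?i < length w" "w ! ?i = Semicolon" "take ?i w = replicate n Tick @ Semicolon # comma_list b1"
      using w b by (auto simp: layout_def nth_append)
    then have "commas_before w ?i = n"
      using bs b len by (simp add: commas_before_eq letters_append letters_replicate letters_Cons
          letters_comma_list block_ok_def)
    then have "\<exists>i<length w. letter_at w i Semicolon \<and> commas_before w i = n"
      using i by (intro exI[of _ ?i]) (simp add: letter_at_def)
    then show ?thesis
      using lk tick cnt cs b \<open>letters w Comma = n + n\<close> \<open>letters w Comma \<le> length w\<close>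
      by (simp add: syntax_ok_def)
  qed
qed

section \<open>Reading a field\<close>

text \<open>
  The loop in \<open>field\<close> as an automaton that reads the word once: \<open>c\<close> commas have been seen, \<open>v\<close> is the
  value so far, and \<open>B\<close> is where it saturates. It obeys a law for concatenation and
  ignores all letters but commas and digits, so the division into blocks disappears.
\<close>

fun push_letter :: "nat \<Rightarrow> letter \<Rightarrow> nat \<Rightarrow> nat" where
  "push_letter B (Bit b) v = min (2 * v + of_bool b) B"
| "push_letter B a v = v"

fun read_field :: "nat \<Rightarrow> nat \<Rightarrow> nat \<Rightarrow> nat \<Rightarrow> letter list \<Rightarrow> nat" where
  "read_field B k c v [] = v"
| "read_field B k c v (a # u) =
     read_field B k (c + of_bool (a = Comma)) (if c = k then push_letter B a v else v) u"

lemma read_field_append: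
  "read_field B k c v (u @ u') = read_field B k (c + letters u Comma) (read_field B k c v u) u'"
  by (induction u arbitrary: c v) (auto simp: letters_Nil letters_Cons)

lemma field_eq_read_field: "field w k = read_field (length w + 1) k 0 0 w"
proof -
  let ?B = "length w + 1"
  define g where "g = (\<lambda>i v. if commas_before w i = k then
         if letter_at w i (Bit True) then csuc w (cadd w v v)
         else if letter_at w i (Bit False) then cadd w v v else v
       else v)"
  have "iter i g 0 = read_field ?B k 0 0 (take i w) \<and> iter i g 0 \<le> ?B" if "i \<le> length w" for i
    using that
  proof (induction i)
    case (Suc i)
    define v where "v = read_field ?B k 0 0 (take i w)"
    have IH: "iter i g 0 = v" "v \<le> ?B" using Suc by (auto simp: v_def)
    have "read_field ?B k 0 0 (take (Suc i) w) =
        (if commas_before w i = k then push_letter ?B (w ! i) v else v)"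
      using Suc.prems by (simp add: take_Suc_conv_app_nth read_field_append commas_before_eq v_def)
    also have "\<dots> = g i v"
      using Suc.prems IH(2)
      by (cases "w ! i") (auto simp: g_def letter_at_def csuc_def cadd split: if_splits)
    finally show ?case
      using IH by (cases "w ! i") (auto simp: g_def csuc_def cadd min_def letter_at_def)
  qed simp
  from this[of "length w"] show ?thesis unfolding field_def g_def by simp
qed

lemma read_field_filter:
  "read_field B k c v (filter (\<lambda>a. a = Comma \<or> a \<in> range Bit) u) = read_field B k c v u"
proof (induction u arbitrary: c v)
  case (Cons a u)
  then show ?case by (cases a) auto
qed simp

lemma read_field_past: "k < c \<Longrightarrow> read_field B k c v u = v"
  by (induction u arbitrary: c) auto

lemma read_field_before: "c \<noteq> k \<Longrightarrow> Comma \<notin> set u \<Longrightarrow> read_field B k c v u = v"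
  by (induction u) auto

lemma read_field_here:
  "set s \<subseteq> range Bit \<Longrightarrow>
     read_field B k k (min v B) s = min (foldl (\<lambda>v a. 2 * v + of_bool (a = Bit True)) v s) B"
proof (induction s arbitrary: v)
  case (Cons a s)
  then obtain b where a: "a = Bit b" by auto
  have "min (2 * min v B + of_bool b) B = min (2 * v + of_bool b) B" by auto
  then show ?case using Cons a by simp
qed simp

lemma read_field_comma_list:
  assumes "\<forall>s\<in>set ss. numeral_word s" "c < k" "k \<le> c + length ss"
  shows "read_field B k c 0 (comma_list ss) = min (numeral_value (ss ! (k - Suc c))) B"
  using assms
proof (induction ss arbitrary: c)
  case (Cons s ss)
  have s: "set s \<subseteq> range Bit" "letters s Comma = 0" "Comma \<notin> set s"
    using Cons.prems letters_numeral[of s Comma] by (auto simp: numeral_word_def)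
  show ?case
  proof (cases "k = Suc c")
    case True
    have "read_field B k k v (comma_list ss) = v" for v
      by (cases ss) (auto simp: read_field_past)
    then show ?thesis
      using True s read_field_here[of s B k 0] by (simp add: read_field_append numeral_value_def)
  next
    case False
    then have "read_field B k (Suc c) 0 (comma_list ss) = min (numeral_value (ss ! (k - Suc (Suc c)))) B"
      using Cons by auto
    moreover have "k - Suc c = Suc (k - Suc (Suc c))" using False Cons.prems by simp
    ultimately show ?thesis
      using s False Cons.prems by (simp add: read_field_append read_field_before)
  qed
qed simp

text \<open>
  Fields are numbered through all blocks.
\<close>

lemma field_layout:
  assumes bs: "\<forall>b\<in>set bs. block_ok b" and k: "1 \<le> k" "k \<le> length (concat bs)"
  shows "field (layout n bs) k =
    min (numeral_value (concat bs ! (k - 1))) (length (layout n bs) + 1)"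
proof -
  let ?P = "\<lambda>a. a = Comma \<or> a \<in> range Bit"
  have 1: "filter ?P (comma_list ss) = comma_list ss" if "\<forall>s\<in>set ss. numeral_word s" for ss
    using that by (auto simp: filter_id_conv numeral_word_def)
  have "filter ?P (block_list bs) = comma_list (concat bs)"
    using bs
  proof (induction bs)
    case (Cons b bs)
    then show ?case using 1[of b] by (simp add: block_ok_def)
  qed simp
  then have "filter ?P (layout n bs) = comma_list (concat bs)"
    by (simp add: layout_def)
  then have "field (layout n bs) k = read_field (length (layout n bs) + 1) k 0 0 (comma_list (concat bs))"
    unfolding field_eq_read_field using read_field_filter by metis
  also have "\<dots> = min (numeral_value (concat bs ! (k - 1))) (length (layout n bs) + 1)"
    using read_field_comma_list[of "concat bs" 0 k] bs k by (auto simp: block_ok_def)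
  finally show ?thesis .
qed

section \<open>Correctness of the procedure\<close>

lemma prod_iter:
  fixes v0 l :: nat
  assumes "\<And>p v. p < N \<Longrightarrow> v < l \<Longrightarrow> f p v = (if P p then v * a p mod l else v)" "v0 < l"
  shows "iter N f v0 = v0 * (\<Prod>p | p < N \<and> P p. a p) mod l"
proof -
  have "iter k f v0 = v0 * (\<Prod>p | p < k \<and> P p. a p) mod l" if "k \<le> N" for k
    using that
  proof (induction k)
    case 0
    then show ?case using assms(2) by simp
  next
    case (Suc k)
    have "{p. p < Suc k \<and> P p} = (if P k then insert k {p. p < k \<and> P p} else {p. p < k \<and> P p})"
      by (auto simp: less_Suc_eq)
    then have "(\<Prod>p | p < Suc k \<and> P p. a p) = (\<Prod>p | p < k \<and> P p. a p) * (if P k then a k else 1)"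
      by (auto simp: mult.commute)
    moreover have "iter k f v0 < l" using Suc assms(2) by simp
    then have "iter (Suc k) f v0 = (if P k then iter k f v0 * a k mod l else iter k f v0)"
      using assms(1)[of k "iter k f v0"] Suc.prems by simp
    ultimately show ?case using Suc by (auto simp: mod_simps mult.assoc)
  qed
  then show ?thesis by simp
qed

text \<open>
  The functions of the decision procedure are only meaningful on the points \<open>1, \<dots>, n\<close>. From
  the assumption that they agree there with permutations \<open>p\<close> and \<open>r\<close>, each of them is identified.
\<close>

context
  fixes w :: "letter list" and n :: nat and p r :: "nat \<Rightarrow> nat"
  assumes n: "letters w Tick = n" "n \<le> length w"
    and p: "p permutes {1..n}" "\<And>x. x \<in> {1..n} \<Longrightarrow> first_perm w x = p x"
    and r: "r permutes {1..n}" "\<And>x. x \<in> {1..n} \<Longrightarrow> target_perm w x = r x"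
begin

lemma is_point: "is_point w x \<longleftrightarrow> x \<in> {1..n}"
  using n by (auto simp: is_point_def)

lemma point_range: "x < length w + 1 \<and> is_point w x \<longleftrightarrow> x \<in> {1..n}"
  using n(2) by (auto simp: is_point)

lemma funpow_agree:
  assumes "q permutes {1..n}" "\<And>x. x \<in> {1..n} \<Longrightarrow> f x = q x" "x \<in> {1..n}"
  shows "(f ^^ k) x = (q ^^ k) x \<and> (q ^^ k) x \<in> {1..n}"
proof (induction k)
  case (Suc k)
  then show ?case using assms permutes_in_image[OF assms(1)] by simp
qed (use assms in simp)

lemma card_orbit_le:
  assumes "q permutes {1..n}" "x \<in> {1..n}"
  shows "card (orbit q x) \<le> n"
  using card_mono[OF _ permutes_orbit_subset[OF assms]] by simp

lemma cycle_len:
  assumes q: "q permutes {1..n}" "\<And>x. x \<in> {1..n} \<Longrightarrow> f x = q x" and x: "x \<in> {1..n}"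
  shows "cycle_len w f x = card (orbit q x)"
proof -
  have perm: "permutation q" using q by (auto simp: permutation_permutes)
  let ?l = "card (orbit q x)"
  have l: "?l \<le> n" "0 < ?l" "(q ^^ ?l) x = x"
    using card_orbit_le[OF q(1) x] card_orbit_pos[OF perm] funpow_fix_iff_card_orbit_dvd[OF perm, of ?l x]
    by auto
  have "{y. y < length w + 1 \<and> (\<exists>k<length w + 1. (f ^^ k) x = y)} = orbit q x"
  proof (intro equalityI subsetI)
    fix y assume "y \<in> {y. y < length w + 1 \<and> (\<exists>k<length w + 1. (f ^^ k) x = y)}"
    then show "y \<in> orbit q x"
      using funpow_agree[OF q x] unfolding orbit_altdef_permutation[OF perm] by auto
  next
    fix y assume "y \<in> orbit q x"
    then obtain k where k: "y = (q ^^ k) x" "k < ?l"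
      using orbit_altdef_bounded[OF l(3,2)] by blast
    have "(f ^^ k) x = y" "k < length w + 1" "y < length w + 1"
      using k funpow_agree[OF q x, of k] l(1) n(2) by auto
    then show "y \<in> {y. y < length w + 1 \<and> (\<exists>k<length w + 1. (f ^^ k) x = y)}" by blast
  qed
  then show ?thesis by (simp add: cycle_len_def)
qed

lemma divides_cycle:
  assumes "q permutes {1..n}" "\<And>x. x \<in> {1..n} \<Longrightarrow> f x = q x"
  shows "divides_cycle w f d \<longleftrightarrow> (\<exists>l\<in>cycle_lengths n q. d dvd l)"
proof -
  have "divides_cycle w f d \<longleftrightarrow> (\<exists>x\<in>{1..n}. d dvd cycle_len w f x)"
    unfolding divides_cycle_def using point_range by blast
  also have "\<dots> \<longleftrightarrow> (\<exists>x\<in>{1..n}. d dvd card (orbit q x))"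
    using cycle_len[OF assms] by simp
  finally show ?thesis by (simp add: cycle_lengths_def)
qed

lemma prime_below: "v < length w + 1 \<Longrightarrow> prime_below w v \<longleftrightarrow> prime v"
  unfolding prime_below_def prime_nat_iff
  using dvd_imp_le by (metis le_less_trans less_trans zero_less_one)

lemma lost_power:
  assumes "d < length w + 1"
  shows "lost_power w v d \<longleftrightarrow>
    d \<in> lost_powers (length w + 1) (cycle_lengths n p) (cycle_lengths n r) v"
proof -
  have "1 < d \<Longrightarrow> (\<forall>c<length w + 1. c dvd d \<longrightarrow> c = 1 \<or> v dvd c) \<longleftrightarrow> (\<forall>c. c dvd d \<longrightarrow> c = 1 \<or> v dvd c)"
    using assms by (meson dvd_imp_le le_less_trans less_trans zero_less_one)
  then show ?thesis
    using assms divides_cycle[OF p] divides_cycle[OF r]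
    by (auto simp: lost_power_def lost_powers_def prime_power_of_def)
qed

abbreviation "E \<equiv> exponent (length w + 1) (cycle_lengths n p) (cycle_lengths n r)"

lemma exponent_mod:
  assumes l: "0 < l" "l \<le> length w + 1"
  shows "exponent_mod w l = E mod l"
proof -
  let ?L = "lost_powers (length w + 1) (cycle_lengths n p) (cycle_lengths n r)"
  have inner: "iter (length w + 1) (\<lambda>q v. if lost_power w c q then modmul w l v c else v) v =
      v * c ^ card (?L c) mod l" if "v < l" for c v
  proof -
    have "{q. q < length w + 1 \<and> q \<in> ?L c} = ?L c" by (auto simp: lost_powers_def)
    then show ?thesis
      using prod_iter[of "length w + 1" l "\<lambda>q v. if lost_power w c q then modmul w l v c else v"
          "\<lambda>q. q \<in> ?L c" "\<lambda>_. c" v] that l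
      by (simp add: lost_power modmul)
  qed
  have one: "modadd w l 0 1 = 1 mod l" using modadd[of l w 0 1] l by simp
  have "exponent_mod w l = (1 mod l) * E mod l"
    unfolding exponent_mod_def exponent_def one
  proof (rule prod_iter)
    fix c v assume "c < length w + 1" "v < l"
    then show "(if prime_below w c then iter (length w + 1)
         (\<lambda>q v. if lost_power w c q then modmul w l v c else v) v else v) =
       (if prime c then v * c ^ card (?L c) mod l else v)"
      using inner by (simp add: prime_below)
  qed (use l in simp)
  then show ?thesis by (simp add: mod_simps)
qed

lemma power_perm: "x \<in> {1..n} \<Longrightarrow> power_perm w x = (p ^^ E) x"
proof -
  assume x: "x \<in> {1..n}"
  have perm: "permutation p" using p by (auto simp: permutation_permutes)
  let ?l = "card (orbit p x)"
  have l: "0 < ?l" "?l \<le> length w + 1" "(p ^^ ?l) x = x"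
    using card_orbit_le[OF p(1) x] card_orbit_pos[OF perm] n funpow_fix_iff_card_orbit_dvd[OF perm, of ?l x]
    by auto
  have "power_perm w x = (p ^^ (E mod ?l)) x"
    using funpow_agree[OF p x] exponent_mod[OF l(1,2)] cycle_len[OF p x]
    by (simp add: power_perm_def)
  also have "\<dots> = (p ^^ E) x" using l(3) by (rule funpow_mod_eq)
  finally show ?thesis .
qed

lemma points_on_cycles:
  assumes "q permutes {1..n}" "\<And>x. x \<in> {1..n} \<Longrightarrow> f x = q x"
  shows "points_on_cycles w f L = card {x\<in>{1..n}. card (orbit q x) = L}"
proof -
  have "cycle_len w f x = card (orbit q x)" if "x \<in> {1..n}" for x
    by (rule cycle_len) (use assms that in auto)
  then have "x < length w + 1 \<and> is_point w x \<and> cycle_len w f x = L \<longleftrightarrow>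
      x \<in> {1..n} \<and> card (orbit q x) = L" for x
    using point_range[of x] by metis
  then show ?thesis unfolding points_on_cycles_def by (simp only:)
qed

lemma points_criterion:
  "(\<forall>L<length w + 1. points_on_cycles w (power_perm w) L = points_on_cycles w (target_perm w) L) \<longleftrightarrow>
    (\<exists>s \<in> generate (sym_group n) {p}. cycle_type n s = cycle_type n r)"
proof -
  have pE: "(p ^^ E) permutes {1..n}" by (rule permutes_funpow[OF p(1)])
  have zero: "{x\<in>{1..n}. card (orbit q x) = L} = {}" if "q permutes {1..n}" "\<not> L < length w + 1" for q L
    using card_orbit_le[OF that(1)] that(2) n(2) by fastforce
  have "(\<forall>L<length w + 1. points_on_cycles w (power_perm w) L = points_on_cycles w (target_perm w) L) \<longleftrightarrow>
    (\<forall>L<length w + 1. card {x\<in>{1..n}. card (orbit (p ^^ E) x) = L} = card {x\<in>{1..n}. card (orbit r x) = L})"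
    using points_on_cycles[OF pE power_perm] points_on_cycles[OF r] by simp
  also have "\<dots> \<longleftrightarrow>
    (\<forall>L. card {x\<in>{1..n}. card (orbit (p ^^ E) x) = L} = card {x\<in>{1..n}. card (orbit r x) = L})"
  proof (intro iffI allI impI)
    fix L
    assume eq: "\<forall>L<length w + 1.
      card {x\<in>{1..n}. card (orbit (p ^^ E) x) = L} = card {x\<in>{1..n}. card (orbit r x) = L}"
    show "card {x\<in>{1..n}. card (orbit (p ^^ E) x) = L} = card {x\<in>{1..n}. card (orbit r x) = L}"
    proof (cases "L < length w + 1")
      case False
      show ?thesis unfolding zero[OF pE False] zero[OF r(1) False] ..
    qed (use eq in blast)
  qed blast
  also have "\<dots> \<longleftrightarrow> cycle_type n (p ^^ E) = cycle_type n r"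
    by (rule cycle_type_eq_iff[OF pE r(1), symmetric])
  also have "\<dots> \<longleftrightarrow> (\<exists>s \<in> generate (sym_group n) {p}. cycle_type n s = cycle_type n r)"
    by (rule cycle_type_of_power[OF p(1) r(1), symmetric]) (use n in simp)
  finally show ?thesis .
qed

end

text \<open>
  A field with a value up to \<open>n\<close> is not saturated, since the word has at least \<open>n\<close> letters; so its
  text can be recovered from its value.
\<close>

lemma binary_field:
  assumes bs: "\<forall>b\<in>set bs. block_ok b" and k: "1 \<le> k" "k \<le> length (concat bs)"
    and small: "field (layout n bs) k \<le> n"
  shows "concat bs ! (k - 1) = binary (field (layout n bs) k)"
proof -
  have "concat bs ! (k - 1) \<in> set (concat bs)" by (rule nth_mem) (use k in simp)
  then have "numeral_word (concat bs ! (k - 1))" using bs by (auto simp: block_ok_def)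
  moreover have "n < length (layout n bs) + 1" by (simp add: layout_def)
  then have "field (layout n bs) k = numeral_value (concat bs ! (k - 1))"
    using field_layout[OF bs k, of n] small by (simp add: min_def split: if_splits)
  ultimately show ?thesis by (simp add: binary_numeral_value)
qed

lemma permutes_of_perm_ok:
  assumes "perm_ok w f" "letters w Tick = n" "n \<le> length w"
  shows "(\<lambda>x. if x \<in> {1..n} then f x else x) permutes {1..n}"
proof (rule bij_imp_permutes)
  have ok: "f x \<in> {1..n}" "\<And>y. y \<in> {1..n} \<Longrightarrow> f x = f y \<Longrightarrow> x = y" if "x \<in> {1..n}" for x
    using assms that by (auto simp: perm_ok_def is_point_def)
  have "inj_on f {1..n}" using ok(2) by (intro inj_onI)
  moreover from this have "f ` {1..n} = {1..n}"
    using ok(1) by (intro endo_inj_surj) auto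
  ultimately have "bij_betw f {1..n} {1..n}" by (simp add: bij_betw_def)
  then show "bij_betw (\<lambda>x. if x \<in> {1..n} then f x else x) {1..n} {1..n}"
    by (rule bij_betw_cong[THEN iffD1, rotated]) simp
qed auto

lemma perm_ok_of_permutes:
  assumes "p permutes {1..n}" "\<And>x. x \<in> {1..n} \<Longrightarrow> f x = p x" "letters w Tick = n"
  shows "perm_ok w f"
proof -
  have "f x \<in> {1..n}" if "x \<in> {1..n}" for x
    using that assms(2) permutes_in_image[OF assms(1), of x] by simp
  moreover have "x = y" if "x \<in> {1..n}" "y \<in> {1..n}" "f x = f y" for x y
    using that assms(2) permutes_inj[OF assms(1)] by (simp add: inj_eq)
  ultimately show ?thesis
    unfolding perm_ok_def is_point_def assms(3) atLeastAtMost_iff by meson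
qed

definition perm_row :: "nat \<Rightarrow> (nat \<Rightarrow> nat) \<Rightarrow> letter list list" where
  "perm_row n p = map (\<lambda>i. binary (p i)) [1..<n+1]"

lemma length_perm_row [simp]: "length (perm_row n p) = n"
  by (simp add: perm_row_def)

lemma nth_perm_row: "i < n \<Longrightarrow> perm_row n p ! i = binary (p (Suc i))"
  by (simp add: perm_row_def del: upt_Suc)

lemma block_ok_perm_row:
  assumes "p permutes {1..n}" "1 \<le> n"
  shows "block_ok (perm_row n p)"
proof -
  have "p i \<noteq> 0" if "i \<in> {1..n}" for i
    using permutes_in_image[OF assms(1), of i] that by auto
  then show ?thesis
    using assms(2) by (auto simp: block_ok_def perm_row_def intro!: numeral_word_binary)
qed

lemma encode_perm_row: "encode (n, ps, r) = layout n (map (perm_row n) (ps @ [r]))"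
  unfolding encode_layout perm_row_def ..

lemma eq_perm_row:
  assumes "length b = n" "\<And>i. i < n \<Longrightarrow> b ! i = binary (f (Suc i))"
  shows "b = perm_row n (\<lambda>x. if x \<in> {1..n} then f x else x)"
  using assms by (intro nth_equalityI) (auto simp: nth_perm_row)

lemma field_encode:
  assumes "set qs \<subseteq> {q. q permutes {1..n}}" "1 \<le> n" "j < length qs" "x \<in> {1..n}"
  shows "field (layout n (map (perm_row n) qs)) (j * n + x) = (qs ! j) x"
proof -
  let ?bs = "map (perm_row n) qs"
  have bs: "\<forall>b\<in>set ?bs. block_ok b" using assms block_ok_perm_row by auto
  have cc: "length (concat (map (perm_row n) qs)) = length qs * n" for qs
    by (induction qs) auto
  have le: "j * n + x \<le> length qs * n"
  proof -
    have "j * n + x \<le> Suc j * n" using assms(4) by simp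
    also have "\<dots> \<le> length qs * n" using assms(3) by (intro mult_le_mono1) simp
    finally show ?thesis .
  qed
  have "concat ?bs ! (j * n + x - 1) = perm_row n (qs ! j) ! (x - 1)"
    using assms(3)
  proof (induction qs arbitrary: j)
    case (Cons q qs)
    show ?case
    proof (cases j)
      case 0
      then show ?thesis using assms(4) by (auto simp: nth_append)
    next
      case (Suc i)
      then have "concat (map (perm_row n) (q # qs)) ! (j * n + x - 1) =
          concat (map (perm_row n) qs) ! (i * n + x - 1)"
        using assms(4) by (auto simp: nth_append)
      then show ?thesis using Cons Suc by simp
    qed
  qed simp
  also have "\<dots> = binary ((qs ! j) x)" using assms(4) nth_perm_row[of "x - 1" n "qs ! j"] by auto
  finally have "field (layout n ?bs) (j * n + x) = min ((qs ! j) x) (length (layout n ?bs) + 1)"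
    using field_layout[OF bs, of "j * n + x" n] assms(4) le cc[of qs] by (simp add: numeral_value_binary)
  moreover have "qs ! j permutes {1..n}" using assms(1) nth_mem[OF assms(3)] by blast
  then have "(qs ! j) x \<le> n" using permutes_in_image[of "qs ! j" "{1..n}" x] assms(4) by auto
  moreover have "n \<le> length (layout n ?bs)" by (simp add: layout_def)
  ultimately show ?thesis by simp
qed

text \<open>
  An accepted word is the code of the permutations that agree with \<open>first_perm w\<close> and
  \<open>target_perm w\<close> on the points and fix everything else. In both directions \<open>points_criterion\<close>
  translates the final comparison into the statement about cycle types.
\<close>

theorem accepted_iff: "accepted w \<longleftrightarrow> w \<in> encode ` CycleType_upto 1"
proof
  assume acc: "accepted w"
  then obtain n bs where w: "w = layout n bs" "1 \<le> n" "length bs \<in> {1, 2}"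
    and bs: "\<forall>b\<in>set bs. block_ok b" and len: "\<forall>b\<in>set bs. length b = n"
    unfolding accepted_def syntax_ok_iff by blast
  note cnt = letters_layout[OF bs, of n, folded w(1)]
  have n: "n \<le> length w" using w by (simp add: layout_def)
  define p where "p = (\<lambda>x. if x \<in> {1..n} then first_perm w x else x)"
  define r where "r = (\<lambda>x. if x \<in> {1..n} then target_perm w x else x)"
  have p: "p permutes {1..n}" and r: "r permutes {1..n}"
    unfolding p_def r_def using acc permutes_of_perm_ok[OF _ cnt(1) n] by (auto simp: accepted_def)
  have ct: "\<exists>s \<in> generate (sym_group n) {p}. cycle_type n s = cycle_type n r"
    using acc points_criterion[OF cnt(1) n p _ r] by (simp add: accepted_def p_def r_def)
  have rng: "p x \<le> n" "r x \<le> n" if "x \<in> {1..n}" for x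
    using that permutes_in_image[OF p, of x] permutes_in_image[OF r, of x] by auto
  show "w \<in> encode ` CycleType_upto 1"
  proof (cases "length bs = 1")
    case True
    then obtain b where b: "bs = [b]" by (auto simp: length_Suc_conv)
    have "p = id" using True cnt by (auto simp: p_def first_perm_def fun_eq_iff)
    have "target_perm w x = field w x" for x using True cnt by (simp add: target_perm_def)
    moreover have "b = perm_row n (\<lambda>x. if x \<in> {1..n} then target_perm w x else x)"
    proof (rule eq_perm_row)
      fix i assume i: "i < n"
      then have "field w (Suc i) \<le> n" using rng(2)[of "Suc i"] calculation by (simp add: r_def)
      then show "b ! i = binary (target_perm w (Suc i))"
        using binary_field[OF bs, of "Suc i" n] i b len w calculation by simp
    qed (use b len in simp)
    ultimately have "w = encode (n, [], r)" unfolding encode_perm_row using w b by (simp add: r_def)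
    moreover have "generate (sym_group n) {p} = generate (sym_group n) {}"
      using group.generate_one[OF sym_group_is_group, of n] group.generate_empty[OF sym_group_is_group, of n]
      by (simp add: \<open>p = id\<close> sym_group_one)
    ultimately show ?thesis
      using ct w r by (intro image_eqI[of _ _ "(n, [], r)"])
        (auto simp: CycleType_upto_def CycleType_def CycleType_instances_def sym_group_carrier)
  next
    case False
    then have "length bs = 2" using w by blast
    then obtain b1 b2 where b: "bs = [b1, b2]" by (auto simp: numeral_2_eq_2 length_Suc_conv)
    have fp: "first_perm w x = field w x" for x using b cnt by (simp add: first_perm_def)
    have tp: "target_perm w x = field w (n + x)" if "x \<in> {1..n}" for x
    proof -
      have "n + n \<le> letters w Comma" using cnt b len by simp
      also have "\<dots> \<le> length w" by (simp add: letters_eq_filter)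
      finally show ?thesis using b cnt n that by (simp add: target_perm_def cadd)
    qed
    have "b1 = perm_row n (\<lambda>x. if x \<in> {1..n} then first_perm w x else x)"
    proof (rule eq_perm_row)
      fix i assume i: "i < n"
      then have "field w (Suc i) \<le> n" using rng(1)[of "Suc i"] fp by (simp add: p_def)
      then show "b1 ! i = binary (first_perm w (Suc i))"
        using binary_field[OF bs, of "Suc i" n] i b len w fp by (simp add: nth_append)
    qed (use b len in simp)
    moreover have "b2 = perm_row n (\<lambda>x. if x \<in> {1..n} then target_perm w x else x)"
    proof (rule eq_perm_row)
      fix i assume i: "i < n"
      then have "field w (n + Suc i) \<le> n" using rng(2)[of "Suc i"] tp by (simp add: r_def)
      then show "b2 ! i = binary (target_perm w (Suc i))"
        using binary_field[OF bs, of "n + Suc i" n] i b len w tp[of "Suc i"] by (simp add: nth_append)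
    qed (use b len in simp)
    ultimately have "w = encode (n, [p], r)"
      unfolding encode_perm_row using w b by (simp add: p_def r_def)
    then show ?thesis
      using ct w p r by (intro image_eqI[of _ _ "(n, [p], r)"])
        (auto simp: CycleType_upto_def CycleType_def CycleType_instances_def sym_group_carrier)
  qed
next
  assume "w \<in> encode ` CycleType_upto 1"
  then obtain t where t: "w = encode t" "t \<in> CycleType_upto 1" by blast
  obtain n ps r where npr: "t = (n, ps, r)" by (rule prod_cases3)
  have w: "w = encode (n, ps, r)" and n1: "1 \<le> n" and ps: "length ps \<le> 1"
    and perms: "set ps \<subseteq> {q. q permutes {1..n}}" "r permutes {1..n}"
    and ct: "\<exists>s \<in> generate (sym_group n) (set ps). cycle_type n s = cycle_type n r"
    using t by (auto simp: npr CycleType_upto_def CycleType_def CycleType_instances_def sym_group_carrier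
        subset_iff simp del: encode.simps)
  let ?bs = "map (perm_row n) (ps @ [r])"
  have wl: "w = layout n ?bs" unfolding w encode_perm_row ..
  have bs: "\<forall>b\<in>set ?bs. block_ok b" using perms n1 block_ok_perm_row by auto
  note cnt = letters_layout[OF bs, of n, folded wl]
  have n: "n \<le> length w" using wl by (simp add: layout_def)
  have "length ?bs \<in> {1, 2}" using ps by (cases ps) auto
  moreover have "\<forall>b\<in>set ?bs. block_ok b \<and> length b = n" using bs by auto
  ultimately have syn: "syntax_ok w"
    unfolding syntax_ok_iff
    using wl n1 by blast
  have fld: "field w (j * n + x) = ((ps @ [r]) ! j) x" if "j < length (ps @ [r])" "x \<in> {1..n}" for j x
    unfolding wl by (rule field_encode) (use perms n1 that in auto)
  define p where "p = (if ps = [] then id else hd ps)"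
  have p: "p permutes {1..n}" using perms by (cases ps) (auto simp: p_def permutes_id)
  have fp: "first_perm w x = p x" and tp: "target_perm w x = r x" if "x \<in> {1..n}" for x
  proof -
    show "first_perm w x = p x"
      using ps cnt fld[of 0 x] that by (cases ps) (auto simp: first_perm_def p_def)
    show "target_perm w x = r x"
    proof (cases ps)
      case Nil
      then show ?thesis using cnt fld[of 0 x] that by (simp add: target_perm_def)
    next
      case (Cons q qs)
      then have q: "ps = [q]" using ps by simp
      have "n + n = letters w Comma" using cnt q by simp
      also have "\<dots> \<le> length w" by (simp add: letters_eq_filter)
      finally show ?thesis using q cnt fld[of 1 x] n that by (simp add: target_perm_def cadd)
    qed
  qed
  have "generate (sym_group n) (set ps) = generate (sym_group n) {p}"
  proof (cases ps)
    case Nil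
    then show ?thesis
      using group.generate_one[OF sym_group_is_group, of n] group.generate_empty[OF sym_group_is_group, of n]
      by (simp add: p_def sym_group_one)
  next
    case (Cons q qs)
    then show ?thesis using ps by (simp add: p_def)
  qed
  then have "\<forall>L<length w + 1. points_on_cycles w (power_perm w) L = points_on_cycles w (target_perm w) L"
    using points_criterion[OF cnt(1) n p fp perms(2) tp] ct by simp
  then show "accepted w"
    using syn perm_ok_of_permutes[OF p fp cnt(1)] perm_ok_of_permutes[OF perms(2) tp cnt(1)]
    by (simp add: accepted_def)
qed

theorem theorem1:
  shows "encode ` CycleType_upto 1 \<in> LOGSPACE"
  by (rule LOGSPACE_logp) (use logp_accepted in \<open>simp add: accepted_iff\<close>)

end
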